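(* Let $\Omega\subset\mathbb{R}^n$ be a bounded, connected, open set and $\Theta\subset\mathbb{R}^n$ a bounded open set with $\overline\Omega\subset\Theta$. Let $v$ be a weight and $Q$ a matrix function, defined on $\Theta$, such that $v\in L^1(\Omega)$ and $|Q(x)|_{\mathrm{op}}\le k\,v(x)$ for a.e. $x\in\Omega$ and some $k>0$. Let $N\in\mathbb{N}$, $f,F\in L^2(v,\Omega)$, $\mathbf G,\mathbf H,\mathbf g\in L^2(v,\Omega,\mathbb{R}^N)$, and let $\mathbf R,\mathbf S,\mathbf T$ be $N$-tuples of degenerate subunit vector fields on $\Omega$. Suppose that $\int_\Omega(\mathbf G\cdot\mathbf S\varphi+F\varphi)\,v\,dx\ge0$ for every nonnegative $\varphi\in Q\mathrm{Lip}_0(v,\Omega)$. Suppose there is a constant $S(2,1)$ such that $\big(\int_\Omega|\varphi|^2v\,dx\big)^{\frac12}\le S(2,1)\big(\int_\Omega|\sqrt Q\nabla\varphi|^2dx\big)^{\frac12}$ for all $\varphi\in Q\mathrm{Lip}_0(v,\Omega)$. Suppose also that $\rho$ is an admissible quasimetric on $\Theta$ and that the local Poincaré inequality holds on $\Theta$ with respect to $\rho$. If $F\in L^\infty(v,\Omega)$, $\mathbf H,\mathbf G\in L^\infty(v,\Omega,\mathbb{R}^N)$, and $$\max(C(\mathbf R),C(\mathbf S))\,S(2,1)\,\big(\|\mathbf G\|_{L^\infty(v,\Omega)}+\|\mathbf H\|_{L^\infty(v,\Omega)}\big)<1,$$ then the Dirichlet problem $$-v^{-1}\operatorname{div}(Q\nabla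 u)+\mathbf H\cdot\mathbf Ru+\mathbf S'\mathbf Gu+Fu=f+\mathbf T'\mathbf g\ \text{in }\Omega,\qquad u=0\ \text{on }\partial\Omega,$$ has a unique degenerate weak solution $u\in QH^{1,2}_0(v,\Omega)$.
   Context: A weight is a nonnegative measurable function $v$ with $0<v(x)<\infty$ a.e. A matrix function $Q$ is a map whose values are real, symmetric, positive semidefinite $n\times n$ matrices, with measurable entries finite a.e., and with $Q(x)$ invertible for a.e. $x$; $\sqrt Q$ is the positive semidefinite square root and $|\cdot|_{\mathrm{op}}$ the operator norm. Function spaces (for $\Omega$, and likewise for $\Theta$). $L^p(v,\Omega)$ has norm $(\int_\Omega|f|^pv\,dx)^{1/p}$ (essential supremum if $p=\infty$); $\mathbf f\in L^p(v,\Omega,\mathbb{R}^N)$ means $|\mathbf f|\in L^p(v,\Omega)$. $QL^2(\Omega)$ is the space of measurable $\mathbf f:\Omega\to\mathbb{R}^n$ with $\|\mathbf f\|_{QL^2(\Omega)}=(\int_\Omega|\sqrt Q\mathbf f|^2dx)^{1/2}<\infty$. $\mathrm{Lip}_{\mathrm{loc}}(\Omega)$: functions Lipschitz on compact subsets of $\Omega$; $\mathrm{Lip}_0(\Omega)$: Lipschitz functions with compact support in $\Omega$. $Q\mathrm{Lip}_{\mathrm{loc}}(v,\Omega)$ (resp. $Q\mathrm{Lip}_0(v,\Omega)$) is the set of $\varphi$ in $\mathrm{Lip}_{\mathrm{loc}}(\Omega)$ (resp. $\mathrm{Lip}_0(\Omega)$) with $\|\varphi\|_{QH^{1,2}(v,\Omega)}=\|\varphi\|_{L^2(v,\Omega)}+\|\nabla\varphi\|_{QL^2(\Omega)}<\infty$.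 $QH^{1,2}(v,\Omega)$ (resp. $QH^{1,2}_0(v,\Omega)$) is the closure of $\{(\varphi,\nabla\varphi)\}$, $\varphi\in Q\mathrm{Lip}_{\mathrm{loc}}(v,\Omega)$ (resp. $Q\mathrm{Lip}_0(v,\Omega)$), in $L^2(v,\Omega)\oplus QL^2(\Omega)$. Elements are pairs $(u,\mathbf g)$ with norm $\|u\|_{L^2(v,\Omega)}+\|\mathbf g\|_{QL^2(\Omega)}$; one writes $\nabla u:=\mathbf g$ by convention (it need not be a weak derivative nor be determined by $u$) and often just $u$ for the pair. Vector fields. A vector field is $V=\mathbf v\cdot\nabla$ with $\mathbf v:\Omega\to\mathbb{R}^n$ measurable, acting by $Vu=\mathbf v\cdot\nabla u$. It is degenerate subunit if there is a constant $C(V)$ with $\|Vu\|_{L^2(v,\Omega)}\le C(V)\|u\|_{QH^{1,2}(v,\Omega)}$ for all $u\in QH^{1,2}(v,\Omega)$. For $\mathbf R=(R_1,\dots,R_N)$, $C(\mathbf R)=[C(R_1)^2+\cdots+C(R_N)^2]^{1/2}$ (similarly $C(\mathbf S)$) and $\mathbf H\cdot\mathbf Ru=\sum_iH_iR_iu$; similarly $\mathbf G\cdot\mathbf S\varphi=\sum_iG_iS_i\varphi$, $\mathbf g\cdot\mathbf T\varphi=\sum_ig_iT_i\varphi$. With $S_i=\mathbf s_i\cdot\nabla$, the formal adjoint is $S_i'u=-v^{-1}\operatorname{div}(\mathbf s_iuv)$, and $\mathbf S'\mathbf Gu=\sum_iS_i'(G_iu)$; $\mathbf T'\mathbf g=\sum_iT_i'g_i$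 likewise. Degenerate weak solution: a pair $(u,\nabla u)\in QH^{1,2}_0(v,\Omega)$ such that for all $\varphi\in Q\mathrm{Lip}_0(v,\Omega)$, $$\int_\Omega Q\nabla u\cdot\nabla\varphi\,dx+\int_\Omega\mathbf H\cdot\mathbf Ru\,\varphi\,v\,dx+\int_\Omega u\,\mathbf G\cdot\mathbf S\varphi\,v\,dx+\int_\Omega Fu\varphi\,v\,dx=\int_\Omega f\varphi\,v\,dx+\int_\Omega\mathbf g\cdot\mathbf T\varphi\,v\,dx.$$ Quasimetric. A quasimetric on $\Theta$ is $\rho:\Theta\times\Theta\to[0,\infty)$, symmetric, with $\rho(x,y)=0$ iff $x=y$, and $\rho(x,y)\le\kappa(\rho(x,z)+\rho(z,y))$ for some constant $\kappa>0$; $B_\rho(x,r)=\{y\in\Theta:\rho(x,y)<r\}$. Call it admissible if: (i) $\rho$-balls are open in the standard topology; (ii) for each $x\in\Theta$ there is $\delta(x)>0$ such that $\overline{B_\rho(x,r)}\subset\Theta$ for $0<r<\delta(x)$; (iii) there is a function $\mathcal G:(0,\infty)\to(0,\infty)$ such that for every compact $K\subset\Theta$ there is $\delta>0$ such that if $0<s<r<\delta$ and $x\in K$, there are at most $\mathcal G(r/s)$ points $x_i\in B_\rho(x,r)$ such that the balls $B_\rho(x_i,s)$ are disjoint. Local Poincaré inequality on $\Theta$: there is $c\ge1$ such that for every compact $K\subset\Theta$ and $\epsilon>0$ there is $\delta>0$ so that for $0<r<\delta$, $x\in K$, and all $\varphi\in Q\mathrm{Lip}_0(v,\Theta)$, $$\Big(\int_{B_\rho(x,r)}|\varphi-\varphi_{v,B_\rho}|^2v\,dy\Big)^{\frac12}\le\epsilon\Big[\Big(\int_{B_\rho(x,cr)}|\sqrt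 Q\nabla\varphi|^2dy\Big)^{\frac12}+\Big(\int_{B_\rho(x,cr)}|\varphi|^2v\,dy\Big)^{\frac12}\Big],$$ where $\varphi_{v,B_\rho}=v(B)^{-1}\int_B\varphi\,v\,dy$, $B=B_\rho(x,r)$, $v(B)=\int_Bv\,dy$. *)

theory Defs
  imports "HOL-Analysis.Analysis" "HOL-Probability.Essential_Supremum"
begin

(* All functions are total on real^'n; a function on a set D is used only through its values on D.
   Measurable means Lebesgue measurable, and Lebesgue classes are handled through
   representatives, so that equality in the function spaces is equality almost everywhere. *)

section \<open>Weights and matrix functions\<close>

definition weight :: "(real^'n) set \<Rightarrow> (real^'n \<Rightarrow> real) \<Rightarrow> bool" where
  "weight D v \<longleftrightarrow> v \<in> borel_measurable (lebesgue_on D) \<and> (\<forall>x\<in>D. 0 \<le> v x)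
     \<and> (AE x in lebesgue_on D. 0 < v x)"

definition pos_semidef :: "real^'n^'n \<Rightarrow> bool" where
  "pos_semidef A \<longleftrightarrow> transpose A = A \<and> (\<forall>y. 0 \<le> y \<bullet> (A *v y))"

definition matrix_sqrt :: "real^'n^'n \<Rightarrow> real^'n^'n" where
  "matrix_sqrt A = (THE B. pos_semidef B \<and> B ** B = A)"

definition matrix_function :: "(real^'n) set \<Rightarrow> (real^'n \<Rightarrow> real^'n^'n) \<Rightarrow> bool" where
  "matrix_function D Q \<longleftrightarrow> (\<forall>x\<in>D. pos_semidef (Q x))
     \<and> (\<forall>i j. (\<lambda>x. Q x $ i $ j) \<in> borel_measurable (lebesgue_on D))
     \<and> (AE x in lebesgue_on D. invertible (Q x))"

abbreviation op_norm :: "real^'n^'n \<Rightarrow> real" where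
  "op_norm A \<equiv> onorm (\<lambda>y. A *v y)"

section \<open>Weighted Lebesgue spaces\<close>

text \<open>The measure \<open>v dx\<close> on \<open>D\<close>.\<close>

definition wmeasure :: "(real^'n \<Rightarrow> real) \<Rightarrow> (real^'n) set \<Rightarrow> (real^'n) measure" where
  "wmeasure v D = density (lebesgue_on D) (\<lambda>x. ennreal (v x))"

definition L2 :: "(real^'n \<Rightarrow> real) \<Rightarrow> (real^'n) set \<Rightarrow> (real^'n \<Rightarrow> 'b::euclidean_space) set" where
  "L2 v D = {f. f \<in> borel_measurable (lebesgue_on D)
               \<and> integrable (wmeasure v D) (\<lambda>x. (norm (f x))\<^sup>2)}"

definition L2_norm :: "(real^'n \<Rightarrow> real) \<Rightarrow> (real^'n) set \<Rightarrow> (real^'n \<Rightarrow> 'b::euclidean_space) \<Rightarrow> real" where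
  "L2_norm v D f = sqrt (LINT x|wmeasure v D. (norm (f x))\<^sup>2)"

definition Linf :: "(real^'n \<Rightarrow> real) \<Rightarrow> (real^'n) set \<Rightarrow> (real^'n \<Rightarrow> 'b::euclidean_space) set" where
  "Linf v D = {f. f \<in> borel_measurable (lebesgue_on D)
                 \<and> esssup (wmeasure v D) (\<lambda>x. ereal (norm (f x))) < \<infinity>}"

definition Linf_norm :: "(real^'n \<Rightarrow> real) \<Rightarrow> (real^'n) set \<Rightarrow> (real^'n \<Rightarrow> 'b::euclidean_space) \<Rightarrow> real" where
  "Linf_norm v D f = real_of_ereal (esssup (wmeasure v D) (\<lambda>x. ereal (norm (f x))))"

definition QL2 :: "(real^'n \<Rightarrow> real^'n^'n) \<Rightarrow> (real^'n) set \<Rightarrow> (real^'n \<Rightarrow> real^'n) set" where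
  "QL2 Q D = {w. w \<in> borel_measurable (lebesgue_on D)
                \<and> integrable (lebesgue_on D) (\<lambda>x. (norm (matrix_sqrt (Q x) *v w x))\<^sup>2)}"

definition QL2_norm :: "(real^'n \<Rightarrow> real^'n^'n) \<Rightarrow> (real^'n) set \<Rightarrow> (real^'n \<Rightarrow> real^'n) \<Rightarrow> real" where
  "QL2_norm Q D w = sqrt (LINT x|lebesgue_on D. (norm (matrix_sqrt (Q x) *v w x))\<^sup>2)"

section \<open>Degenerate Sobolev spaces\<close>

text \<open>The vector of classical partial derivatives. It is applied to locally Lipschitz functions
  on open sets, where it exists almost everywhere by Rademacher's theorem; its (arbitrary) value
  at the remaining points is immaterial.\<close>

definition grad :: "(real^'n \<Rightarrow> real) \<Rightarrow> real^'n \<Rightarrow> real^'n" where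
  "grad \<phi> x = (\<chi> i. deriv (\<lambda>t. \<phi> (x + t *\<^sub>R axis i 1)) 0)"

definition Lip_loc :: "(real^'n) set \<Rightarrow> (real^'n \<Rightarrow> real) set" where
  "Lip_loc D = {\<phi>. \<forall>K. compact K \<and> K \<subseteq> D \<longrightarrow> (\<exists>L. L-lipschitz_on K \<phi>)}"

definition Lip0 :: "(real^'n) set \<Rightarrow> (real^'n \<Rightarrow> real) set" where
  "Lip0 D = {\<phi>. (\<exists>L. L-lipschitz_on D \<phi>)
               \<and> compact (closure {x\<in>D. \<phi> x \<noteq> 0}) \<and> closure {x\<in>D. \<phi> x \<noteq> 0} \<subseteq> D}"

definition QLip_loc ::
  "(real^'n \<Rightarrow> real) \<Rightarrow> (real^'n \<Rightarrow> real^'n^'n) \<Rightarrow> (real^'n) set \<Rightarrow> (real^'n \<Rightarrow> real) set" where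
  "QLip_loc v Q D = {\<phi>\<in>Lip_loc D. \<phi> \<in> L2 v D \<and> grad \<phi> \<in> QL2 Q D}"

definition QLip0 ::
  "(real^'n \<Rightarrow> real) \<Rightarrow> (real^'n \<Rightarrow> real^'n^'n) \<Rightarrow> (real^'n) set \<Rightarrow> (real^'n \<Rightarrow> real) set" where
  "QLip0 v Q D = {\<phi>\<in>Lip0 D. \<phi> \<in> L2 v D \<and> grad \<phi> \<in> QL2 Q D}"

definition QH_norm ::
  "(real^'n \<Rightarrow> real) \<Rightarrow> (real^'n \<Rightarrow> real^'n^'n) \<Rightarrow> (real^'n) set
    \<Rightarrow> (real^'n \<Rightarrow> real) \<times> (real^'n \<Rightarrow> real^'n) \<Rightarrow> real" where
  "QH_norm v Q D = (\<lambda>(u, w). L2_norm v D u + QL2_norm Q D w)"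

text \<open>The closure of the graph of \<open>grad\<close> over \<open>\<Phi>\<close> in \<open>L2 v D \<oplus> QL2 Q D\<close>.\<close>

definition QH_closure ::
  "(real^'n \<Rightarrow> real) \<Rightarrow> (real^'n \<Rightarrow> real^'n^'n) \<Rightarrow> (real^'n) set \<Rightarrow> (real^'n \<Rightarrow> real) set
    \<Rightarrow> ((real^'n \<Rightarrow> real) \<times> (real^'n \<Rightarrow> real^'n)) set" where
  "QH_closure v Q D \<Phi> = {(u, w). u \<in> L2 v D \<and> w \<in> QL2 Q D \<and>
     (\<forall>\<epsilon>>0. \<exists>\<phi>\<in>\<Phi>. QH_norm v Q D (\<lambda>x. u x - \<phi> x, \<lambda>x. w x - grad \<phi> x) < \<epsilon>)}"

definition QH12 ::
  "(real^'n \<Rightarrow> real) \<Rightarrow> (real^'n \<Rightarrow> real^'n^'n) \<Rightarrow> (real^'n) set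
    \<Rightarrow> ((real^'n \<Rightarrow> real) \<times> (real^'n \<Rightarrow> real^'n)) set" where
  "QH12 v Q D = QH_closure v Q D (QLip_loc v Q D)"

definition QH12_0 ::
  "(real^'n \<Rightarrow> real) \<Rightarrow> (real^'n \<Rightarrow> real^'n^'n) \<Rightarrow> (real^'n) set
    \<Rightarrow> ((real^'n \<Rightarrow> real) \<times> (real^'n \<Rightarrow> real^'n)) set" where
  "QH12_0 v Q D = QH_closure v Q D (QLip0 v Q D)"

section \<open>Degenerate subunit vector fields\<close>

text \<open>A vector field \<open>s \<cdot> \<nabla>\<close> is given by its coefficient \<open>s\<close>. It acts on a pair \<open>(u, w)\<close>
  through the formal gradient \<open>w\<close>. An \<open>N\<close>-tuple of vector fields is indexed by a finite type.\<close>

definition subunit_const ::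
  "(real^'n \<Rightarrow> real) \<Rightarrow> (real^'n \<Rightarrow> real^'n^'n) \<Rightarrow> (real^'n) set
    \<Rightarrow> (real^'n \<Rightarrow> real^'n) \<Rightarrow> real \<Rightarrow> bool" where
  "subunit_const v Q D s C \<longleftrightarrow> s \<in> borel_measurable (lebesgue_on D) \<and>
     (\<forall>(u, w)\<in>QH12 v Q D. (\<lambda>x. s x \<bullet> w x) \<in> L2 v D \<and>
        L2_norm v D (\<lambda>x. s x \<bullet> w x) \<le> C * QH_norm v Q D (u, w))"

definition degenerate_subunit ::
  "(real^'n \<Rightarrow> real) \<Rightarrow> (real^'n \<Rightarrow> real^'n^'n) \<Rightarrow> (real^'n) set \<Rightarrow> (real^'n \<Rightarrow> real^'n) \<Rightarrow> bool" where
  "degenerate_subunit v Q D s \<longleftrightarrow> (\<exists>C. subunit_const v Q D s C)"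

definition vfields :: "('m \<Rightarrow> real^'n \<Rightarrow> real^'n) \<Rightarrow> (real^'n \<Rightarrow> real^'n) \<Rightarrow> real^'n \<Rightarrow> real^'m::finite" where
  "vfields R w x = (\<chi> i. R i x \<bullet> w x)"

definition tuple_const :: "('m::finite \<Rightarrow> real) \<Rightarrow> real" where
  "tuple_const C = sqrt (\<Sum>i\<in>UNIV. (C i)\<^sup>2)"

section \<open>Degenerate weak solutions\<close>

text \<open>\<open>(u, w)\<close>, with \<open>w\<close> in the role of \<open>\<nabla>u\<close>, solves
  \<open>- v\<inverse> div (Q \<nabla>u) + H \<cdot> R u + S' G u + F u = f + T' g\<close> in \<open>D\<close>, \<open>u = 0\<close> on \<open>\<partial>D\<close>.\<close>

definition degenerate_weak_solution ::
  "(real^'n) set \<Rightarrow> (real^'n \<Rightarrow> real) \<Rightarrow> (real^'n \<Rightarrow> real^'n^'n)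
    \<Rightarrow> (real^'n \<Rightarrow> real^'m::finite) \<Rightarrow> ('m \<Rightarrow> real^'n \<Rightarrow> real^'n)
    \<Rightarrow> (real^'n \<Rightarrow> real^'m) \<Rightarrow> ('m \<Rightarrow> real^'n \<Rightarrow> real^'n) \<Rightarrow> (real^'n \<Rightarrow> real)
    \<Rightarrow> (real^'n \<Rightarrow> real) \<Rightarrow> (real^'n \<Rightarrow> real^'m) \<Rightarrow> ('m \<Rightarrow> real^'n \<Rightarrow> real^'n)
    \<Rightarrow> (real^'n \<Rightarrow> real) \<times> (real^'n \<Rightarrow> real^'n) \<Rightarrow> bool" where
  "degenerate_weak_solution D v Q H R G S F f g T = (\<lambda>(u, w).
     (u, w) \<in> QH12_0 v Q D \<and>
     (\<forall>\<phi>\<in>QLip0 v Q D.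
        (LINT x|lebesgue_on D. (Q x *v w x) \<bullet> grad \<phi> x)
        + (LINT x|wmeasure v D. (H x \<bullet> vfields R w x) * \<phi> x)
        + (LINT x|wmeasure v D. u x * (G x \<bullet> vfields S (grad \<phi>) x))
        + (LINT x|wmeasure v D. F x * u x * \<phi> x)
        = (LINT x|wmeasure v D. f x * \<phi> x)
        + (LINT x|wmeasure v D. g x \<bullet> vfields T (grad \<phi>) x)))"

section \<open>Quasimetrics and the local Poincare inequality\<close>

definition quasimetric :: "(real^'n) set \<Rightarrow> (real^'n \<Rightarrow> real^'n \<Rightarrow> real) \<Rightarrow> bool" where
  "quasimetric D \<rho> \<longleftrightarrow>
     (\<forall>x\<in>D. \<forall>y\<in>D. 0 \<le> \<rho> x y \<and> \<rho> x y = \<rho> y x \<and> (\<rho> x y = 0 \<longleftrightarrow> x = y)) \<and>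
     (\<exists>\<kappa>>0. \<forall>x\<in>D. \<forall>y\<in>D. \<forall>z\<in>D. \<rho> x y \<le> \<kappa> * (\<rho> x z + \<rho> z y))"

definition qball :: "(real^'n) set \<Rightarrow> (real^'n \<Rightarrow> real^'n \<Rightarrow> real) \<Rightarrow> real^'n \<Rightarrow> real \<Rightarrow> (real^'n) set" where
  "qball D \<rho> x r = {y\<in>D. \<rho> x y < r}"

definition admissible_quasimetric :: "(real^'n) set \<Rightarrow> (real^'n \<Rightarrow> real^'n \<Rightarrow> real) \<Rightarrow> bool" where
  "admissible_quasimetric D \<rho> \<longleftrightarrow> quasimetric D \<rho> \<and>
     (\<forall>x\<in>D. \<forall>r>0. open (qball D \<rho> x r)) \<and>
     (\<forall>x\<in>D. \<exists>\<delta>>0. \<forall>r. 0 < r \<and> r < \<delta> \<longrightarrow> closure (qball D \<rho> x r) \<subseteq> D) \<and>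
     (\<exists>\<G>::real \<Rightarrow> real. (\<forall>t>0. 0 < \<G> t) \<and>
        (\<forall>K. compact K \<and> K \<subseteq> D \<longrightarrow>
          (\<exists>\<delta>>0. \<forall>s r. 0 < s \<and> s < r \<and> r < \<delta> \<longrightarrow>
            (\<forall>x\<in>K. \<forall>X. X \<subseteq> qball D \<rho> x r \<and> disjoint_family_on (\<lambda>y. qball D \<rho> y s) X \<longrightarrow>
              finite X \<and> real (card X) \<le> \<G> (r / s)))))"

text \<open>The average of \<open>\<phi>\<close> over \<open>B\<close> with respect to \<open>v dx\<close>; it is \<open>0\<close> if
  \<open>v(B) = \<infinity>\<close>.\<close>

definition waverage :: "(real^'n \<Rightarrow> real) \<Rightarrow> (real^'n) set \<Rightarrow> (real^'n \<Rightarrow> real) \<Rightarrow> real" where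
  "waverage v B \<phi> = (LINT y|wmeasure v B. \<phi> y) / measure (wmeasure v B) B"

text \<open>The right-hand side is finite for every \<open>\<phi> \<in> QLip0 v Q D\<close>; membership in \<open>L2\<close> expresses that
  the integral on the left-hand side is finite as well.\<close>

definition local_poincare ::
  "(real^'n) set \<Rightarrow> (real^'n \<Rightarrow> real^'n \<Rightarrow> real) \<Rightarrow> (real^'n \<Rightarrow> real)
    \<Rightarrow> (real^'n \<Rightarrow> real^'n^'n) \<Rightarrow> bool" where
  "local_poincare D \<rho> v Q \<longleftrightarrow>
     (\<exists>c\<ge>1. \<forall>K. compact K \<and> K \<subseteq> D \<longrightarrow> (\<forall>\<epsilon>>0. \<exists>\<delta>>0. \<forall>r. 0 < r \<and> r < \<delta> \<longrightarrow>
        (\<forall>x\<in>K. \<forall>\<phi>\<in>QLip0 v Q D.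
           (\<lambda>y. \<phi> y - waverage v (qball D \<rho> x r) \<phi>) \<in> L2 v (qball D \<rho> x r) \<and>
           L2_norm v (qball D \<rho> x r) (\<lambda>y. \<phi> y - waverage v (qball D \<rho> x r) \<phi>)
             \<le> \<epsilon> * (QL2_norm Q (qball D \<rho> x (c * r)) (grad \<phi>)
                    + L2_norm v (qball D \<rho> x (c * r)) \<phi>))))"

end

theory Submission
  imports Defs "HOL-Library.Function_Algebras"
begin

text \<open>
  The boundary value problem is solved by the Lax--Milgram theorem. Let \<open>W\<close> be the space
  \<open>QH12_0\<close> with the inner product of \<open>L2 v \<oplus> QL2\<close>. The left-hand side of the weak
  equation is a bounded bilinear form on \<open>W\<close> and the right-hand side a bounded linear functional,
  because degenerate subunit fields map \<open>W\<close> into \<open>L2 v\<close> and the coefficients of the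
  first and zeroth order terms are bounded. What has to be proved is that the form is coercive.

  The difficulty is that a subunit constant bounds \<open>V\<phi>\<close> by the full norm
  \<open>\<parallel>\<phi>\<parallel> + \<parallel>\<surd>Q \<nabla>\<phi>\<parallel>\<close>, whereas the smallness hypothesis leaves room only
  for \<open>\<parallel>\<surd>Q \<nabla>\<phi>\<parallel>\<close>. That norm alone is a bound as well (\<open>subunit_gradient_bound\<close>): the inequality
  may be tested with the rapidly oscillating functions \<open>sin (l \<phi>) / l\<close> and
  \<open>cos (l \<phi>) / l\<close>. Their gradients are \<open>cos (l \<phi>) \<nabla>\<phi>\<close> and \<open>- sin (l \<phi>) \<nabla>\<phi>\<close>, so the
  squares of \<open>\<parallel>V \<sqdot>\<parallel>\<close> of the two functions add up to \<open>\<parallel>V\<phi>\<parallel>\<^sup>2\<close>, those of the gradient norms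
  add up to \<open>\<parallel>\<surd>Q \<nabla>\<phi>\<parallel>\<^sup>2\<close>, and the functions themselves are bounded by \<open>1 / l\<close>, hence of norm
  \<open>O(1 / l)\<close> since \<open>v\<close> is integrable. Letting \<open>l\<close> tend to infinity removes the term
  of order zero.

  Coercivity (\<open>form_coercive\<close>) then follows by inserting \<open>\<phi>\<^sup>2\<close> into the sign condition. As
  \<open>\<nabla>\<phi>\<^sup>2 = 2 \<phi> \<nabla>\<phi>\<close>, it says that twice the \<open>G\<close>-term plus the \<open>F\<close>-term of the form at
  \<open>(\<phi>, \<phi>)\<close> is nonnegative, so that together these two terms are at least minus the \<open>G\<close>-term. The
  \<open>H\<close>-term and the \<open>G\<close>-term are bounded by their coefficient times
  \<open>C \<parallel>\<surd>Q \<nabla>\<phi>\<parallel> \<parallel>\<phi>\<parallel> \<le> C S21 \<parallel>\<surd>Q \<nabla>\<phi>\<parallel>\<^sup>2\<close>, and the smallness hypothesis leaves a positive multiple of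
  \<open>\<parallel>\<surd>Q \<nabla>\<phi>\<parallel>\<^sup>2\<close>, which controls the norm of \<open>W\<close> by the Sobolev inequality.

  The remaining sections provide the analysis on which this rests: the square root of a
  positive semidefinite matrix exists and is unique, so \<open>\<bar>\<surd>Q y\<bar>\<^sup>2 = Q y \<bullet> y\<close>; locally Lipschitz
  functions have partial derivatives almost everywhere, so \<open>grad\<close> obeys the rules of calculus
  up to null sets; and \<open>L2 v \<oplus> QL2\<close> is complete.
\<close>

section \<open>Square roots of positive semidefinite matrices\<close>

text \<open>The first-order condition at the minimum \<open>t = 0\<close>: if \<open>b \<noteq> 0\<close>, then a small multiple of \<open>- b\<close> makes the
  linear term dominate.\<close>

lemma quadratic_nonneg_imp_linear_coeff_zero:
  fixes b c :: real
  assumes "\<And>t. 0 \<le> 2 * t * b + t\<^sup>2 * c"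
  shows "b = 0"
proof (rule ccontr)
  assume b: "b \<noteq> 0"
  define d where "d = \<bar>c\<bar> + 1"
  have d: "d > 0" "c \<le> d" by (auto simp: d_def)
  have "0 \<le> 2 * (- b / d) * b + (- b / d)\<^sup>2 * c" by (rule assms)
  also have "\<dots> \<le> 2 * (- b / d) * b + (- b / d)\<^sup>2 * d"
    using d by (intro add_left_mono mult_left_mono) auto
  also have "\<dots> = - b\<^sup>2 / d" using d by (simp add: field_simps power2_eq_square)
  also have "\<dots> < 0" using b d by simp
  finally show False by simp
qed

text \<open>A maximiser \<open>e\<close> of \<open>y \<bullet> f y\<close> on the unit sphere of \<open>V\<close> is an eigenvector: with \<open>l\<close> the
  maximum, the quadratic form \<open>l (y \<bullet> y) - y \<bullet> f y\<close> is nonnegative on \<open>V\<close> and vanishes at \<open>e\<close>, so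
  its derivative at \<open>e\<close> in the direction \<open>l e - f e\<close> vanishes, which is twice the squared length of
  \<open>l e - f e\<close>.\<close>

lemma self_adjoint_eigenvector_in_subspace:
  fixes f :: "'a::euclidean_space \<Rightarrow> 'a"
  assumes lin: "linear f" and sa: "\<And>x y. f x \<bullet> y = x \<bullet> f y"
    and V: "subspace V" "\<And>x. x \<in> V \<Longrightarrow> f x \<in> V" and ne: "\<exists>x\<in>V. x \<noteq> 0"
  shows "\<exists>e\<in>V. norm e = 1 \<and> (\<exists>l. f e = l *\<^sub>R e)"
proof -
  interpret linear f by fact
  define S where "S = V \<inter> sphere 0 1"
  have "compact S"
    unfolding S_def by (intro closed_Int_compact closed_subspace V) auto
  moreover have "S \<noteq> {}"
  proof -
    obtain x where x: "x \<in> V" "x \<noteq> 0" using ne by auto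
    then have "(1 / norm x) *\<^sub>R x \<in> S" by (auto simp: S_def subspace_scale V)
    then show ?thesis by auto
  qed
  moreover have "continuous_on S (\<lambda>x. x \<bullet> f x)"
    by (intro continuous_on_inner continuous_on_id linear_continuous_on linear_conv_bounded_linear[THEN iffD1, OF lin])
  ultimately obtain e where e: "e \<in> S" and max: "\<And>y. y \<in> S \<Longrightarrow> y \<bullet> f y \<le> e \<bullet> f e"
    using continuous_attains_sup[of S "\<lambda>x. x \<bullet> f x"] by blast
  define l where "l = e \<bullet> f e"
  have ee: "e \<bullet> e = 1" and eV: "e \<in> V" "norm e = 1" using e by (auto simp: S_def dot_square_norm)
  have q: "0 \<le> l * (y \<bullet> y) - y \<bullet> f y" if "y \<in> V" for y
  proof (cases "y = 0")
    case False
    have "(1 / norm y) *\<^sub>R y \<in> S" using False that by (auto simp: S_def subspace_scale V)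
    from max[OF this] have "(y \<bullet> f y) / (norm y)\<^sup>2 \<le> l"
      by (simp add: scale l_def power2_eq_square)
    then show ?thesis using False by (simp add: divide_simps dot_square_norm mult.commute)
  qed (simp add: zero)
  define z where "z = l *\<^sub>R e - f e"
  have zV: "z \<in> V" unfolding z_def by (intro subspace_diff subspace_scale V eV)
  have "0 \<le> 2 * t * (z \<bullet> z) + t\<^sup>2 * (l * (z \<bullet> z) - z \<bullet> f z)" for t
  proof -
    have "0 \<le> l * ((e + t *\<^sub>R z) \<bullet> (e + t *\<^sub>R z)) - (e + t *\<^sub>R z) \<bullet> f (e + t *\<^sub>R z)"
      by (intro q subspace_add subspace_scale V eV zV)
    also have "\<dots> = 2 * t * (z \<bullet> z) + t\<^sup>2 * (l * (z \<bullet> z) - z \<bullet> f z)"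
    proof -
      have zz: "z \<bullet> z = l * (e \<bullet> z) - f e \<bullet> z" by (subst (1) z_def) (simp add: inner_diff_left)
      have c: "z \<bullet> e = e \<bullet> z" "e \<bullet> f z = f e \<bullet> z" "z \<bullet> f e = f e \<bullet> z" "e \<bullet> f e = l"
        by (metis inner_commute, metis sa, metis inner_commute, simp add: l_def)
      have "l * ((e + t *\<^sub>R z) \<bullet> (e + t *\<^sub>R z)) - (e + t *\<^sub>R z) \<bullet> f (e + t *\<^sub>R z)
        = 2 * t * (l * (e \<bullet> z) - f e \<bullet> z) + t\<^sup>2 * (l * (z \<bullet> z) - z \<bullet> f z)"
        by (simp add: add scale inner_add_left inner_add_right c ee power2_eq_square algebra_simps)
      then show ?thesis by (simp only: zz[symmetric])
    qed
    finally show ?thesis .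
  qed
  from quadratic_nonneg_imp_linear_coeff_zero[OF this] have "f e = l *\<^sub>R e"
    by (simp add: z_def)
  then show ?thesis using eV by blast
qed

text \<open>Take an orthonormal set of eigenvectors of maximal size. Its orthogonal complement is invariant
  under \<open>f\<close>, so if it were nontrivial it would contain one more eigenvector.\<close>

lemma self_adjoint_eigenbasis:
  fixes f :: "'a::euclidean_space \<Rightarrow> 'a"
  assumes lin: "linear f" and sa: "\<And>x y. f x \<bullet> y = x \<bullet> f y"
  obtains E l where "finite E" "pairwise orthogonal E" "\<And>e. e \<in> E \<Longrightarrow> norm e = 1"
    "span E = UNIV" "\<And>e. e \<in> E \<Longrightarrow> f e = l e *\<^sub>R e"
proof -
  define P where "P E \<longleftrightarrow> pairwise orthogonal E \<and> (\<forall>e\<in>E. norm e = 1 \<and> (\<exists>l. f e = l *\<^sub>R e))"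
    for E
  have ind: "independent E" if "P E" for E
    using that by (intro pairwise_orthogonal_independent) (auto simp: P_def)
  have card: "finite E \<and> card E \<le> DIM('a)" if "P E" for E
    using independent_bound[OF ind[OF that]] by auto
  obtain E where E: "P E" and Emax: "\<And>E'. P E' \<Longrightarrow> card E' \<le> card E"
  proof -
    have "\<exists>E. P E \<and> (\<forall>y. P y \<longrightarrow> card y \<le> card E)"
      by (rule ex_has_greatest_nat[of P "{}" card "Suc DIM('a)"])
        (use card in \<open>auto simp: P_def less_Suc_eq_le\<close>)
    then show ?thesis using that by blast
  qed
  have "span E = UNIV"
  proof (rule ccontr)
    assume "span E \<noteq> UNIV"
    then obtain a where a: "a \<noteq> 0" "\<And>x. x \<in> span E \<Longrightarrow> a \<bullet> x = 0"
      by (meson span_not_UNIV_orthogonal top.not_eq_extremum)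
    define V where "V = {x. \<forall>e\<in>E. e \<bullet> x = 0}"
    have V: "subspace V" by (auto simp: V_def subspace_def inner_add_right)
    have fV: "f x \<in> V" if "x \<in> V" for x
      unfolding V_def
    proof safe
      fix e assume e: "e \<in> E"
      then obtain l where "f e = l *\<^sub>R e" using E by (auto simp: P_def)
      then show "e \<bullet> f x = 0" using that e by (simp add: sa[symmetric] V_def)
    qed
    have "\<exists>x\<in>V. x \<noteq> 0"
      using a by (intro bexI[of _ a]) (auto simp: V_def span_base inner_commute)
    from self_adjoint_eigenvector_in_subspace[OF lin sa V fV this]
    obtain e l where e: "e \<in> V" "norm e = 1" "f e = l *\<^sub>R e" by auto
    have "e \<notin> E" using e by (auto simp: V_def)
    moreover have "P (insert e E)"
      using E e unfolding P_def
      by (auto simp: pairwise_insert V_def orthogonal_def inner_commute)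
    ultimately show False using Emax[of "insert e E"] card[OF E] by simp
  qed
  moreover have "\<exists>l. \<forall>e\<in>E. f e = l e *\<^sub>R e" using E by (intro bchoice) (auto simp: P_def)
  then obtain l where "\<And>e. e \<in> E \<Longrightarrow> f e = l e *\<^sub>R e" by blast
  ultimately show ?thesis using that[of E l] E card[OF E] by (auto simp: P_def)
qed

lemma pos_semidef_self_adjoint:
  assumes "pos_semidef A" shows "(A *v x) \<bullet> y = x \<bullet> (A *v y)"
  using assms by (metis pos_semidef_def dot_lmul_matrix vector_transpose_matrix)

lemma pos_semidef_sqrt_exists:
  fixes A :: "real^'n^'n"
  assumes A: "pos_semidef A"
  shows "\<exists>B. pos_semidef B \<and> B ** B = A"
proof -
  obtain E l where E: "finite E" "pairwise orthogonal E" "\<And>e. e \<in> E \<Longrightarrow> norm e = 1"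
    "span E = UNIV" "\<And>e. e \<in> E \<Longrightarrow> A *v e = l e *\<^sub>R e"
    using self_adjoint_eigenbasis[of "(*v) A"] pos_semidef_self_adjoint[OF A] by blast
  have l: "0 \<le> l e" if "e \<in> E" for e
  proof -
    have "0 \<le> e \<bullet> (A *v e)" using A by (simp add: pos_semidef_def)
    then show ?thesis using E(3,5)[OF that] by (simp add: dot_square_norm)
  qed
  define g where "g x = (\<Sum>e\<in>E. (sqrt (l e) * (e \<bullet> x)) *\<^sub>R e)" for x
  have lin: "linear g"
    unfolding g_def by (rule linearI)
      (simp_all add: inner_add_right algebra_simps sum.distrib scaleR_sum_right)
  have ge: "g e = sqrt (l e) *\<^sub>R e" if "e \<in> E" for e
  proof -
    have "g e = (\<Sum>e'\<in>E. if e' = e then sqrt (l e) *\<^sub>R e else 0)"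
      unfolding g_def
    proof (rule sum.cong)
      fix e' assume "e' \<in> E"
      then show "(sqrt (l e') * (e' \<bullet> e)) *\<^sub>R e' = (if e' = e then sqrt (l e) *\<^sub>R e else 0)"
        using E that by (auto simp: pairwise_def orthogonal_def dot_square_norm)
    qed simp
    then show ?thesis using E(1) that by simp
  qed
  define B where "B = matrix g"
  have Bv: "B *v x = g x" for x unfolding B_def by (metis lin matrix_vector_mul(2))
  have "(B ** B) *v x = A *v x" for x
  proof (rule linear_eq_on_span[where B = E and f = "\<lambda>x. (B ** B) *v x"])
    show "(B ** B) *v e = A *v e" if "e \<in> E" for e
      using that l E by (simp add: matrix_vector_mul_assoc[symmetric] Bv ge linear_scale[OF lin])
  qed (use E in auto)
  then have "B ** B = A" by (simp add: matrix_eq)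
  moreover have "pos_semidef B"
    unfolding pos_semidef_def
  proof
    have "(B *v x) \<bullet> y = x \<bullet> (B *v y)" for x y
      unfolding Bv g_def inner_sum_left inner_sum_right
      by (intro sum.cong) (auto simp: inner_commute)
    then have "x \<bullet> (transpose B *v y) = x \<bullet> (B *v y)" for x y
      by (metis dot_lmul_matrix vector_transpose_matrix transpose_transpose inner_commute)
    then have "transpose B *v y = B *v y" for y
      using vector_eq_ldot[of "transpose B *v y" "B *v y"] by simp
    then show "transpose B = B" by (simp add: matrix_eq)
    have "y \<bullet> (B *v y) = (\<Sum>e\<in>E. sqrt (l e) * (e \<bullet> y)\<^sup>2)" for y
      unfolding Bv g_def inner_sum_right
      by (intro sum.cong) (auto simp: power2_eq_square inner_commute[of y])
    then show "\<forall>y. 0 \<le> y \<bullet> (B *v y)"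
      by (simp add: sum_nonneg l)
  qed
  ultimately show ?thesis by blast
qed

text \<open>If \<open>B e = l e\<close>, then \<open>C\<^sup>2 e = l\<^sup>2 e\<close>, so that \<open>z = C e - l e\<close> satisfies \<open>C z = - l z\<close>. A positive
  semidefinite \<open>C\<close> has no negative eigenvalue, hence \<open>z = 0\<close> if \<open>l > 0\<close>; for \<open>l = 0\<close> the length of
  \<open>C e\<close> is zero. Thus \<open>B\<close> and \<open>C\<close> agree on an eigenbasis of \<open>B\<close>.\<close>

lemma pos_semidef_sqrt_unique:
  fixes A B C :: "real^'n^'n"
  assumes B: "pos_semidef B" "B ** B = A" and C: "pos_semidef C" "C ** C = A"
  shows "B = C"
proof -
  obtain E l where "finite E" "pairwise orthogonal E" and E: "\<And>e. e \<in> E \<Longrightarrow> norm e = 1"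
    "span E = UNIV" "\<And>e. e \<in> E \<Longrightarrow> B *v e = l e *\<^sub>R e"
    using self_adjoint_eigenbasis[of "(*v) B"] pos_semidef_self_adjoint[OF B(1)] by blast
  have l: "0 \<le> l e" if "e \<in> E" for e
  proof -
    have "0 \<le> e \<bullet> (B *v e)" using B by (simp add: pos_semidef_def)
    then show ?thesis using E(1,3)[OF that] by (simp add: dot_square_norm)
  qed
  have "C *v e = B *v e" if e: "e \<in> E" for e
  proof -
    have CC: "C *v (C *v e) = (l e * l e) *\<^sub>R e"
      using e by (simp add: matrix_vector_mul_assoc C B(2)[symmetric])
        (simp add: matrix_vector_mul_assoc[symmetric] E matrix_vector_mult_scaleR)
    show ?thesis
    proof (cases "l e = 0")
      case True
      have "(C *v e) \<bullet> (C *v e) = 0"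
        using CC True by (simp add: pos_semidef_self_adjoint[OF C(1)])
      then show ?thesis using e True by (simp add: E)
    next
      case False
      define z where "z = C *v e - l e *\<^sub>R e"
      have "C *v z = - l e *\<^sub>R z"
        by (simp add: z_def matrix_vector_mult_diff_distrib CC matrix_vector_mult_scaleR algebra_simps)
      moreover have "0 \<le> z \<bullet> (C *v z)" using C by (simp add: pos_semidef_def)
      ultimately have "l e * (z \<bullet> z) \<le> 0" by simp
      then have "z \<bullet> z \<le> 0" using False l[OF e] by (simp add: mult_le_0_iff)
      then have "z = 0" by (metis inner_ge_zero inner_eq_zero_iff antisym)
      then show ?thesis using e by (simp add: z_def E)
    qed
  qed
  then have "C *v x = B *v x" for x
    using linear_eq_on_span[of "(*v) C" "(*v) B" E x, OF matrix_vector_mul_linear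
        matrix_vector_mul_linear] E(2) by simp
  then show ?thesis by (simp add: matrix_eq)
qed

lemma matrix_sqrt:
  assumes "pos_semidef A"
  shows "pos_semidef (matrix_sqrt A)" "matrix_sqrt A ** matrix_sqrt A = A"
proof -
  have "\<exists>!B. pos_semidef B \<and> B ** B = A"
    using pos_semidef_sqrt_exists[OF assms] pos_semidef_sqrt_unique by blast
  from theI'[OF this] show "pos_semidef (matrix_sqrt A)" "matrix_sqrt A ** matrix_sqrt A = A"
    by (auto simp: matrix_sqrt_def)
qed

lemma norm_matrix_sqrt_square:
  assumes "pos_semidef A"
  shows "(norm (matrix_sqrt A *v y))\<^sup>2 = (A *v y) \<bullet> y"
proof -
  have "(norm (matrix_sqrt A *v y))\<^sup>2 = (matrix_sqrt A *v (matrix_sqrt A *v y)) \<bullet> y"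
    by (simp add: power2_norm_eq_inner pos_semidef_self_adjoint[OF matrix_sqrt(1)[OF assms]])
  then show ?thesis by (simp add: matrix_vector_mul_assoc matrix_sqrt(2)[OF assms])
qed

lemma pos_semidef_invertible_pos:
  assumes A: "pos_semidef A" and "invertible A" and "y \<noteq> 0"
  shows "0 < (A *v y) \<bullet> y"
proof -
  have "A *v y \<noteq> 0"
    by (metis assms(2,3) inj_matrix_vector_mult injD matrix_vector_mult_0_right)
  then have "matrix_sqrt A *v y \<noteq> 0"
    by (metis matrix_vector_mul_assoc matrix_sqrt(2)[OF A] matrix_vector_mult_0_right)
  then have "0 < (norm (matrix_sqrt A *v y))\<^sup>2" by simp
  then show ?thesis unfolding norm_matrix_sqrt_square[OF A] .
qed

section \<open>The Lax--Milgram theorem for a semi-inner product\<close>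

text \<open>Elements of the function spaces are functions rather than classes of functions, so the inner
  product is only semidefinite. Keeping it that way avoids quotients; the price is that objects
  such as the Riesz representative are determined up to elements of norm zero.\<close>

locale semi_inner_space =
  fixes V :: "'a::real_vector set" and ip :: "'a \<Rightarrow> 'a \<Rightarrow> real"
  assumes V: "subspace V"
    and ip_sym: "\<lbrakk>x \<in> V; y \<in> V\<rbrakk> \<Longrightarrow> ip x y = ip y x"
    and ip_add: "\<lbrakk>x \<in> V; y \<in> V; z \<in> V\<rbrakk> \<Longrightarrow> ip (x + y) z = ip x z + ip y z"
    and ip_scale: "\<lbrakk>x \<in> V; y \<in> V\<rbrakk> \<Longrightarrow> ip (c *\<^sub>R x) y = c * ip x y"
    and ip_nonneg: "x \<in> V \<Longrightarrow> 0 \<le> ip x x"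
begin

definition nrm :: "'a \<Rightarrow> real" where "nrm x = sqrt (ip x x)"

lemmas mem = subspace_add[OF V] subspace_diff[OF V] subspace_scale[OF V] subspace_0[OF V]

lemma ip_diff: "\<lbrakk>x \<in> V; y \<in> V; z \<in> V\<rbrakk> \<Longrightarrow> ip (x - y) z = ip x z - ip y z"
  using ip_add[of x "- 1 *\<^sub>R y" z] ip_scale[of y z "- 1"] mem(3)[of y "-1"] by simp

lemma ip_add_right: "\<lbrakk>x \<in> V; y \<in> V; z \<in> V\<rbrakk> \<Longrightarrow> ip z (x + y) = ip z x + ip z y"
  using ip_add[of x y z] mem by (simp add: ip_sym)

lemma ip_scale_right: "\<lbrakk>x \<in> V; y \<in> V\<rbrakk> \<Longrightarrow> ip y (c *\<^sub>R x) = c * ip y x"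
  using ip_scale[of x y c] mem by (simp add: ip_sym)

lemma nrm_nonneg [simp]: "x \<in> V \<Longrightarrow> 0 \<le> nrm x"
  by (simp add: nrm_def ip_nonneg)

lemma nrm_square: "x \<in> V \<Longrightarrow> (nrm x)\<^sup>2 = ip x x"
  by (simp add: nrm_def ip_nonneg)

lemma nrm_zero [simp]: "nrm 0 = 0"
  using ip_scale[of 0 0 0] mem by (simp add: nrm_def)

lemma nrm_scale: "x \<in> V \<Longrightarrow> nrm (c *\<^sub>R x) = \<bar>c\<bar> * nrm x"
  using mem by (simp add: nrm_def ip_scale ip_scale_right real_sqrt_mult flip: mult.assoc)

lemma ip_expand:
  assumes "x \<in> V" "y \<in> V"
  shows "ip (x + t *\<^sub>R y) (x + t *\<^sub>R y) = ip x x + 2 * t * ip x y + t\<^sup>2 * ip y y"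
  using assms ip_sym[of x y] mem
  by (simp add: ip_add ip_add_right ip_scale ip_scale_right power2_eq_square algebra_simps)

lemma nrm_minus_commute: "\<lbrakk>x \<in> V; y \<in> V\<rbrakk> \<Longrightarrow> nrm (x - y) = nrm (y - x)"
  using nrm_scale[of "y - x" "-1"] mem by simp

lemma ip_Cauchy_Schwarz:
  assumes x: "x \<in> V" and y: "y \<in> V"
  shows "\<bar>ip x y\<bar> \<le> nrm x * nrm y"
proof (cases "ip y y = 0")
  case True
  have "ip x y = 0"
  proof (rule quadratic_nonneg_imp_linear_coeff_zero[where c = "ip x x"])
    fix t
    have "0 \<le> ip (y + t *\<^sub>R x) (y + t *\<^sub>R x)" using x y mem by (intro ip_nonneg) auto
    then show "0 \<le> 2 * t * ip x y + t\<^sup>2 * ip x x"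
      by (simp add: ip_expand x y True ip_sym[OF y x])
  qed
  then show ?thesis using x y by simp
next
  case False
  then have pos: "0 < ip y y" using ip_nonneg[OF y] by simp
  define t where "t = - ip x y / ip y y"
  have "0 \<le> ip (x + t *\<^sub>R y) (x + t *\<^sub>R y)" using x y mem by (intro ip_nonneg) auto
  also have "\<dots> = ip x x - (ip x y)\<^sup>2 / ip y y"
    unfolding ip_expand[OF x y] t_def using pos by (simp add: field_simps power2_eq_square)
  finally have "(ip x y)\<^sup>2 \<le> ip x x * ip y y" using pos by (simp add: field_simps)
  then have "sqrt ((ip x y)\<^sup>2) \<le> sqrt (ip x x * ip y y)" by (rule real_sqrt_le_mono)
  then show ?thesis by (simp add: nrm_def real_sqrt_mult)
qed

lemma nrm_triangle:
  assumes x: "x \<in> V" and y: "y \<in> V"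
  shows "nrm (x + y) \<le> nrm x + nrm y"
proof (rule power2_le_imp_le)
  have "(nrm (x + y))\<^sup>2 = ip x x + 2 * ip x y + ip y y"
    using ip_expand[OF x y, of 1] mem x y by (simp add: nrm_square)
  also have "\<dots> \<le> (nrm x)\<^sup>2 + 2 * (nrm x * nrm y) + (nrm y)\<^sup>2"
    using ip_Cauchy_Schwarz[OF x y] by (simp add: nrm_square x y)
  finally show "(nrm (x + y))\<^sup>2 \<le> (nrm x + nrm y)\<^sup>2"
    by (simp add: power2_sum algebra_simps)
qed (use x y in auto)

lemma nrm_triangle_diff:
  assumes "x \<in> V" "y \<in> V" "z \<in> V"
  shows "nrm (x - z) \<le> nrm (x - y) + nrm (y - z)"
  using nrm_triangle[of "x - y" "y - z"] assms mem by simp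

end

text \<open>Completeness is required only for sequences whose increments decay geometrically. The
  constructions below produce such sequences, and for them completeness of an \<open>L2\<close> space can be
  checked without passing to subsequences.\<close>

locale semi_hilbert_space = semi_inner_space V ip
  for V :: "'a::real_vector set" and ip +
  assumes complete: "\<lbrakk>\<And>n. X n \<in> V; 0 < q; q < 1;
      \<And>n::nat. nrm (X (Suc n) - X n) \<le> C * q ^ n\<rbrakk> \<Longrightarrow> \<exists>x\<in>V. (\<lambda>n. nrm (X n - x)) \<longlonglongrightarrow> 0"
begin

text \<open>The representative minimises the energy \<open>J x = ip x x / 2 - l x\<close>. By the parallelogram law
  \<open>\<parallel>x - y\<parallel>\<^sup>2 \<le> 4 (J x + J y - 2 m)\<close>, where \<open>m\<close> is the infimum, so a minimising sequence with energies within
  \<open>(1/4) ^ n\<close> of \<open>m\<close> converges geometrically; the first variation at its limit is the claim.\<close>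

lemma Riesz_representation:
  assumes l_add: "\<And>x y. \<lbrakk>x \<in> V; y \<in> V\<rbrakk> \<Longrightarrow> l (x + y) = l x + l y"
    and l_scale: "\<And>c x. x \<in> V \<Longrightarrow> l (c *\<^sub>R x) = c * l x"
    and l_bdd: "\<And>x. x \<in> V \<Longrightarrow> \<bar>l x\<bar> \<le> K * nrm x"
  obtains r where "r \<in> V" "\<And>y. y \<in> V \<Longrightarrow> ip r y = l y"
proof -
  define J where "J x = ip x x / 2 - l x" for x
  define m where "m = Inf (J ` V)"
  have J_lower: "- K\<^sup>2 / 2 \<le> J x" if "x \<in> V" for x
  proof -
    have "0 \<le> (nrm x - K)\<^sup>2" by simp
    then have "- K\<^sup>2 / 2 \<le> (nrm x)\<^sup>2 / 2 - K * nrm x"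
      by (simp add: power2_eq_square algebra_simps)
    also have "\<dots> \<le> J x" using l_bdd[OF that] that by (simp add: J_def nrm_square)
    finally show ?thesis .
  qed
  have bdd: "bdd_below (J ` V)" using J_lower by (intro bdd_belowI2)
  have m: "m \<le> J x" if "x \<in> V" for x
    unfolding m_def using that bdd by (intro cInf_lower) auto
  have "\<exists>x\<in>V. J x \<le> m + (1/4) ^ n" for n :: nat
  proof -
    have "\<exists>y\<in>J ` V. y < m + (1/4) ^ n"
      unfolding m_def by (rule cInf_lessD) (use mem in auto)
    then show ?thesis by (auto intro: less_imp_le)
  qed
  then obtain X where X: "\<And>n. X n \<in> V" "\<And>n::nat. J (X n) \<le> m + (1/4) ^ n"
    by metis
  have diff: "nrm (X (Suc n) - X n) \<le> 3 * (1/2) ^ n" for n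
  proof (rule power2_le_imp_le)
    let ?x = "X (Suc n)" and ?y = "X n"
    define e where "e = (1/4::real) ^ n"
    have V': "?x \<in> V" "?y \<in> V" using X by auto
    have "m \<le> J ((1/2) *\<^sub>R (?x + ?y))" using V' mem by (intro m) auto
    also have "\<dots> = (ip ?x ?x + 2 * ip ?x ?y + ip ?y ?y) / 8 - (l ?x + l ?y) / 2"
      using V' mem ip_sym[of ?x ?y]
      by (simp add: J_def l_add l_scale ip_scale ip_scale_right ip_add ip_add_right field_simps)
    finally have "8 * m \<le> ip ?x ?x + 2 * ip ?x ?y + ip ?y ?y - 4 * (l ?x + l ?y)"
      by (simp add: field_simps)
    moreover have "J ?x \<le> m + e"
    proof -
      have "(1/4::real) ^ Suc n \<le> (1/4) ^ n" by simp
      then show ?thesis using X(2)[of "Suc n"] unfolding e_def by linarith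
    qed
    moreover have "J ?y \<le> m + e" using X(2) by (simp add: e_def)
    moreover have "(nrm (?x - ?y))\<^sup>2 = ip ?x ?x - 2 * ip ?x ?y + ip ?y ?y"
      using ip_expand[OF V', of "-1"] V' mem by (simp add: nrm_square)
    ultimately have "(nrm (?x - ?y))\<^sup>2 \<le> 8 * e" unfolding J_def by argo
    also have "\<dots> \<le> 9 * (1/4) ^ n" by (simp add: e_def)
    also have "\<dots> = (3 * (1/2) ^ n)\<^sup>2"
      by (simp add: power_mult_distrib power2_eq_square flip: power_mult_distrib)
    finally show "(nrm (?x - ?y))\<^sup>2 \<le> (3 * (1/2) ^ n)\<^sup>2" .
  qed simp
  obtain r where r: "r \<in> V" "(\<lambda>n. nrm (X n - r)) \<longlonglongrightarrow> 0"
    using complete[OF X(1) _ _ diff] by auto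
  have "ip r y = l y" if y: "y \<in> V" for y
  proof -
    have "(\<lambda>n. ip (X n - r) y) \<longlonglongrightarrow> 0"
    proof (rule Lim_null_comparison)
      show "\<forall>\<^sub>F n in sequentially. norm (ip (X n - r) y) \<le> nrm (X n - r) * nrm y"
        using ip_Cauchy_Schwarz X(1) r(1) y mem by (intro always_eventually) auto
      show "(\<lambda>n. nrm (X n - r) * nrm y) \<longlonglongrightarrow> 0"
        using tendsto_mult_right[OF r(2)] by auto
    qed
    then have "(\<lambda>n. ip (X n - r) y + ip r y) \<longlonglongrightarrow> 0 + ip r y" by (intro tendsto_intros)
    then have lim: "(\<lambda>n. ip (X n) y) \<longlonglongrightarrow> ip r y"
      using X(1) r(1) y by (simp add: ip_diff)
    have "0 \<le> 2 * t * (ip r y - l y) + t\<^sup>2 * ip y y" for t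
    proof (rule tendsto_lowerbound)
      have "(\<lambda>n. 2 * t * (ip (X n) y - l y) + t\<^sup>2 * ip y y + 2 * (1/4) ^ n) \<longlonglongrightarrow>
          2 * t * (ip r y - l y) + t\<^sup>2 * ip y y + 2 * 0"
        by (intro tendsto_intros lim LIMSEQ_power_zero) simp
      then show "(\<lambda>n. 2 * t * (ip (X n) y - l y) + t\<^sup>2 * ip y y + 2 * (1/4) ^ n) \<longlonglongrightarrow>
          2 * t * (ip r y - l y) + t\<^sup>2 * ip y y" by simp
      have "0 \<le> 2 * t * (ip (X n) y - l y) + t\<^sup>2 * ip y y + 2 * (1/4) ^ n" for n
      proof -
        have "J (X n) \<le> J (X n + t *\<^sub>R y) + (1/4) ^ n"
          using X(2)[of n] m[of "X n + t *\<^sub>R y"] X(1) y mem by fastforce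
        then show ?thesis
          using X(1) y mem by (simp add: J_def ip_expand l_add l_scale field_simps)
      qed
      then show "\<forall>\<^sub>F n in sequentially. 0 \<le> 2 * t * (ip (X n) y - l y) + t\<^sup>2 * ip y y + 2 * (1/4) ^ n"
        by simp
    qed simp
    from quadratic_nonneg_imp_linear_coeff_zero[OF this] show ?thesis by simp
  qed
  then show ?thesis using that r(1) by blast
qed

text \<open>Let \<open>A x\<close> represent \<open>a x\<close> and \<open>r\<close> represent \<open>l\<close>. The solution is a fixed point of
  \<open>T x = x - t (A x - r)\<close>, which is a contraction for small \<open>t\<close>, since
  \<open>\<parallel>T x - T y\<parallel>\<^sup>2 \<le> (1 - 2 t c + t\<^sup>2 N\<^sup>2) \<parallel>x - y\<parallel>\<^sup>2\<close>.\<close>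

lemma Lax_Milgram:
  assumes a_add: "\<And>x y z. \<lbrakk>x \<in> V; y \<in> V; z \<in> V\<rbrakk> \<Longrightarrow> a (x + y) z = a x z + a y z"
    and a_scale: "\<And>c x z. \<lbrakk>x \<in> V; z \<in> V\<rbrakk> \<Longrightarrow> a (c *\<^sub>R x) z = c * a x z"
    and a_add_right: "\<And>x y z. \<lbrakk>x \<in> V; y \<in> V; z \<in> V\<rbrakk> \<Longrightarrow> a z (x + y) = a z x + a z y"
    and a_scale_right: "\<And>c x z. \<lbrakk>x \<in> V; z \<in> V\<rbrakk> \<Longrightarrow> a z (c *\<^sub>R x) = c * a z x"
    and a_bdd: "\<And>x y. \<lbrakk>x \<in> V; y \<in> V\<rbrakk> \<Longrightarrow> \<bar>a x y\<bar> \<le> M * nrm x * nrm y"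
    and c: "0 < c" and coercive: "\<And>x. x \<in> V \<Longrightarrow> c * (nrm x)\<^sup>2 \<le> a x x"
    and l_add: "\<And>x y. \<lbrakk>x \<in> V; y \<in> V\<rbrakk> \<Longrightarrow> l (x + y) = l x + l y"
    and l_scale: "\<And>c x. x \<in> V \<Longrightarrow> l (c *\<^sub>R x) = c * l x"
    and l_bdd: "\<And>x. x \<in> V \<Longrightarrow> \<bar>l x\<bar> \<le> K * nrm x"
  obtains u where "u \<in> V" "\<And>y. y \<in> V \<Longrightarrow> a u y = l y"
proof -
  \<comment> \<open>Enlarging the bound makes it positive and at least \<open>c\<close>, so that \<open>c\<^sup>2 / N\<^sup>2\<close> lies between 0 and 1.\<close>
  define N where "N = \<bar>M\<bar> + c"
  have N: "0 < N" "c \<le> N" using c by (auto simp: N_def)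
  have a_N: "\<bar>a x y\<bar> \<le> N * nrm x * nrm y" if "x \<in> V" "y \<in> V" for x y
  proof -
    have "M * (nrm x * nrm y) \<le> N * (nrm x * nrm y)"
      using that c by (intro mult_right_mono) (auto simp: N_def)
    then show ?thesis using a_bdd[OF that] by (simp add: mult.assoc)
  qed
  have "\<exists>r\<in>V. \<forall>y\<in>V. ip r y = a x y" if "x \<in> V" for x
    by (rule Riesz_representation[of "a x" "N * nrm x"])
      (use that a_add_right a_scale_right a_N in auto)
  then obtain A where A: "\<And>x. x \<in> V \<Longrightarrow> A x \<in> V" "\<And>x y. \<lbrakk>x \<in> V; y \<in> V\<rbrakk> \<Longrightarrow> ip (A x) y = a x y"
    by metis
  obtain r where r: "r \<in> V" "\<And>y. y \<in> V \<Longrightarrow> ip r y = l y"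
    using Riesz_representation[of l K, OF l_add l_scale l_bdd] by blast
  \<comment> \<open>This value minimises \<open>1 - 2 t c + t\<^sup>2 N\<^sup>2\<close>; the minimum is \<open>1 - c\<^sup>2 / N\<^sup>2\<close>.\<close>
  define t where "t = c / N\<^sup>2"
  have t: "0 < t" using c N by (simp add: t_def)
  define T where "T x = x - t *\<^sub>R (A x - r)" for x
  define X where "X n = (T ^^ n) 0" for n
  have X_Suc: "X (Suc n) = T (X n)" for n by (simp add: X_def)
  have TV: "T x \<in> V" if "x \<in> V" for x using that A(1) r(1) mem by (simp add: T_def)
  have XV: "X n \<in> V" for n
  proof (induction n)
    case 0 show ?case using mem by (simp add: X_def)
  next
    case (Suc n) then show ?case by (simp add: X_Suc TV)
  qed
  \<comment> \<open>Halving the gain keeps the contraction factor positive, as the completeness axiom demands.\<close>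
  define q where "q = sqrt (1 - c\<^sup>2 / N\<^sup>2 / 2)"
  have cN: "0 < c\<^sup>2 / N\<^sup>2" "c\<^sup>2 / N\<^sup>2 \<le> 1" using c N by (auto simp: power_mono)
  have q: "0 < q" "q < 1" using cN by (auto simp: q_def)
  have contr: "nrm (T x - T y) \<le> q * nrm (x - y)" if x: "x \<in> V" and y: "y \<in> V" for x y
  proof (rule power2_le_imp_le)
    define d where "d = x - y"
    define g where "g = A x - A y"
    have V': "d \<in> V" "g \<in> V" using x y A(1) mem by (auto simp: d_def g_def)
    have a_diff: "a (x - y) z = a x z - a y z" if "z \<in> V" for z
      using a_add[of x "-1 *\<^sub>R y" z] a_scale[of y z "-1"] x y that mem(3)[of y "-1"] by simp
    have ipg: "ip g z = a d z" if "z \<in> V" for z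
      using x y that A mem by (simp add: d_def g_def ip_diff a_diff)
    have "(nrm g)\<^sup>2 \<le> N * nrm d * nrm g"
      using a_N[OF V'] by (simp add: nrm_square V' ipg)
    then have "nrm g \<le> N * nrm d"
    proof (cases "nrm g = 0")
      case False
      then have "0 < nrm g" using V'(2) by (simp add: less_le)
      with \<open>(nrm g)\<^sup>2 \<le> N * nrm d * nrm g\<close> show ?thesis
        by (simp add: power2_eq_square)
    qed (use V' N in auto)
    then have gd: "(nrm g)\<^sup>2 \<le> N\<^sup>2 * (nrm d)\<^sup>2"
      using V' by (metis nrm_nonneg power_mono power_mult_distrib)
    have "T x - T y = d + (- t) *\<^sub>R g" by (simp add: T_def d_def g_def algebra_simps)
    then have "(nrm (T x - T y))\<^sup>2 = (nrm d)\<^sup>2 - 2 * t * ip d g + t\<^sup>2 * (nrm g)\<^sup>2"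
      using V' mem ip_expand[OF V', of "-t"] by (simp add: nrm_square)
    also have "\<dots> \<le> (nrm d)\<^sup>2 - 2 * t * (c * (nrm d)\<^sup>2) + t\<^sup>2 * (N\<^sup>2 * (nrm d)\<^sup>2)"
    proof -
      have "c * (nrm d)\<^sup>2 \<le> ip d g" using coercive[OF V'(1)] ipg[OF V'(1)] ip_sym[OF V'] by simp
      then have "t * (c * (nrm d)\<^sup>2) \<le> t * ip d g" using t by simp
      moreover have "t\<^sup>2 * (nrm g)\<^sup>2 \<le> t\<^sup>2 * (N\<^sup>2 * (nrm d)\<^sup>2)"
        using gd by (intro mult_left_mono) auto
      ultimately show ?thesis by simp
    qed
    also have "\<dots> = (1 - c\<^sup>2 / N\<^sup>2) * (nrm d)\<^sup>2"
      using N by (simp add: t_def field_simps power2_eq_square)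
    also have "\<dots> \<le> (1 - c\<^sup>2 / N\<^sup>2 / 2) * (nrm d)\<^sup>2"
      using cN by (intro mult_right_mono) auto
    also have "\<dots> = (q * nrm (x - y))\<^sup>2"
      using cN by (simp add: q_def d_def power_mult_distrib)
    finally show "(nrm (T x - T y))\<^sup>2 \<le> (q * nrm (x - y))\<^sup>2" .
  qed (use q x y mem in auto)
  have geo: "nrm (X (Suc n) - X n) \<le> nrm (X (Suc 0) - X 0) * q ^ n" for n
  proof (induction n)
    case (Suc n)
    have "nrm (X (Suc (Suc n)) - X (Suc n)) \<le> q * nrm (X (Suc n) - X n)"
      unfolding X_Suc[of "Suc n"] X_Suc[of n] by (rule contr[OF XV XV, of "Suc n" n, unfolded X_Suc])
    also have "\<dots> \<le> q * (nrm (X (Suc 0) - X 0) * q ^ n)"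
      using q Suc by (intro mult_left_mono) auto
    finally show ?case by (simp add: mult_ac)
  qed simp
  obtain u where u: "u \<in> V" "(\<lambda>n. nrm (X n - u)) \<longlonglongrightarrow> 0"
    using complete[OF XV q geo] by blast
  have "a u y = l y" if y: "y \<in> V" for y
  proof -
    have a_diff: "a (x - x') z = a x z - a x' z" if "x \<in> V" "x' \<in> V" "z \<in> V" for x x' z
      using a_add[of x "-1 *\<^sub>R x'" z] a_scale[of x' z "-1"] that mem(3)[of x' "-1"] by simp
    have "(\<lambda>n. a (X n - u) y) \<longlonglongrightarrow> 0"
    proof (rule Lim_null_comparison)
      show "\<forall>\<^sub>F n in sequentially. norm (a (X n - u) y) \<le> N * nrm (X n - u) * nrm y"
        using a_N XV u(1) y mem by (intro always_eventually) auto
      show "(\<lambda>n. N * nrm (X n - u) * nrm y) \<longlonglongrightarrow> 0"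
        by (rule tendsto_eq_intros u(2) refl)+ simp
    qed
    then have "(\<lambda>n. a (X n - u) y + (a u y - l y)) \<longlonglongrightarrow> 0 + (a u y - l y)"
      by (intro tendsto_add tendsto_const)
    then have lim1: "(\<lambda>n. a (X n) y - l y) \<longlonglongrightarrow> a u y - l y"
      using XV u(1) y by (simp add: a_diff)
    have "(\<lambda>n. a (X n) y - l y) \<longlonglongrightarrow> 0"
    proof (rule Lim_null_comparison)
      have "norm (a (X n) y - l y) \<le> (nrm (X (Suc 0) - X 0) * q ^ n) * nrm y / t" for n
      proof -
        have "X n - X (Suc n) = t *\<^sub>R (A (X n) - r)" by (simp add: X_Suc T_def)
        then have "ip (X n - X (Suc n)) y = t * (a (X n) y - l y)"
          using XV[of n] A r y mem by (simp add: ip_scale ip_diff)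
        then have "t * \<bar>a (X n) y - l y\<bar> = \<bar>ip (X n - X (Suc n)) y\<bar>"
          using t by (simp add: abs_mult)
        also have "\<dots> \<le> nrm (X n - X (Suc n)) * nrm y"
          using XV y mem by (intro ip_Cauchy_Schwarz) auto
        also have "\<dots> \<le> (nrm (X (Suc 0) - X 0) * q ^ n) * nrm y"
          using geo[of n] y by (intro mult_right_mono) (auto simp: nrm_minus_commute XV)
        finally show ?thesis using t by (simp add: field_simps)
      qed
      then show "\<forall>\<^sub>F n in sequentially.
          norm (a (X n) y - l y) \<le> (nrm (X (Suc 0) - X 0) * q ^ n) * nrm y / t"
        by simp
      have "(\<lambda>n. (nrm (X (Suc 0) - X 0) * q ^ n) * nrm y / t) \<longlonglongrightarrow>
          (nrm (X (Suc 0) - X 0) * 0) * nrm y / t"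
        using q t by (intro tendsto_intros LIMSEQ_power_zero) auto
      then show "(\<lambda>n. (nrm (X (Suc 0) - X 0) * q ^ n) * nrm y / t) \<longlonglongrightarrow> 0" by simp
    qed
    from LIMSEQ_unique[OF this lim1] show ?thesis by simp
  qed
  then show ?thesis using that u(1) by blast
qed

text \<open>Coercivity and the equation are required only on a dense set \<open>S\<close>, in the application the graphs of
  Lipschitz functions. Coercivity extends to \<open>V\<close> because \<open>a\<close> is bounded; for the same reason
  \<open>a x x = 0\<close> if \<open>a x\<close> vanishes on \<open>S\<close>, which gives uniqueness.\<close>

lemma Lax_Milgram_dense:
  assumes a_add: "\<And>x y z. \<lbrakk>x \<in> V; y \<in> V; z \<in> V\<rbrakk> \<Longrightarrow> a (x + y) z = a x z + a y z"
    and a_scale: "\<And>c x z. \<lbrakk>x \<in> V; z \<in> V\<rbrakk> \<Longrightarrow> a (c *\<^sub>R x) z = c * a x z"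
    and a_add_right: "\<And>x y z. \<lbrakk>x \<in> V; y \<in> V; z \<in> V\<rbrakk> \<Longrightarrow> a z (x + y) = a z x + a z y"
    and a_scale_right: "\<And>c x z. \<lbrakk>x \<in> V; z \<in> V\<rbrakk> \<Longrightarrow> a z (c *\<^sub>R x) = c * a z x"
    and a_bdd: "\<And>x y. \<lbrakk>x \<in> V; y \<in> V\<rbrakk> \<Longrightarrow> \<bar>a x y\<bar> \<le> M * nrm x * nrm y"
    and l_add: "\<And>x y. \<lbrakk>x \<in> V; y \<in> V\<rbrakk> \<Longrightarrow> l (x + y) = l x + l y"
    and l_scale: "\<And>c x. x \<in> V \<Longrightarrow> l (c *\<^sub>R x) = c * l x"
    and l_bdd: "\<And>x. x \<in> V \<Longrightarrow> \<bar>l x\<bar> \<le> K * nrm x"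
    and S: "S \<subseteq> V" and dense: "\<And>x e. \<lbrakk>x \<in> V; 0 < e\<rbrakk> \<Longrightarrow> \<exists>y\<in>S. nrm (x - y) < e"
    and c: "0 < c" and coercive: "\<And>x. x \<in> S \<Longrightarrow> c * (nrm x)\<^sup>2 \<le> a x x"
  shows "\<exists>u\<in>V. \<forall>y\<in>S. a u y = l y"
    and "\<lbrakk>u \<in> V; u' \<in> V; \<And>y. y \<in> S \<Longrightarrow> a u y = l y; \<And>y. y \<in> S \<Longrightarrow> a u' y = l y\<rbrakk>
      \<Longrightarrow> nrm (u - u') = 0"
proof -
  have a_diff: "a (x - y) z = a x z - a y z" if "x \<in> V" "y \<in> V" "z \<in> V" for x y z
    using a_add[of x "-1 *\<^sub>R y" z] a_scale[of y z "-1"] that mem(3)[of y "-1"] by simp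
  have a_diff_right: "a z (x - y) = a z x - a z y" if "x \<in> V" "y \<in> V" "z \<in> V" for x y z
    using a_add_right[of x "-1 *\<^sub>R y" z] a_scale_right[of y z "-1"] that mem(3)[of y "-1"] by simp
  have coercive_V: "c * (nrm x)\<^sup>2 \<le> a x x"
    and ortho_V: "(\<forall>y\<in>S. a x y = 0) \<Longrightarrow> a x x = 0" if x: "x \<in> V" for x
  proof -
    have "\<exists>y\<in>S. nrm (x - y) < 1 / Suc n" for n by (rule dense[OF x]) simp
    then obtain Y where Y: "\<And>n. Y n \<in> S" "\<And>n. nrm (x - Y n) < 1 / Suc n" by metis
    have YV: "Y n \<in> V" for n using Y(1) S by auto
    have dV: "x - Y n \<in> V" for n using x YV mem by auto
    have "(\<lambda>n. 1 / real (Suc n)) \<longlonglongrightarrow> 0" by (intro LIMSEQ_Suc lim_const_over_n)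
    then have d0: "(\<lambda>n. nrm (x - Y n)) \<longlonglongrightarrow> 0"
      by (rule Lim_null_comparison[rotated])
        (use Y(2) dV in \<open>auto intro!: always_eventually less_imp_le\<close>)
    have a_right: "(\<lambda>n. a x (x - Y n)) \<longlonglongrightarrow> 0"
    proof (rule Lim_null_comparison)
      show "\<forall>\<^sub>F n in sequentially. norm (a x (x - Y n)) \<le> M * nrm x * nrm (x - Y n)"
        using a_bdd[OF x dV] by simp
      show "(\<lambda>n. M * nrm x * nrm (x - Y n)) \<longlonglongrightarrow> 0" by (rule tendsto_mult_right_zero[OF d0])
    qed
    have a_left: "(\<lambda>n. a (x - Y n) x) \<longlonglongrightarrow> 0"
    proof (rule Lim_null_comparison)
      show "\<forall>\<^sub>F n in sequentially. norm (a (x - Y n) x) \<le> M * nrm x * nrm (x - Y n)"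
        using a_bdd[OF dV x] by (simp add: mult_ac)
      show "(\<lambda>n. M * nrm x * nrm (x - Y n)) \<longlonglongrightarrow> 0" by (rule tendsto_mult_right_zero[OF d0])
    qed
    have a_both: "(\<lambda>n. a (x - Y n) (x - Y n)) \<longlonglongrightarrow> 0"
    proof (rule Lim_null_comparison)
      show "\<forall>\<^sub>F n in sequentially. norm (a (x - Y n) (x - Y n)) \<le> M * nrm (x - Y n) * nrm (x - Y n)"
        using a_bdd[OF dV dV] by simp
      show "(\<lambda>n. M * nrm (x - Y n) * nrm (x - Y n)) \<longlonglongrightarrow> 0"
        using tendsto_mult[OF tendsto_mult[OF tendsto_const[of M] d0] d0] by simp
    qed
    have "a (Y n) (Y n) = a x x - a x (x - Y n) - a (x - Y n) x + a (x - Y n) (x - Y n)" for n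
      using x YV dV by (simp add: a_diff a_diff_right)
    moreover have "(\<lambda>n. a x x - a x (x - Y n) - a (x - Y n) x + a (x - Y n) (x - Y n)) \<longlonglongrightarrow> a x x - 0 - 0 + 0"
      by (intro tendsto_intros a_right a_left a_both)
    ultimately have aY: "(\<lambda>n. a (Y n) (Y n)) \<longlonglongrightarrow> a x x" by simp
    have nY: "(\<lambda>n. nrm x - nrm (x - Y n)) \<longlonglongrightarrow> nrm x - 0" by (intro tendsto_intros d0)
    have nY': "(\<lambda>n. c * (max 0 (nrm x - nrm (x - Y n)))\<^sup>2) \<longlonglongrightarrow> c * (max 0 (nrm x - 0))\<^sup>2"
      by (intro tendsto_intros nY)
    have le: "c * (max 0 (nrm x - nrm (x - Y n)))\<^sup>2 \<le> a (Y n) (Y n)" for n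
    proof -
      have "nrm x \<le> nrm (x - Y n) + nrm (Y n)" using nrm_triangle[OF dV YV, of n n] by simp
      then have "(max 0 (nrm x - nrm (x - Y n)))\<^sup>2 \<le> (nrm (Y n))\<^sup>2"
        using YV by (intro power_mono) auto
      then have "c * (max 0 (nrm x - nrm (x - Y n)))\<^sup>2 \<le> c * (nrm (Y n))\<^sup>2"
        using c by (intro mult_left_mono) auto
      then show ?thesis using coercive[OF Y(1)] by (rule order_trans)
    qed
    have "c * (max 0 (nrm x - 0))\<^sup>2 \<le> a x x" by (rule LIMSEQ_le[OF nY' aY]) (use le in auto)
    then show "c * (nrm x)\<^sup>2 \<le> a x x" using x by (simp add: max_def)
    assume "\<forall>y\<in>S. a x y = 0"
    then have "a x (x - Y n) = a x x" for n using Y(1) x YV by (simp add: a_diff_right)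
    then show "a x x = 0" using a_right by (simp add: LIMSEQ_const_iff)
  qed
  have "\<exists>u\<in>V. \<forall>y\<in>V. a u y = l y"
    by (rule Lax_Milgram[of a M c l K])
      (use a_add a_scale a_add_right a_scale_right a_bdd c coercive_V l_add l_scale l_bdd in auto)
  then show "\<exists>u\<in>V. \<forall>y\<in>S. a u y = l y" using S by blast
  assume u: "u \<in> V" "u' \<in> V" "\<And>y. y \<in> S \<Longrightarrow> a u y = l y" "\<And>y. y \<in> S \<Longrightarrow> a u' y = l y"
  then have "\<forall>y\<in>S. a (u - u') y = 0" using S by (auto simp: a_diff)
  then have "c * (nrm (u - u'))\<^sup>2 \<le> 0"
    using coercive_V[of "u - u'"] ortho_V[of "u - u'"] u mem by simp
  then show "nrm (u - u') = 0" using c by (simp add: mult_le_0_iff)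
qed

end

section \<open>Almost everywhere differentiability of Lipschitz functions\<close>

text \<open>Wherever the difference quotients of \<open>g\<close> drop below \<open>p\<close> at arbitrarily small scales, the set
  \<open>g ` E\<close> is covered in the sense of Vitali by images of short intervals that \<open>g\<close> stretches by a factor less than
  \<open>p\<close>. Disjoint images come from disjoint intervals, so their total length is at most \<open>p\<close> times the
  measure of an open set around \<open>E\<close>. Outer measure is used because nothing is known about the
  measurability of \<open>E\<close>.\<close>

lemma Vitali_image_estimate:
  fixes g :: "real \<Rightarrow> real"
  assumes mono: "strict_mono g" and cont: "\<And>x. isCont g x"
    and p: "0 < p"
    and low: "\<And>x d. \<lbrakk>x \<in> E; 0 < d\<rbrakk> \<Longrightarrow> \<exists>h. h \<noteq> 0 \<and> \<bar>h\<bar> < d \<and> (g (x + h) - g x) / h < p"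
  shows "outer_measure_of lebesgue (g ` E) \<le> ennreal p * outer_measure_of lebesgue E"
proof -
  have less: "g x < g y \<longleftrightarrow> x < y" and le: "g x \<le> g y \<longleftrightarrow> x \<le> y" for x y
    using mono by (auto simp: strict_mono_less strict_mono_less_eq)
  obtain F where F: "F \<in> sets lebesgue" "E \<subseteq> F" "outer_measure_of lebesgue E = emeasure lebesgue F"
    using outer_measure_of_attain[of E lebesgue] by auto
  have main: "outer_measure_of lebesgue (g ` E) \<le> ennreal p * emeasure lebesgue U"
    if U: "open U" "E \<subseteq> U" for U
  proof -
    define K where "K = {(x, y). x < y \<and> {x..y} \<subseteq> U \<and> g y - g x < p * (y - x)}"
    define ctr where "ctr = (\<lambda>(x, y). (g x + g y) / 2)"
    define rad where "rad = (\<lambda>(x, y). (g y - g x) / 2)"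
    have ball: "cball (ctr (x, y)) (rad (x, y)) = {g x..g y}" for x y
      unfolding ctr_def rad_def by (auto simp: cball_def dist_real_def abs_le_iff field_simps)
    have cover: "\<exists>i. i \<in> K \<and> z \<in> cball (ctr i) (rad i) \<and> rad i < e"
      if z: "z \<in> g ` E" and e: "0 < e" for z e
    proof -
      obtain x where x: "x \<in> E" "z = g x" using z by auto
      obtain d1 where d1: "0 < d1" "ball x d1 \<subseteq> U" using U x by (meson open_contains_ball subsetD)
      obtain d2 where d2: "0 < d2" "\<And>y. \<bar>y - x\<bar> < d2 \<Longrightarrow> \<bar>g y - g x\<bar> < e"
        using cont[of x] e unfolding continuous_at_eps_delta by (auto simp: dist_real_def)
      obtain h where h: "h \<noteq> 0" "\<bar>h\<bar> < min d1 d2" "(g (x + h) - g x) / h < p"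
        using low[OF x(1), of "min d1 d2"] d1(1) d2(1) by auto
      define i where "i = (if 0 < h then (x, x + h) else (x + h, x))"
      have U': "{min x (x + h)..max x (x + h)} \<subseteq> U"
      proof
        fix y assume "y \<in> {min x (x + h)..max x (x + h)}"
        then have "y \<in> ball x d1" using h(2) by (auto simp: dist_real_def)
        then show "y \<in> U" using d1 by auto
      qed
      have "i \<in> K"
        using h U' by (cases "0 < h") (auto simp: i_def K_def field_simps)
      moreover have "z \<in> cball (ctr i) (rad i)"
        using h by (auto simp: i_def ball x le simp del: mem_cball)
      moreover have "rad i < e"
        using d2(2)[of "x + h"] h less[of x "x + h"] less[of "x + h" x]
        by (auto simp: i_def rad_def abs_if split: if_splits)
      ultimately show ?thesis by blast
    qed
    have rad_pos: "0 < rad i" if "i \<in> K" for i using that less by (auto simp: K_def rad_def)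
    obtain C where C: "countable C" "C \<subseteq> K"
      "pairwise (\<lambda>i j. disjnt (cball (ctr i) (rad i)) (cball (ctr j) (rad j))) C"
      "negligible (g ` E - (\<Union>i\<in>C. cball (ctr i) (rad i)))"
      using Vitali_covering_theorem_cballs[of K rad "g ` E" ctr, OF rad_pos cover] by blast
    define B where "B i = cball (ctr i) (rad i)" for i
    define I where "I = (\<lambda>(x, y). {x..y::real})"
    have "outer_measure_of lebesgue (g ` E)
        \<le> outer_measure_of lebesgue ((\<Union>i\<in>C. B i) \<union> (g ` E - (\<Union>i\<in>C. B i)))"
      by (rule outer_measure_of_mono) auto
    also have "\<dots> = emeasure lebesgue ((\<Union>i\<in>C. B i) \<union> (g ` E - (\<Union>i\<in>C. B i)))"
      using C(1,4) unfolding B_def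
      by (intro outer_measure_of_eq sets.Un sets.countable_UN' negligible_imp_sets) auto
    also have "\<dots> = emeasure lebesgue (\<Union>i\<in>C. B i)"
      using C(1,4) unfolding B_def
      by (intro emeasure_Un_null_set sets.countable_UN') (auto simp: negligible_iff_null_sets)
    also have "\<dots> = (\<integral>\<^sup>+i. emeasure lebesgue (B i) \<partial>count_space C)"
      using C(1,3) unfolding B_def
      by (intro emeasure_UN_countable) (auto simp: disjoint_family_on_def pairwise_def disjnt_def)
    also have "\<dots> \<le> (\<integral>\<^sup>+i. ennreal p * emeasure lebesgue (I i) \<partial>count_space C)"
    proof (rule nn_integral_mono)
      fix i assume "i \<in> space (count_space C)"
      then have "i \<in> K" using C(2) by auto
      then obtain x y where xy: "i = (x, y)" "x < y" "g y - g x < p * (y - x)" by (auto simp: K_def)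
      have "g x < g y" using xy less by simp
      then show "emeasure lebesgue (B i) \<le> ennreal p * emeasure lebesgue (I i)"
        using xy p by (simp add: B_def ball I_def ennreal_mult[symmetric] ennreal_leI)
    qed
    also have "\<dots> = ennreal p * (\<integral>\<^sup>+i. emeasure lebesgue (I i) \<partial>count_space C)"
      by (rule nn_integral_cmult) simp
    also have "(\<integral>\<^sup>+i. emeasure lebesgue (I i) \<partial>count_space C) = emeasure lebesgue (\<Union>i\<in>C. I i)"
    proof (rule emeasure_UN_countable[symmetric])
      show "disjoint_family_on I C"
        unfolding disjoint_family_on_def
      proof (intro ballI impI)
        fix i j assume ij: "i \<in> C" "j \<in> C" "i \<noteq> j"
        obtain x y x' y' where i: "i = (x, y)" and j: "j = (x', y')" by (metis surj_pair)
        have "disjnt {g x..g y} {g x'..g y'}"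
          using pairwiseD[OF C(3) ij] unfolding i j ball .
        then have "\<not> (g z \<in> {g x..g y} \<and> g z \<in> {g x'..g y'})" for z
          unfolding disjnt_def by blast
        then have "\<not> (z \<in> {x..y} \<and> z \<in> {x'..y'})" for z
          by (simp add: le)
        then show "I i \<inter> I j = {}"
          unfolding i j I_def by blast
      qed
    qed (use C(1) in \<open>auto simp: I_def\<close>)
    also have "emeasure lebesgue (\<Union>i\<in>C. I i) \<le> emeasure lebesgue U"
      using C(2) U(1) by (intro emeasure_mono) (auto simp: K_def I_def)
    finally show ?thesis by (simp add: mult_left_mono)
  qed
  show ?thesis
  proof (rule ennreal_le_epsilon)
    fix e :: real assume e: "0 < e"
    assume fin: "ennreal p * outer_measure_of lebesgue E < top"
    obtain U where U: "open U" "F \<subseteq> U" "emeasure lebesgue (U - F) < ennreal (e / p)"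
      by (rule sets_lebesgue_outer_open[OF F(1) divide_pos_pos[OF e p]])
    have "emeasure lebesgue U = emeasure lebesgue (F \<union> (U - F))"
      using U(2) by (simp add: Un_absorb1)
    also have "\<dots> \<le> emeasure lebesgue F + emeasure lebesgue (U - F)"
      using F(1) U(1) by (intro emeasure_subadditive) auto
    also have "\<dots> \<le> emeasure lebesgue F + ennreal (e / p)"
      using U(3) by (intro add_left_mono) auto
    finally have "ennreal p * emeasure lebesgue U \<le> ennreal p * (emeasure lebesgue F + ennreal (e / p))"
      by (rule mult_left_mono) simp
    also have "\<dots> = ennreal p * outer_measure_of lebesgue E + ennreal e"
      using p e by (simp add: F(3) distrib_left ennreal_mult[symmetric])
    finally show "outer_measure_of lebesgue (g ` E) \<le> ennreal p * outer_measure_of lebesgue E + ennreal e"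
      using main[of U] U F(2) by (meson order_trans)
  qed
qed

text \<open>Bounded difference quotients fail to converge exactly if they cross a gap between two rationals
  infinitely often. Rational levels make the set of bad points a countable union.\<close>

lemma tendsto_at_0_iff_no_oscillation:
  fixes Q :: "real \<Rightarrow> real"
  assumes bdd: "\<And>h. h \<noteq> 0 \<Longrightarrow> \<bar>Q h\<bar> \<le> B"
  shows "(\<exists>l. (Q \<longlongrightarrow> l) (at 0)) \<longleftrightarrow>
    \<not> (\<exists>p\<in>\<rat>. \<exists>q\<in>\<rat>. p < q \<and> (\<exists>\<^sub>F h in at 0. Q h < p) \<and> (\<exists>\<^sub>F h in at 0. q < Q h))"
    (is "?lim \<longleftrightarrow> \<not> ?osc")
proof
  assume ?lim
  then obtain l where l: "(Q \<longlongrightarrow> l) (at 0)" ..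
  show "\<not> ?osc"
  proof safe
    fix p q :: real
    assume pq: "p < q" "\<exists>\<^sub>F h in at 0. Q h < p" "\<exists>\<^sub>F h in at 0. q < Q h"
    have "l \<le> p"
    proof (rule ccontr)
      assume "\<not> l \<le> p"
      then have "\<forall>\<^sub>F h in at 0. p < Q h" using order_tendstoD(1)[OF l] by simp
      then have "\<forall>\<^sub>F h in at 0. \<not> Q h < p" by eventually_elim simp
      then show False using pq(2) by (simp add: frequently_def)
    qed
    then have "l < q" using pq by simp
    then have "\<forall>\<^sub>F h in at 0. Q h < q" using order_tendstoD(2)[OF l] by simp
    then have "\<forall>\<^sub>F h in at 0. \<not> q < Q h" by eventually_elim simp
    then show False using pq(3) by (simp add: frequently_def)
  qed
next
  assume nosc: "\<not> ?osc"
  define li ls where "li = Liminf (at 0) (\<lambda>h. ereal (Q h))" and "ls = Limsup (at 0) (\<lambda>h. ereal (Q h))"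
  have ev: "\<forall>\<^sub>F h in at 0. ereal (- B) \<le> ereal (Q h) \<and> ereal (Q h) \<le> ereal B"
    using bdd by (auto simp: eventually_at_filter abs_le_iff intro!: always_eventually)
       (metis minus_le_iff)
  have le: "li \<le> ls" unfolding li_def ls_def by (rule Liminf_le_Limsup) simp
  have "ereal (- B) \<le> li" unfolding li_def
    by (rule Liminf_bounded) (use ev in eventually_elim, auto)
  moreover have "ls \<le> ereal B" unfolding ls_def
    by (rule Limsup_bounded) (use ev in eventually_elim, auto)
  moreover have "li = ls"
  proof (rule ccontr)
    assume "li \<noteq> ls"
    then have "li < ls" using le by simp
    then obtain a where a: "li < ereal a" "ereal a < ls" using ereal_dense2 by blast
    then obtain b where b: "ereal a < ereal b" "ereal b < ls" using ereal_dense2 by blast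
    obtain p where p: "p \<in> \<rat>" "a < p" "p < b" using Rats_dense_in_real[of a b] b by auto
    obtain q where q: "q \<in> \<rat>" "p < q" "q < b" using Rats_dense_in_real[of p b] p by auto
    have "\<exists>\<^sub>F h in at 0. Q h < p"
    proof (rule ccontr)
      assume "\<not> ?thesis"
      then have "ereal p \<le> li" unfolding li_def not_frequently
        by (intro Liminf_bounded) (auto simp: not_less)
      then show False using a(1) p(2) by (metis ereal_less_eq(3) leD le_less_trans less_imp_le order_trans)
    qed
    moreover have "\<exists>\<^sub>F h in at 0. q < Q h"
    proof (rule ccontr)
      assume "\<not> ?thesis"
      then have "ls \<le> ereal q" unfolding ls_def not_frequently
        by (intro Limsup_bounded) (auto simp: not_less)
      also have "\<dots> < ereal b" using q by simp
      finally show False using b(2) by simp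
    qed
    ultimately show False using nosc p(1) q by blast
  qed
  ultimately obtain l where l: "li = ereal l" "ls = ereal l" by (cases li) auto
  have "((\<lambda>h. ereal (Q h)) \<longlongrightarrow> ereal l) (at 0)"
    by (subst tendsto_iff_Liminf_eq_Limsup) (use l in \<open>auto simp: li_def ls_def\<close>)
  then show ?lim by auto
qed

lemma real_differentiable_iff_quotient:
  fixes f :: "real \<Rightarrow> real"
  shows "f differentiable (at x) \<longleftrightarrow> (\<exists>l. ((\<lambda>h. (f (x + h) - f x) / h) \<longlongrightarrow> l) (at 0))"
  by (simp add: real_differentiable_def DERIV_def)

text \<open>The Vitali estimate applies twice: to \<open>g\<close>, whose quotients drop below \<open>p\<close>, giving
  \<open>\<bar>g E\<bar> \<le> p \<bar>E\<bar>\<close>; and to the inverse of \<open>g\<close>, whose quotients drop below \<open>1 / q\<close>, giving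
  \<open>\<bar>E\<bar> \<le> \<bar>g E\<bar> / q\<close>. Hence \<open>\<bar>E\<bar> \<le> (p / q) \<bar>E\<bar>\<close> with \<open>p / q < 1\<close>.\<close>

lemma negligible_oscillation_set:
  fixes g :: "real \<Rightarrow> real"
  assumes lower: "\<And>x y. x < y \<Longrightarrow> y - x \<le> g y - g x"
    and upper: "\<And>x y. x < y \<Longrightarrow> g y - g x \<le> L * (y - x)"
    and pq: "p < q" and E: "bounded E"
    and lo: "\<And>x. x \<in> E \<Longrightarrow> \<exists>\<^sub>F h in at 0. (g (x + h) - g x) / h < p"
    and hi: "\<And>x. x \<in> E \<Longrightarrow> \<exists>\<^sub>F h in at 0. q < (g (x + h) - g x) / h"
  shows "negligible E"
proof (cases "E = {}")
  case False
  have lip: "\<bar>x - y\<bar> \<le> \<bar>g x - g y\<bar>" "\<bar>g x - g y\<bar> \<le> L * \<bar>x - y\<bar>" for x y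
    using lower[of x y] upper[of x y] lower[of y x] upper[of y x]
    by (cases x y rule: linorder_cases; auto simp: abs_if algebra_simps)+
  have L: "1 \<le> L" using lower[of 0 1] upper[of 0 1] by simp
  have mono: "strict_mono g"
    by (rule strict_monoI) (use lower in force)
  have cont: "isCont g x" for x
  proof -
    have "L-lipschitz_on UNIV g" using lip L by (auto simp: lipschitz_on_def dist_real_def)
    then show ?thesis
      using lipschitz_on_continuous_on continuous_on_eq_continuous_at by blast
  qed
  have surj: "\<exists>x. g x = a" for a
  proof -
    let ?x = "\<bar>a - g 0\<bar>"
    have "g (- ?x) \<le> a" using lower[of "- ?x" 0] by (cases "?x = 0") (auto simp: abs_if split: if_splits)
    moreover have "a \<le> g ?x" using lower[of 0 ?x] by (cases "?x = 0") (auto simp: abs_if split: if_splits)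
    ultimately show ?thesis using IVT[of g "- ?x" a ?x] cont by auto
  qed
  define G where "G = inv g"
  have gG: "g (G a) = a" for a using surj[of a] by (auto simp: G_def intro: f_inv_into_f)
  have Gg: "G (g x) = x" for x using mono by (simp add: G_def inv_f_f strict_mono_imp_inj_on)
  have Glip: "\<bar>G a - G b\<bar> \<le> \<bar>a - b\<bar>" for a b using lip(1)[of "G a" "G b"] by (simp add: gG)
  have G_mono: "strict_mono G"
  proof (rule strict_monoI)
    fix a b :: real assume "a < b"
    then have "g (G a) < g (G b)" by (simp add: gG)
    then show "G a < G b" using mono by (simp add: strict_mono_less)
  qed
  have G_cont: "isCont G x" for x
  proof -
    have "1-lipschitz_on UNIV G" using Glip by (auto simp: lipschitz_on_def dist_real_def)
    then show ?thesis
      using lipschitz_on_continuous_on continuous_on_eq_continuous_at by blast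
  qed
  have p: "0 < p"
  proof -
    obtain x where "x \<in> E" using False by auto
    obtain h where h: "h \<noteq> 0" "(g (x + h) - g x) / h < p"
      using lo[OF \<open>x \<in> E\<close>] by (auto simp: frequently_at intro: zero_less_one)
    have "0 \<le> (g (x + h) - g x) / h"
      using h(1) lower[of x "x + h"] lower[of "x + h" x]
      by (cases "0 < h") (auto simp: zero_le_divide_iff)
    then show ?thesis using h by simp
  qed
  have 1: "outer_measure_of lebesgue (g ` E) \<le> ennreal p * outer_measure_of lebesgue E"
  proof (rule Vitali_image_estimate[OF mono cont p])
    fix x d :: real assume "x \<in> E" "0 < d"
    then show "\<exists>h. h \<noteq> 0 \<and> \<bar>h\<bar> < d \<and> (g (x + h) - g x) / h < p"
      using lo[of x] by (auto simp: frequently_at dist_real_def)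
  qed
  have 2: "outer_measure_of lebesgue (G ` g ` E) \<le> ennreal (1 / q) * outer_measure_of lebesgue (g ` E)"
  proof (rule Vitali_image_estimate[OF G_mono G_cont])
    show "0 < 1 / q" using p pq by simp
    fix y d :: real assume y: "y \<in> g ` E" and d: "0 < d"
    obtain x where x: "x \<in> E" "y = g x" using y by auto
    have "0 < d / L" using d L by simp
    then obtain h where h: "h \<noteq> 0" "\<bar>h\<bar> < d / L" "q < (g (x + h) - g x) / h"
      using hi[OF x(1)] by (auto simp: frequently_at dist_real_def)
    define k where "k = g (x + h) - g x"
    have "\<bar>h\<bar> \<le> \<bar>k\<bar>" "\<bar>k\<bar> \<le> L * \<bar>h\<bar>" using lip[of "x + h" x] by (auto simp: k_def)
    moreover have "L * \<bar>h\<bar> < d" using h(2) L by (simp add: field_simps)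
    moreover have "(G (y + k) - G y) / k = 1 / ((g (x + h) - g x) / h)"
      by (simp add: x k_def Gg)
    moreover have "1 / ((g (x + h) - g x) / h) < 1 / q"
    proof (rule divide_strict_left_mono[OF h(3)])
      have "0 < (g (x + h) - g x) / h" using h(3) p pq by linarith
      then show "0 < (g (x + h) - g x) / h * q" using p pq by (intro mult_pos_pos) auto
    qed simp
    ultimately show "\<exists>k. k \<noteq> 0 \<and> \<bar>k\<bar> < d \<and> (G (y + k) - G y) / k < 1 / q"
      using h(1) by (intro exI[of _ k]) auto
  qed
  let ?m = "outer_measure_of lebesgue E"
  have "G ` g ` E = E" by (simp add: image_image Gg)
  then have "?m \<le> ennreal (1 / q) * outer_measure_of lebesgue (g ` E)" using 2 by (simp only:)
  also have "\<dots> \<le> ennreal (1 / q) * (ennreal p * ?m)" by (intro mult_left_mono 1) simp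
  also have "\<dots> = ennreal (p / q) * ?m"
    using p pq by (simp add: mult.assoc[symmetric] ennreal_mult[symmetric])
  finally have m: "?m \<le> ennreal (p / q) * ?m" .
  have "?m < \<infinity>"
  proof -
    obtain a where ab: "E \<subseteq> cbox (- a) a" using bounded_subset_cbox_symmetric[OF E] .
    have "?m \<le> outer_measure_of lebesgue (cbox (- a) a)" by (rule outer_measure_of_mono[OF ab])
    also have "\<dots> < \<infinity>" by (simp add: emeasure_lborel_Icc_eq)
    finally show ?thesis .
  qed
  then obtain r where r: "?m = ennreal r" "0 \<le> r" by (cases ?m) auto
  have "r \<le> p / q * r" using m r p pq by (simp add: ennreal_mult[symmetric])
  moreover have "p / q < 1" using p pq by simp
  ultimately have "r = 0" using r(2) by (smt (verit) mult_le_cancel_right1)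
  then have "?m = 0" using r by simp
  moreover obtain F where "F \<in> sets lebesgue" "E \<subseteq> F" "?m = emeasure lebesgue F"
    using outer_measure_of_attain[of E lebesgue] by auto
  ultimately show "negligible E"
    by (metis negligible_iff_null_sets negligible_subset null_setsI)
qed simp

text \<open>Adding a large multiple of the identity turns \<open>f\<close> into a function \<open>g\<close> that expands distances and is
  Lipschitz, without changing the points of differentiability.\<close>

lemma Lipschitz_differentiable_ae_real:
  fixes f :: "real \<Rightarrow> real"
  assumes lip: "L-lipschitz_on UNIV f"
  shows "negligible {x. \<not> f differentiable (at x)}"
proof -
  define g where "g x = f x + (L + 1) * x" for x
  have f: "\<bar>f y - f x\<bar> \<le> L * \<bar>y - x\<bar>" for x y
    using lipschitz_onD[OF lip, of y x] by (simp add: dist_real_def)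
  have lower: "y - x \<le> g y - g x" and upper: "g y - g x \<le> (2 * L + 1) * (y - x)" if "x < y" for x y
    using f[of y x] that by (auto simp: g_def algebra_simps abs_if split: if_splits)
  define E where "E p q n = {x. \<bar>x\<bar> \<le> real n \<and> (\<exists>\<^sub>F h in at 0. (g (x + h) - g x) / h < p) \<and>
      (\<exists>\<^sub>F h in at 0. q < (g (x + h) - g x) / h)}" for p q n
  have negl: "negligible (E p q n)" if "p < q" for p q n
    by (rule negligible_oscillation_set[of g "2 * L + 1" p q, OF lower upper that])
      (auto simp: E_def bounded_iff)
  have "{x. \<not> f differentiable (at x)} \<subseteq> (\<Union>(p, q, n)\<in>{(p, q, n). p \<in> \<rat> \<and> q \<in> \<rat> \<and> p < q}. E p q n)"
  proof
    fix x assume "x \<in> {x. \<not> f differentiable (at x)}"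
    moreover have "f differentiable (at x)" if "g differentiable (at x)"
    proof -
      have "f = (\<lambda>x. g x - (L + 1) * x)" by (simp add: g_def)
      then show ?thesis using that by (simp add: differentiable_diff)
    qed
    ultimately have "\<not> g differentiable (at x)" by auto
    moreover have "\<bar>(g (x + h) - g x) / h\<bar> \<le> 2 * L + 1" if "h \<noteq> 0" for h
      using that lower[of x "x + h"] upper[of x "x + h"] lower[of "x + h" x] upper[of "x + h" x]
      by (cases "0 < h") (auto simp: abs_if field_simps)
    ultimately obtain p q where "p \<in> \<rat>" "q \<in> \<rat>" "p < q"
        "\<exists>\<^sub>F h in at 0. (g (x + h) - g x) / h < p" "\<exists>\<^sub>F h in at 0. q < (g (x + h) - g x) / h"
      unfolding real_differentiable_iff_quotient
      by (subst (asm) tendsto_at_0_iff_no_oscillation[where B = "2 * L + 1"]) auto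
    moreover obtain n where "\<bar>x\<bar> \<le> real n" using real_arch_simple by blast
    ultimately have "x \<in> E p q n" by (simp add: E_def)
    then show "x \<in> (\<Union>(p, q, n)\<in>{(p, q, n). p \<in> \<rat> \<and> q \<in> \<rat> \<and> p < q}. E p q n)"
      using \<open>p \<in> \<rat>\<close> \<open>q \<in> \<rat>\<close> \<open>p < q\<close> by blast
  qed
  moreover have "negligible (\<Union>(p, q, n)\<in>{(p, q, n). p \<in> \<rat> \<and> q \<in> \<rat> \<and> p < q}. E p q n)"
  proof (rule negligible_countable_Union)
    have "countable (\<rat> \<times> \<rat> \<times> (UNIV :: nat set) :: (real \<times> real \<times> nat) set)"
      by (intro countable_SIGMA countable_rat) auto
    then have "countable {(p :: real, q :: real, n :: nat). p \<in> \<rat> \<and> q \<in> \<rat> \<and> p < q}"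
      by (rule countable_subset[rotated]) auto
    then show "countable ((\<lambda>(p, q, n). E p q n) ` {(p, q, n). p \<in> \<rat> \<and> q \<in> \<rat> \<and> p < q})"
      by (rule countable_image)
  qed (use negl in auto)
  ultimately show ?thesis using negligible_subset by blast
qed

text \<open>Fubini in an arbitrary direction, without a choice of coordinates: integrating
  \<open>indicator N (x + t e)\<close> over \<open>x\<close> first gives the measure of \<open>N\<close> for each \<open>t\<close> in the unit interval, by translation invariance,
  whereas integrating over \<open>t\<close> first gives 0.\<close>

lemma null_sets_if_lines_null:
  fixes N :: "'a::euclidean_space set" and e :: 'a
  assumes N [measurable]: "N \<in> sets borel"
    and lines: "\<And>x. {t::real. x + t *\<^sub>R e \<in> N} \<in> null_sets lborel"
  shows "N \<in> null_sets lborel"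
proof -
  define f :: "'a \<times> real \<Rightarrow> ennreal" where "f = (\<lambda>(x, t). indicator {0..1} t * indicator N (x + t *\<^sub>R e))"
  have f [measurable]: "f \<in> borel_measurable (lborel \<Otimes>\<^sub>M lborel)"
    unfolding f_def by measurable
  have "(\<integral>\<^sup>+t. f (x, t) \<partial>lborel) = 0" for x
  proof -
    have "(\<integral>\<^sup>+t. f (x, t) \<partial>lborel) \<le> (\<integral>\<^sup>+t. indicator {t. x + t *\<^sub>R e \<in> N} t \<partial>lborel)"
      unfolding f_def by (intro nn_integral_mono) (auto split: split_indicator)
    also have "\<dots> = emeasure lborel {t. x + t *\<^sub>R e \<in> N}"
      using lines[of x] by (intro nn_integral_indicator) auto
    also have "\<dots> = 0" using lines[of x] by auto
    finally show ?thesis by simp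
  qed
  moreover have "(\<integral>\<^sup>+x. f (x, t) \<partial>lborel) = indicator {0..1} t * emeasure lborel N" for t
  proof -
    have "(\<integral>\<^sup>+x. f (x, t) \<partial>lborel) = indicator {0..1} t * (\<integral>\<^sup>+x. indicator N (x + t *\<^sub>R e) \<partial>lborel)"
      unfolding f_def by (simp add: nn_integral_cmult)
    also have "(\<integral>\<^sup>+x. indicator N (x + t *\<^sub>R e) \<partial>lborel)
        = (\<integral>\<^sup>+x. indicator N x \<partial>distr lborel borel ((+) (t *\<^sub>R e)))"
      by (subst nn_integral_distr) (auto simp: add.commute)
    also have "\<dots> = emeasure lborel N" by (simp add: lborel_distr_plus)
    finally show ?thesis .
  qed
  ultimately have "(\<integral>\<^sup>+t. indicator {0..1} t * emeasure lborel N \<partial>(lborel :: real measure)) = 0"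
    using lborel_pair.Fubini[of f, OF f] by simp
  moreover have "(\<integral>\<^sup>+t. indicator {0..1} t * emeasure lborel N \<partial>(lborel :: real measure)) = emeasure lborel N"
    by (subst nn_integral_multc) auto
  ultimately show ?thesis by auto
qed

text \<open>The restriction of \<open>f\<close> to each line in the direction \<open>e\<close> is Lipschitz on the real line, so only the Borel
  measurability of the exceptional set is at stake. It holds because for each step size \<open>h\<close> the
  difference quotient is continuous in the base point, and frequently crossing a level is a countable intersection of
  unions of open conditions.\<close>

lemma Lipschitz_directionally_differentiable_ae:
  fixes f :: "'a::euclidean_space \<Rightarrow> real"
  assumes lip: "L-lipschitz_on UNIV f"
  shows "{x. \<not> (\<lambda>t. f (x + t *\<^sub>R e)) differentiable (at 0)} \<in> null_sets lborel"
proof -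
  define Q where "Q x h = (f (x + h *\<^sub>R e) - f x) / h" for x h
  have L: "0 \<le> L" using lipschitz_on_nonneg[OF lip] .
  have lip': "\<bar>f (x + s *\<^sub>R e) - f (x + t *\<^sub>R e)\<bar> \<le> (L * norm e) * \<bar>s - t\<bar>" for x s t
    using lipschitz_onD[OF lip, of "x + s *\<^sub>R e" "x + t *\<^sub>R e"]
    by (simp add: dist_real_def dist_norm mult_ac flip: scaleR_diff_left)
  have Q_bdd: "\<bar>Q x h\<bar> \<le> L * norm e" if "h \<noteq> 0" for x h
    using lip'[of x h 0] that by (simp add: Q_def field_simps)
  have diff_iff: "(\<lambda>t. f (x + t *\<^sub>R e)) differentiable (at 0) \<longleftrightarrow> (\<exists>l. (Q x \<longlongrightarrow> l) (at 0))" for x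
    unfolding real_differentiable_iff_quotient Q_def by simp
  define A where "A p = {x. \<exists>\<^sub>F h in at 0. Q x h < p}" for p
  define B where "B q = {x. \<exists>\<^sub>F h in at 0. q < Q x h}" for q
  define N where "N = (\<Union>p\<in>\<rat>. \<Union>q\<in>\<rat> \<inter> {p<..}. A p \<inter> B q)"
  have N_eq: "{x. \<not> (\<lambda>t. f (x + t *\<^sub>R e)) differentiable (at 0)} = N"
  proof -
    have "(\<exists>l. (Q x \<longlongrightarrow> l) (at 0)) \<longleftrightarrow> x \<notin> N" for x
      using tendsto_at_0_iff_no_oscillation[of "Q x" "L * norm e", OF Q_bdd]
      by (auto simp: N_def A_def B_def)
    then show ?thesis unfolding diff_iff by auto
  qed
  have Q_cont: "continuous_on UNIV (\<lambda>x. Q x h)" for h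
    unfolding Q_def divide_inverse
    by (intro continuous_intros continuous_on_compose2[OF lipschitz_on_continuous_on[OF lip]]) auto
  have freq: "(\<exists>\<^sub>F h in at 0. P h) \<longleftrightarrow> (\<forall>m. \<exists>h. h \<noteq> 0 \<and> \<bar>h\<bar> < 1 / Suc m \<and> P h)"
    for P :: "real \<Rightarrow> bool"
  proof
    assume R: "\<forall>m. \<exists>h. h \<noteq> 0 \<and> \<bar>h\<bar> < 1 / Suc m \<and> P h"
    show "\<exists>\<^sub>F h in at 0. P h"
      unfolding frequently_at
    proof safe
      fix d :: real assume "0 < d"
      then obtain m where m: "1 / Suc m < d" using nat_approx_posE by metis
      obtain h where "h \<noteq> 0" "\<bar>h\<bar> < 1 / Suc m" "P h" using R by blast
      then show "\<exists>h\<in>UNIV. h \<noteq> 0 \<and> dist h 0 < d \<and> P h"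
        using m by (intro bexI[of _ h]) auto
    qed
  next
    assume "\<exists>\<^sub>F h in at 0. P h"
    then have "\<exists>h. h \<noteq> 0 \<and> dist h 0 < d \<and> P h" if "0 < d" for d
      using that by (auto simp: frequently_at)
    from this[of "1 / Suc _"] show "\<forall>m. \<exists>h. h \<noteq> 0 \<and> \<bar>h\<bar> < 1 / Suc m \<and> P h"
      by (simp add: dist_real_def)
  qed
  have A: "A p \<in> sets borel" for p
  proof -
    have "A p = (\<Inter>m. \<Union>h\<in>{h. h \<noteq> 0 \<and> \<bar>h\<bar> < 1 / Suc m}. {x. Q x h < p})"
      unfolding A_def freq by auto
    moreover have "open {x. Q x h < p}" for h
      using Q_cont by (intro open_Collect_less continuous_intros) auto
    ultimately show ?thesis by (simp add: sets.countable_INT' borel_open open_UN)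
  qed
  have B: "B q \<in> sets borel" for q
  proof -
    have "B q = (\<Inter>m. \<Union>h\<in>{h. h \<noteq> 0 \<and> \<bar>h\<bar> < 1 / Suc m}. {x. q < Q x h})"
      unfolding B_def freq by auto
    moreover have "open {x. q < Q x h}" for h
      using Q_cont by (intro open_Collect_less continuous_intros) auto
    ultimately show ?thesis by (simp add: sets.countable_INT' borel_open open_UN)
  qed
  have N [measurable]: "N \<in> sets borel"
    unfolding N_def using A B by (intro sets.countable_UN'' countable_Int1 countable_rat sets.Int)
  have "N \<in> null_sets lborel"
  proof (rule null_sets_if_lines_null[OF N])
    fix x
    define F where "F t = f (x + t *\<^sub>R e)" for t
    have "(L * norm e)-lipschitz_on UNIV F"
      using lip' L by (auto simp: lipschitz_on_def F_def dist_real_def)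
    then have "negligible {t. \<not> F differentiable (at t)}" by (rule Lipschitz_differentiable_ae_real)
    moreover have "{t. \<not> F differentiable (at t)} = {t. x + t *\<^sub>R e \<in> N}"
      unfolding N_eq[symmetric] real_differentiable_iff_quotient
      by (simp add: F_def algebra_simps)
    ultimately have "{t. x + t *\<^sub>R e \<in> N} \<in> null_sets lebesgue" by (simp add: negligible_iff_null_sets)
    moreover have "{t. x + t *\<^sub>R e \<in> N} \<in> sets lborel" by measurable
    ultimately show "{t. x + t *\<^sub>R e \<in> N} \<in> null_sets lborel"
      using null_sets_completion_iff by blast
  qed
  then show ?thesis by (simp add: N_eq)
qed

text \<open>An open set is a countable union of closed boxes. On each of them \<open>\<phi>\<close> agrees with \<open>\<phi> \<circ> clamp a b\<close>, which is Lipschitz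
  on the whole space, and the boundary of a box is negligible.\<close>

lemma Lip_loc_directionally_differentiable_ae:
  fixes \<phi> :: "real^'n \<Rightarrow> real"
  assumes "open D" and \<phi>: "\<phi> \<in> Lip_loc D"
  shows "negligible {x\<in>D. \<not> (\<lambda>t. \<phi> (x + t *\<^sub>R e)) differentiable (at 0)}"
proof -
  obtain \<D> where \<D>: "countable \<D>" "\<D> \<subseteq> Pow D" "\<And>X. X \<in> \<D> \<Longrightarrow> \<exists>a b. X = cbox a b" "\<Union>\<D> = D"
    using open_countable_Union_open_cbox[OF \<open>open D\<close>] by metis
  let ?N = "\<lambda>\<phi>. {x. \<not> (\<lambda>t. \<phi> (x + t *\<^sub>R e)) differentiable (at 0)}"
  have "negligible (X \<inter> ?N \<phi>)" if X: "X \<in> \<D>" for X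
  proof -
    obtain a b where ab: "X = cbox a b" using \<D>(3)[OF X] by auto
    show ?thesis
    proof (cases "X = {}")
      case False
      then have ne: "\<forall>i\<in>Basis. a \<bullet> i \<le> b \<bullet> i" by (simp add: ab box_ne_empty)
      have "compact X" "X \<subseteq> D" using X \<D>(2) by (auto simp: ab)
      then obtain L where L: "L-lipschitz_on X \<phi>" using \<phi> by (auto simp: Lip_loc_def)
      define \<psi> where "\<psi> x = \<phi> (clamp a b x)" for x
      have "L-lipschitz_on UNIV \<psi>"
      proof (rule lipschitz_onI)
        fix x y
        have "dist (\<psi> x) (\<psi> y) \<le> L * dist (clamp a b x) (clamp a b y)"
          unfolding \<psi>_def using ne ab by (intro lipschitz_onD[OF L]) (auto intro!: clamp_in_interval)
        also have "\<dots> \<le> L * dist x y"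
          using lipschitz_on_nonneg[OF L] by (intro mult_left_mono dist_clamps_le_dist_args)
        finally show "dist (\<psi> x) (\<psi> y) \<le> L * dist x y" .
      qed (rule lipschitz_on_nonneg[OF L])
      from Lipschitz_directionally_differentiable_ae[OF this, of e]
      have "negligible (?N \<psi>)"
        by (simp add: negligible_iff_null_sets null_sets_completionI)
      moreover have "negligible (cbox a b - box a b)" by (rule negligible_frontier_interval)
      moreover have "X \<inter> ?N \<phi> \<subseteq> (cbox a b - box a b) \<union> ?N \<psi>"
      proof
        fix x assume x: "x \<in> X \<inter> ?N \<phi>"
        have "(\<lambda>t. \<phi> (x + t *\<^sub>R e)) differentiable (at 0)"
          if box: "x \<in> box a b" and d: "(\<lambda>t. \<psi> (x + t *\<^sub>R e)) differentiable (at 0)"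
        proof -
          have "((\<lambda>t. x + t *\<^sub>R e) \<longlongrightarrow> x + 0 *\<^sub>R e) (nhds 0)"
            by (intro tendsto_add tendsto_const tendsto_scaleR filterlim_ident)
          then have "\<forall>\<^sub>F t in nhds 0. x + t *\<^sub>R e \<in> box a b"
            using box by (intro topological_tendstoD[OF _ open_box]) auto
          then have ev: "\<forall>\<^sub>F t in nhds 0. \<psi> (x + t *\<^sub>R e) = \<phi> (x + t *\<^sub>R e)"
            by eventually_elim (auto simp: \<psi>_def clamp_cancel_cbox box_subset_cbox[THEN subsetD])
          obtain l where "((\<lambda>t. \<psi> (x + t *\<^sub>R e)) has_real_derivative l) (at 0)"
            using d by (auto simp: real_differentiable_def)
          then have "((\<lambda>t. \<phi> (x + t *\<^sub>R e)) has_real_derivative l) (at 0)"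
            using DERIV_cong_ev[OF refl ev refl] by simp
          then show ?thesis by (auto simp: real_differentiable_def)
        qed
        then show "x \<in> (cbox a b - box a b) \<union> ?N \<psi>" using x ab by auto
      qed
      ultimately show ?thesis by (meson negligible_Un negligible_subset)
    qed simp
  qed
  then have "negligible (\<Union>X\<in>\<D>. X \<inter> ?N \<phi>)"
    using \<D>(1) by (intro negligible_countable_Union) auto
  moreover have "{x\<in>D. \<not> (\<lambda>t. \<phi> (x + t *\<^sub>R e)) differentiable (at 0)} = (\<Union>X\<in>\<D>. X \<inter> ?N \<phi>)"
    using \<D>(4) by blast
  ultimately show ?thesis by simp
qed

section \<open>Completeness of the L2 space of a field of quadratic forms\<close>

text \<open>With pointwise operations the function spaces become subspaces of one real vector space, as the
  Lax--Milgram theorem requires.\<close>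

instantiation "fun" :: (type, real_vector) real_vector
begin
definition scaleR_fun where "scaleR_fun c f = (\<lambda>x. c *\<^sub>R f x)"
instance
  by standard (simp_all add: scaleR_fun_def plus_fun_def algebra_simps)
end

lemma scaleR_fun_apply [simp]: "(c *\<^sub>R f) x = c *\<^sub>R f x"
  by (simp add: scaleR_fun_def)

lemma sub_fun_apply [simp]: "(f - g) x = f x - g x" for f g :: "'a \<Rightarrow> 'b::real_vector"
  by (simp add: fun_diff_def)

text \<open>A measurable field of quadratic forms, positive definite almost everywhere, defines the \<open>L2\<close> space of the
  \<open>f\<close> with \<open>\<integral> q\<^sub>x(f x, f x) < \<infinity>\<close>. The weighted space \<open>L2 v\<close>, the space \<open>QL2\<close> and their direct sum are
  all of this kind, so that completeness is proved once.\<close>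

locale quadratic_field =
  fixes M :: "'a measure" and q :: "'a \<Rightarrow> 'b::euclidean_space \<Rightarrow> 'b \<Rightarrow> real"
  assumes q_meas: "\<lbrakk>f \<in> borel_measurable M; g \<in> borel_measurable M\<rbrakk>
      \<Longrightarrow> (\<lambda>x. q x (f x) (g x)) \<in> borel_measurable M"
    and q_bil: "x \<in> space M \<Longrightarrow> bilinear (q x)"
    and q_sym: "x \<in> space M \<Longrightarrow> q x a b = q x b a"
    and q_nonneg: "x \<in> space M \<Longrightarrow> 0 \<le> q x a a"
    and q_pos: "AE x in M. \<forall>a. a \<noteq> 0 \<longrightarrow> 0 < q x a a"
begin

definition L2q :: "('a \<Rightarrow> 'b) set" where
  "L2q = {f \<in> borel_measurable M. integrable M (\<lambda>x. q x (f x) (f x))}"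

definition ipq :: "('a \<Rightarrow> 'b) \<Rightarrow> ('a \<Rightarrow> 'b) \<Rightarrow> real" where
  "ipq f g = (LINT x|M. q x (f x) (g x))"

lemma q_add: "x \<in> space M \<Longrightarrow> q x (a + b) c = q x a c + q x b c"
  and q_add_right: "x \<in> space M \<Longrightarrow> q x c (a + b) = q x c a + q x c b"
  and q_scale: "x \<in> space M \<Longrightarrow> q x (t *\<^sub>R a) b = t * q x a b"
  and q_scale_right: "x \<in> space M \<Longrightarrow> q x b (t *\<^sub>R a) = t * q x b a"
  using q_bil[of x] by (auto simp: bilinear_ladd bilinear_radd bilinear_lmul bilinear_rmul)

lemma q_expand:
  "x \<in> space M \<Longrightarrow> q x (a + t *\<^sub>R b) (a + t *\<^sub>R b) = q x a a + 2 * t * q x a b + t\<^sup>2 * q x b b"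
  by (simp add: q_add q_add_right q_scale q_scale_right q_sym[of x b a] power2_eq_square algebra_simps)

lemma q_polar_bound: "x \<in> space M \<Longrightarrow> 2 * \<bar>q x a b\<bar> \<le> q x a a + q x b b"
  using q_expand[of x a 1 b] q_expand[of x a "-1" b] q_nonneg[of x "a + b"] q_nonneg[of x "a - b"]
  by (simp add: abs_if)

lemma q_integrable:
  assumes f: "f \<in> L2q" and g: "g \<in> L2q"
  shows "integrable M (\<lambda>x. q x (f x) (g x))"
proof (rule Bochner_Integration.integrable_bound)
  show "integrable M (\<lambda>x. q x (f x) (f x) + q x (g x) (g x))"
    using f g by (simp add: L2q_def)
  show "AE x in M. norm (q x (f x) (g x)) \<le> norm (q x (f x) (f x) + q x (g x) (g x))"
  proof (rule AE_I2)
    fix x assume x: "x \<in> space M"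
    then show "norm (q x (f x) (g x)) \<le> norm (q x (f x) (f x) + q x (g x) (g x))"
      using q_polar_bound[OF x, of "f x" "g x"] q_nonneg[OF x, of "f x"] q_nonneg[OF x, of "g x"]
      by simp
  qed
qed (use f g in \<open>auto simp: L2q_def intro: q_meas\<close>)

lemma L2q_subspace: "subspace L2q"
  unfolding subspace_def
proof (intro conjI ballI allI)
  have "integrable M (\<lambda>x. q x 0 0) = integrable M (\<lambda>x. 0 :: real)"
    by (rule Bochner_Integration.integrable_cong) (use q_scale[of _ 0 0 0] in auto)
  then show "0 \<in> L2q" by (simp add: L2q_def zero_fun_def)
  fix f assume f: "f \<in> L2q"
  { fix g assume g: "g \<in> L2q"
    have "integrable M (\<lambda>x. q x (f x + g x) (f x + g x))
        = integrable M (\<lambda>x. q x (f x) (f x) + 2 * q x (f x) (g x) + q x (g x) (g x))"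
      by (rule Bochner_Integration.integrable_cong) (use q_expand[of _ _ 1] in auto)
    then show "f + g \<in> L2q"
      using f g q_integrable[OF f g] by (auto simp: L2q_def plus_fun_def) }
  fix c
  have "integrable M (\<lambda>x. q x (c *\<^sub>R f x) (c *\<^sub>R f x)) = integrable M (\<lambda>x. c\<^sup>2 * q x (f x) (f x))"
    by (rule Bochner_Integration.integrable_cong)
      (auto simp: q_scale q_scale_right power2_eq_square)
  then show "c *\<^sub>R f \<in> L2q" using f by (auto simp: L2q_def scaleR_fun_def)
qed

sublocale semi_inner_space L2q ipq
proof
  show "subspace L2q" by (rule L2q_subspace)
  fix f g h assume f: "f \<in> L2q" and g: "g \<in> L2q"
  show "ipq f g = ipq g f"
    unfolding ipq_def by (rule Bochner_Integration.integral_cong) (auto simp: q_sym)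
  show "ipq (c *\<^sub>R f) g = c * ipq f g" for c
  proof -
    have "ipq (c *\<^sub>R f) g = (LINT x|M. c * q x (f x) (g x))"
      unfolding ipq_def by (rule Bochner_Integration.integral_cong) (auto simp: q_scale)
    then show ?thesis by (simp add: ipq_def)
  qed
  show "0 \<le> ipq f f" unfolding ipq_def
    by (rule integral_nonneg_AE) (auto intro: AE_I2 simp: q_nonneg)
  assume h: "h \<in> L2q"
  have "ipq (f + g) h = (LINT x|M. q x (f x) (h x) + q x (g x) (h x))"
    unfolding ipq_def by (rule Bochner_Integration.integral_cong) (auto simp: q_add)
  then show "ipq (f + g) h = ipq f h + ipq g h"
    using f g h q_integrable by (simp add: ipq_def)
qed

lemma nn_integral_q:
  assumes "f \<in> L2q"
  shows "(\<integral>\<^sup>+x. ennreal (q x (f x) (f x)) \<partial>M) = ennreal ((nrm f)\<^sup>2)"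
  unfolding nrm_square[OF assms] ipq_def
  by (rule nn_integral_eq_integral) (use assms in \<open>auto simp: L2q_def q_nonneg\<close>)

lemma q_coercive:
  assumes x: "x \<in> space M" and pos: "\<forall>a. a \<noteq> 0 \<longrightarrow> 0 < q x a a"
  shows "\<exists>c>0. \<forall>a. c * (norm a)\<^sup>2 \<le> q x a a"
proof -
  have "bounded_bilinear (q x)" using q_bil[OF x] by (simp add: bilinear_conv_bounded_bilinear)
  then have cont: "continuous_on (sphere 0 1) (\<lambda>a. q x a a)"
    by (rule bounded_bilinear.continuous_on[OF _ continuous_on_id continuous_on_id])
  have "sphere 0 1 \<noteq> ({} :: 'b set)" by simp
  then obtain e where e: "norm e = 1" "\<And>a. norm a = 1 \<Longrightarrow> q x e e \<le> q x a a"
    using continuous_attains_inf[OF compact_sphere _ cont] by auto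
  have "q x e e * (norm a)\<^sup>2 \<le> q x a a" for a
  proof (cases "a = 0")
    case False
    define b where "b = (1 / norm a) *\<^sub>R a"
    have "norm b = 1" "a = norm a *\<^sub>R b" using False by (auto simp: b_def)
    then have "q x a a = (norm a)\<^sup>2 * q x b b"
      by (metis q_scale[OF x] q_scale_right[OF x] mult.assoc power2_eq_square)
    then show ?thesis
      using e(2)[OF \<open>norm b = 1\<close>] mult_left_mono[of "q x e e" "q x b b" "(norm a)\<^sup>2"]
      by (simp add: mult.commute)
  qed (simp add: q_nonneg x)
  moreover have "0 < q x e e" using pos e(1) by (metis norm_zero zero_neq_one)
  ultimately show ?thesis by blast
qed

text \<open>Dividing the squared increments by \<open>r ^ n\<close> leaves a summable series of integrals. So almost everywhere
  \<open>q\<^sub>x(d\<^sub>n, d\<^sub>n)\<close> is at most a constant times \<open>r ^ n\<close>, and since \<open>q\<^sub>x\<close> is coercive, the increments are dominated by a geometric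
  series and \<open>X n x\<close> converges. Fatou's lemma shows that this pointwise limit is also the limit in norm.\<close>

lemma L2q_complete:
  assumes X: "\<And>n. X n \<in> L2q" and r: "0 < r" "r < 1"
    and fast: "\<And>n::nat. nrm (X (Suc n) - X n) \<le> C * r ^ n"
  shows "\<exists>g\<in>L2q. (\<lambda>n. nrm (X n - g)) \<longlonglongrightarrow> 0"
proof -
  have X_meas [measurable]: "X n \<in> borel_measurable M" for n using X by (auto simp: L2q_def)
  have C: "0 \<le> C"
    using order_trans[OF nrm_nonneg[OF mem(2)[OF X X]] fast[of 0]] by simp
  define d where "d n = X (Suc n) - X n" for n
  have d: "d n \<in> L2q" for n using X mem by (simp add: d_def)
  have d_meas [measurable]: "d n \<in> borel_measurable M" for n using d by (auto simp: L2q_def)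
  note [measurable] = q_meas
  define S where "S x = (\<Sum>n. ennreal (q x (d n x) (d n x) / r ^ n))" for x
  have int_d: "(\<integral>\<^sup>+x. ennreal (q x (d n x) (d n x) / r ^ n) \<partial>M) \<le> ennreal (C\<^sup>2 * r ^ n)" for n
  proof -
    have "(\<integral>\<^sup>+x. ennreal (q x (d n x) (d n x) / r ^ n) \<partial>M)
        = (\<integral>\<^sup>+x. ennreal (1 / r ^ n) * ennreal (q x (d n x) (d n x)) \<partial>M)"
      using r by (intro nn_integral_cong) (simp add: ennreal_mult[symmetric] q_nonneg)
    also have "\<dots> = ennreal (1 / r ^ n) * ennreal ((nrm (d n))\<^sup>2)"
      by (subst nn_integral_cmult) (auto simp: nn_integral_q d)
    also have "\<dots> = ennreal ((nrm (d n))\<^sup>2 / r ^ n)"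
      using r by (simp add: ennreal_mult[symmetric])
    also have "\<dots> \<le> ennreal ((C * r ^ n)\<^sup>2 / r ^ n)"
      using fast[of n] d[of n] r
      by (intro ennreal_leI divide_right_mono power_mono) (auto simp: d_def[symmetric])
    also have "(C * r ^ n)\<^sup>2 / r ^ n = C\<^sup>2 * r ^ n"
      using r by (simp add: power2_eq_square)
    finally show ?thesis .
  qed
  have "(\<integral>\<^sup>+x. S x \<partial>M) \<le> (\<Sum>n. ennreal (C\<^sup>2 * r ^ n))"
    unfolding S_def by (subst nn_integral_suminf) (auto intro!: suminf_le int_d)
  also have "\<dots> = ennreal (\<Sum>n. C\<^sup>2 * r ^ n)"
    using r by (intro suminf_ennreal2) (auto intro!: summable_mult summable_geometric)
  finally have "(\<integral>\<^sup>+x. S x \<partial>M) \<noteq> \<infinity>" by (auto simp: top_unique)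
  then have S_fin: "AE x in M. S x \<noteq> \<infinity>"
    by (intro nn_integral_PInf_AE) (auto simp: S_def)
  define g where "g x = lim (\<lambda>n. X n x)" for x
  have g_meas [measurable]: "g \<in> borel_measurable M" unfolding g_def by measurable
  have conv: "AE x in M. (\<lambda>n. X n x) \<longlonglongrightarrow> g x"
    using S_fin q_pos AE_space
  proof eventually_elim
    case (elim x)
    obtain c where c: "0 < c" "\<And>a. c * (norm a)\<^sup>2 \<le> q x a a"
      using q_coercive[OF elim(3,2)] by blast
    obtain m where m: "S x = ennreal m" "0 \<le> m" using elim(1) by (cases "S x") auto
    have bnd: "norm (d n x) \<le> sqrt (m / c) * (sqrt r) ^ n" for n
    proof -
      have "(\<Sum>k\<in>{n}. ennreal (q x (d k x) (d k x) / r ^ k)) \<le> S x"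
        unfolding S_def by (rule sum_le_suminf) auto
      then have "q x (d n x) (d n x) / r ^ n \<le> m" using m by simp
      then have "c * (norm (d n x))\<^sup>2 \<le> m * r ^ n"
        using c(2)[of "d n x"] r by (simp add: field_simps)
      then have "(norm (d n x))\<^sup>2 \<le> m / c * r ^ n" using c by (simp add: field_simps)
      then have "sqrt ((norm (d n x))\<^sup>2) \<le> sqrt (m / c * r ^ n)" by (rule real_sqrt_le_mono)
      then show ?thesis by (simp add: real_sqrt_mult real_sqrt_divide real_sqrt_power)
    qed
    have "summable (\<lambda>n. sqrt (m / c) * (sqrt r) ^ n)"
      using r by (intro summable_mult summable_geometric) auto
    then have "summable (\<lambda>n. d n x)"
      by (rule summable_comparison_test'[where N = 0]) (use bnd in auto)
    then have "(\<lambda>n. X 0 x + (\<Sum>k<n. d k x)) \<longlonglongrightarrow> X 0 x + suminf (\<lambda>n. d n x)"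
      by (intro tendsto_intros summable_LIMSEQ)
    moreover have "X 0 x + (\<Sum>k<n. d k x) = X n x" for n
      by (simp add: d_def sum_lessThan_telescope[of "\<lambda>k. X k x"])
    ultimately have "convergent (\<lambda>n. X n x)" by (auto simp: convergent_def)
    then show ?case unfolding g_def by (simp add: convergent_LIMSEQ_iff)
  qed
  define T where "T n = C * r ^ n / (1 - r)" for n
  have T: "0 \<le> T n" for n using C r by (simp add: T_def)
  have tail: "nrm (X (n + k) - X n) \<le> T n" for n k
  proof -
    have "nrm (X (n + k) - X n) \<le> C * r ^ n * (1 - r ^ k) / (1 - r)"
    proof (induction k)
      case (Suc k)
      have "nrm (X (n + Suc k) - X n) \<le> nrm (X (n + Suc k) - X (n + k)) + nrm (X (n + k) - X n)"
        by (rule nrm_triangle_diff) (rule X)+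
      also have "\<dots> \<le> C * r ^ (n + k) + C * r ^ n * (1 - r ^ k) / (1 - r)"
        using add_mono[OF fast[of "n + k"] Suc] by (simp only: add_Suc_right)
      also have "\<dots> = C * r ^ n * (1 - r ^ Suc k) / (1 - r)"
        using r by (simp add: field_simps power_add)
      finally show ?case .
    qed (simp add: nrm_zero[unfolded zero_fun_def])
    also have "\<dots> \<le> T n"
      unfolding T_def using C r
      by (intro divide_right_mono) (auto intro!: mult_left_le)
    finally show ?thesis .
  qed
  have fatou: "(\<integral>\<^sup>+x. ennreal (q x (g x - X n x) (g x - X n x)) \<partial>M) \<le> ennreal ((T n)\<^sup>2)" for n
  proof -
    have "(\<integral>\<^sup>+x. ennreal (q x (g x - X n x) (g x - X n x)) \<partial>M)
      = (\<integral>\<^sup>+x. liminf (\<lambda>k. ennreal (q x (X (n + k) x - X n x) (X (n + k) x - X n x))) \<partial>M)"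
    proof (rule nn_integral_cong_AE)
      show "AE x in M. ennreal (q x (g x - X n x) (g x - X n x))
         = liminf (\<lambda>k. ennreal (q x (X (n + k) x - X n x) (X (n + k) x - X n x)))"
        using conv AE_space
      proof eventually_elim
        case (elim x)
        have bb: "bounded_bilinear (q x)" using q_bil[OF elim(2)] by (simp add: bilinear_conv_bounded_bilinear)
        have lim: "(\<lambda>k. X (n + k) x - X n x) \<longlonglongrightarrow> g x - X n x"
          using LIMSEQ_ignore_initial_segment[OF elim(1), of n]
          by (intro tendsto_intros) (simp add: add.commute)
        have "(\<lambda>k. q x (X (n + k) x - X n x) (X (n + k) x - X n x)) \<longlonglongrightarrow>
            q x (g x - X n x) (g x - X n x)"
          by (rule bounded_bilinear.tendsto[OF bb lim lim])
        then have "(\<lambda>k. ennreal (q x (X (n + k) x - X n x) (X (n + k) x - X n x))) \<longlonglongrightarrow>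
            ennreal (q x (g x - X n x) (g x - X n x))"
          by (rule tendsto_ennrealI)
        then show ?case by (simp add: lim_imp_Liminf)
      qed
    qed
    also have "\<dots> \<le> liminf (\<lambda>k. \<integral>\<^sup>+x. ennreal (q x (X (n + k) x - X n x) (X (n + k) x - X n x)) \<partial>M)"
      by (intro nn_integral_liminf) measurable
    also have "\<dots> \<le> liminf (\<lambda>k. ennreal ((T n)\<^sup>2))"
    proof (intro Liminf_mono always_eventually allI)
      fix k
      have "X (n + k) - X n \<in> L2q" using X mem by auto
      from nn_integral_q[OF this]
      show "(\<integral>\<^sup>+x. ennreal (q x (X (n + k) x - X n x) (X (n + k) x - X n x)) \<partial>M) \<le> ennreal ((T n)\<^sup>2)"
        using tail[of n k] \<open>X (n + k) - X n \<in> L2q\<close> by (auto intro!: ennreal_leI power_mono)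
    qed
    also have "\<dots> = ennreal ((T n)\<^sup>2)" by (simp add: Liminf_const)
    finally show ?thesis .
  qed
  have gX: "g - X n \<in> L2q" for n
    unfolding L2q_def
  proof safe
    show "g - X n \<in> borel_measurable M" by (simp add: fun_diff_def)
    show "integrable M (\<lambda>x. q x ((g - X n) x) ((g - X n) x))"
    proof (rule integrableI_bounded)
      have "(\<integral>\<^sup>+x. ennreal (norm (q x ((g - X n) x) ((g - X n) x))) \<partial>M)
          = (\<integral>\<^sup>+x. ennreal (q x (g x - X n x) (g x - X n x)) \<partial>M)"
        by (intro nn_integral_cong) (simp add: q_nonneg)
      then show "(\<integral>\<^sup>+x. ennreal (norm (q x ((g - X n) x) ((g - X n) x))) \<partial>M) < \<infinity>"
        using fatou[of n] by (simp add: le_less_trans[OF _ ennreal_less_top])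
    qed (simp add: q_meas)
  qed
  have gX_le: "nrm (g - X n) \<le> T n" for n
  proof (rule power2_le_imp_le)
    have "ennreal ((nrm (g - X n))\<^sup>2) \<le> ennreal ((T n)\<^sup>2)"
      using fatou[of n] nn_integral_q[OF gX, of n] by simp
    then show "(nrm (g - X n))\<^sup>2 \<le> (T n)\<^sup>2" by simp
  qed (rule T)
  have g: "g \<in> L2q" using mem(1)[OF gX X, of 0 0] by simp
  have "(\<lambda>n. nrm (X n - g)) \<longlonglongrightarrow> 0"
  proof (rule Lim_null_comparison)
    show "\<forall>\<^sub>F n in sequentially. norm (nrm (X n - g)) \<le> T n"
    proof (intro always_eventually allI)
      fix n
      have "nrm (X n - g) = nrm (g - X n)" by (rule nrm_minus_commute[OF X g])
      then show "norm (nrm (X n - g)) \<le> T n" using gX_le[of n] gX by simp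
    qed
    have "(\<lambda>n. C * r ^ n / (1 - r)) \<longlonglongrightarrow> C * 0 / (1 - r)"
      using r by (intro tendsto_intros LIMSEQ_power_zero) auto
    then show "T \<longlonglongrightarrow> 0" by (simp add: T_def[abs_def])
  qed
  then show ?thesis using g by blast
qed

lemma L2q_AE_cong:
  assumes f: "f \<in> L2q" and g: "g \<in> borel_measurable M" and eq: "AE x in M. f x = g x"
  shows "g \<in> L2q" and "nrm g = nrm f"
proof -
  have fM: "f \<in> borel_measurable M" using f by (simp add: L2q_def)
  have eq': "AE x in M. q x (f x) (f x) = q x (g x) (g x)" using eq by eventually_elim simp
  have "integrable M (\<lambda>x. q x (f x) (f x)) = integrable M (\<lambda>x. q x (g x) (g x))"
    by (rule integrable_cong_AE) (use fM g eq' in \<open>auto intro: q_meas\<close>)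
  then show "g \<in> L2q" using f g by (simp add: L2q_def)
  have "(LINT x|M. q x (f x) (f x)) = (LINT x|M. q x (g x) (g x))"
    by (rule integral_cong_AE) (use fM g eq' in \<open>auto intro: q_meas\<close>)
  then show "nrm g = nrm f" by (simp add: nrm_def ipq_def)
qed

lemma L2q_bounded_multiplier:
  assumes f: "f \<in> L2q" and c: "c \<in> borel_measurable M" and B: "\<And>x. x \<in> space M \<Longrightarrow> \<bar>c x\<bar> \<le> B"
  shows "(\<lambda>x. c x *\<^sub>R f x) \<in> L2q"
proof -
  have fM: "f \<in> borel_measurable M" using f by (simp add: L2q_def)
  have cf: "(\<lambda>x. c x *\<^sub>R f x) \<in> borel_measurable M" using c fM by simp
  have "integrable M (\<lambda>x. q x (c x *\<^sub>R f x) (c x *\<^sub>R f x))"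
  proof (rule Bochner_Integration.integrable_bound)
    show "integrable M (\<lambda>x. B\<^sup>2 * q x (f x) (f x))" using f by (simp add: L2q_def)
    show "AE x in M. norm (q x (c x *\<^sub>R f x) (c x *\<^sub>R f x)) \<le> norm (B\<^sup>2 * q x (f x) (f x))"
    proof (rule AE_I2)
      fix x assume x: "x \<in> space M"
      have "(c x)\<^sup>2 \<le> B\<^sup>2" using B[OF x] by (metis abs_ge_zero power2_abs power_mono)
      then show "norm (q x (c x *\<^sub>R f x) (c x *\<^sub>R f x)) \<le> norm (B\<^sup>2 * q x (f x) (f x))"
        using q_nonneg[OF x, of "f x"]
        by (simp add: q_scale[OF x] q_scale_right[OF x] abs_mult mult_right_mono
            flip: mult.assoc power2_eq_square)
    qed
  qed (rule q_meas[OF cf cf])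
  then show ?thesis using cf by (simp add: L2q_def)
qed

lemma nrm_eq_0_iff_AE:
  assumes f: "f \<in> L2q"
  shows "nrm f = 0 \<longleftrightarrow> (AE x in M. f x = 0)"
proof -
  have "nrm f = 0 \<longleftrightarrow> (LINT x|M. q x (f x) (f x)) = 0" by (simp add: nrm_def ipq_def)
  also have "\<dots> \<longleftrightarrow> (AE x in M. q x (f x) (f x) = 0)"
    using f by (intro integral_nonneg_eq_0_iff_AE) (auto simp: L2q_def q_nonneg)
  also have "\<dots> \<longleftrightarrow> (AE x in M. f x = 0)"
  proof
    assume "AE x in M. q x (f x) (f x) = 0"
    with q_pos show "AE x in M. f x = 0" by eventually_elim force
  next
    assume "AE x in M. f x = 0"
    with AE_space show "AE x in M. q x (f x) (f x) = 0"
    proof eventually_elim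
      case (elim x) then show ?case using q_scale[of x 0 0 0] by simp
    qed
  qed
  finally show ?thesis .
qed

end

section \<open>Calculus of the classical gradient\<close>

definition partially_differentiable :: "(real^'n \<Rightarrow> real) \<Rightarrow> real^'n \<Rightarrow> bool" where
  "partially_differentiable \<phi> x \<longleftrightarrow> (\<forall>i. (\<lambda>t. \<phi> (x + t *\<^sub>R axis i 1)) differentiable (at 0))"

lemma grad_eqI:
  assumes "\<And>i. ((\<lambda>t. \<phi> (x + t *\<^sub>R axis i 1)) has_real_derivative (w $ i)) (at 0)"
  shows "grad \<phi> x = w"
  unfolding grad_def vec_eq_iff using DERIV_imp_deriv[OF assms] by simp

lemma has_partial_derivative_grad:
  assumes "partially_differentiable \<phi> x"
  shows "((\<lambda>t. \<phi> (x + t *\<^sub>R axis i 1)) has_real_derivative (grad \<phi> x $ i)) (at 0)"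
  using assms DERIV_imp_deriv unfolding partially_differentiable_def grad_def real_differentiable_def
  by fastforce

lemma grad_add:
  assumes "partially_differentiable \<phi> x" "partially_differentiable \<psi> x"
  shows "grad (\<lambda>x. \<phi> x + \<psi> x) x = grad \<phi> x + grad \<psi> x"
  by (rule grad_eqI) (simp add: DERIV_add has_partial_derivative_grad assms)

lemma grad_scale:
  assumes "partially_differentiable \<phi> x"
  shows "grad (\<lambda>x. c * \<phi> x) x = c *\<^sub>R grad \<phi> x"
  by (rule grad_eqI) (simp add: DERIV_cmult has_partial_derivative_grad assms)

lemma grad_compose:
  assumes \<phi>: "partially_differentiable \<phi> x" and h: "(h has_real_derivative c) (at (\<phi> x))"
  shows "grad (\<lambda>x. h (\<phi> x)) x = c *\<^sub>R grad \<phi> x"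
proof (rule grad_eqI)
  fix i
  have "((\<lambda>t. h (\<phi> (x + t *\<^sub>R axis i 1))) has_real_derivative c * (grad \<phi> x $ i)) (at 0)"
    using has_partial_derivative_grad[OF \<phi>, of i] h by (intro DERIV_chain2[of h]) auto
  then show "((\<lambda>t. h (\<phi> (x + t *\<^sub>R axis i 1))) has_real_derivative (c *\<^sub>R grad \<phi> x) $ i) (at 0)"
    by simp
qed

lemma Lip_loc_partially_differentiable_ae:
  fixes \<phi> :: "real^'n \<Rightarrow> real"
  assumes "open D" "\<phi> \<in> Lip_loc D"
  shows "AE x in lebesgue_on D. partially_differentiable \<phi> x"
proof -
  define N where "N i = {x\<in>D. \<not> (\<lambda>t. \<phi> (x + t *\<^sub>R axis i 1)) differentiable (at 0)}" for i :: 'n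
  have "negligible (\<Union>i. N i)"
    using Lip_loc_directionally_differentiable_ae[OF assms]
    by (intro negligible_countable_Union) (auto simp: N_def)
  then have "AE x in lebesgue. x \<notin> (\<Union>i. N i)"
    by (intro AE_not_in) (simp add: negligible_iff_null_sets)
  moreover have "D \<in> sets lebesgue" using \<open>open D\<close> by auto
  ultimately show ?thesis
    by (auto simp: AE_restrict_space_iff partially_differentiable_def N_def elim!: eventually_mono)
qed

lemma borel_measurable_lebesgue_on_AE:
  fixes f g :: "'a::euclidean_space \<Rightarrow> 'b::euclidean_space"
  assumes S: "S \<in> sets lebesgue" and f: "f \<in> borel_measurable (lebesgue_on S)"
    and eq: "AE x in lebesgue_on S. f x = g x"
  shows "g \<in> borel_measurable (lebesgue_on S)"
proof (rule borel_measurable_if_D)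
  have "(\<lambda>x. if x \<in> S then f x else 0) \<in> borel_measurable lebesgue"
    using f S by (simp add: borel_measurable_if)
  moreover have "AE x in lebesgue. (if x \<in> S then f x else 0) = (if x \<in> S then g x else 0)"
    using eq S by (auto simp: AE_restrict_space_iff elim!: eventually_mono)
  ultimately show "(\<lambda>x. if x \<in> S then g x else 0) \<in> borel_measurable lebesgue"
    by (rule borel_measurable_AE)
qed

lemma Lip0_subset_Lip_loc: "Lip0 D \<subseteq> Lip_loc D"
  unfolding Lip0_def Lip_loc_def by (blast intro: lipschitz_on_subset)

lemma Lip0_vanishing_outside:
  assumes "\<phi> \<in> Lip0 D" and "\<And>x. x \<in> D \<Longrightarrow> \<psi> x \<noteq> 0 \<Longrightarrow> \<phi> x \<noteq> 0" "L-lipschitz_on D \<psi>"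
  shows "\<psi> \<in> Lip0 D"
proof -
  have "closure {x\<in>D. \<psi> x \<noteq> 0} \<subseteq> closure {x\<in>D. \<phi> x \<noteq> 0}"
    using assms(2) by (intro closure_mono) auto
  moreover have "compact (closure {x\<in>D. \<phi> x \<noteq> 0})" "closure {x\<in>D. \<phi> x \<noteq> 0} \<subseteq> D"
    using assms(1) by (auto simp: Lip0_def)
  ultimately have "compact (closure {x\<in>D. \<psi> x \<noteq> 0})" "closure {x\<in>D. \<psi> x \<noteq> 0} \<subseteq> D"
    using closed_Int_compact[OF closed_closure, of "closure {x\<in>D. \<phi> x \<noteq> 0}" "{x\<in>D. \<psi> x \<noteq> 0}"]
    by (simp_all add: inf.absorb1)
  then show ?thesis using assms(3) by (auto simp: Lip0_def)
qed

lemma Lip0_add: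
  assumes \<phi>: "\<phi> \<in> Lip0 D" and \<psi>: "\<psi> \<in> Lip0 D"
  shows "(\<lambda>x. \<phi> x + \<psi> x) \<in> Lip0 D"
proof -
  obtain L M where "L-lipschitz_on D \<phi>" "M-lipschitz_on D \<psi>" using assms by (auto simp: Lip0_def)
  then have lip: "(L + M)-lipschitz_on D (\<lambda>x. \<phi> x + \<psi> x)" by (rule lipschitz_on_add)
  let ?K = "closure {x\<in>D. \<phi> x \<noteq> 0} \<union> closure {x\<in>D. \<psi> x \<noteq> 0}"
  have "compact ?K" "?K \<subseteq> D" using assms by (auto simp: Lip0_def intro: compact_Un)
  moreover have "closure {x\<in>D. \<phi> x + \<psi> x \<noteq> 0} \<subseteq> ?K"
    unfolding closure_Un[symmetric] by (intro closure_mono) auto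
  ultimately have "compact (closure {x\<in>D. \<phi> x + \<psi> x \<noteq> 0})" "closure {x\<in>D. \<phi> x + \<psi> x \<noteq> 0} \<subseteq> D"
    using closed_Int_compact[OF closed_closure, of ?K "{x\<in>D. \<phi> x + \<psi> x \<noteq> 0}"]
    by (simp_all add: inf.absorb1) blast
  then show ?thesis using lip by (auto simp: Lip0_def)
qed

lemma Lip0_scale:
  assumes "\<phi> \<in> Lip0 D" shows "(\<lambda>x. c * \<phi> x) \<in> Lip0 D"
proof -
  obtain L where "L-lipschitz_on D \<phi>" using assms by (auto simp: Lip0_def)
  then have "(\<bar>c\<bar> * L)-lipschitz_on D (\<lambda>x. c * \<phi> x)" by (rule lipschitz_on_cmult_real)
  then show ?thesis by (intro Lip0_vanishing_outside[OF assms]) auto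
qed

lemma Lip0_bounded:
  assumes "\<phi> \<in> Lip0 D"
  obtains B where "0 \<le> B" "\<And>x. x \<in> D \<Longrightarrow> \<bar>\<phi> x\<bar> \<le> B"
proof -
  let ?K = "closure {x\<in>D. \<phi> x \<noteq> 0}"
  obtain L where L: "L-lipschitz_on D \<phi>" and K: "compact ?K" "?K \<subseteq> D"
    using assms by (auto simp: Lip0_def)
  have "compact (\<phi> ` ?K)"
    using K(1) continuous_on_subset[OF lipschitz_on_continuous_on[OF L] K(2)]
    by (rule compact_continuous_image[rotated])
  then have "bounded (\<phi> ` ?K)" by (rule compact_imp_bounded)
  then obtain B where B: "\<And>x. x \<in> ?K \<Longrightarrow> \<bar>\<phi> x\<bar> \<le> B" by (auto simp: bounded_iff)
  have "\<bar>\<phi> x\<bar> \<le> max B 0" if "x \<in> D" for x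
  proof (cases "\<phi> x = 0")
    case False
    then have "x \<in> ?K" using that by (intro closure_subset[THEN subsetD]) simp
    from B[OF this] show ?thesis by simp
  qed simp
  then show ?thesis using that[of "max B 0"] by simp
qed

lemma Lip0_square:
  assumes "\<phi> \<in> Lip0 D" shows "(\<lambda>x. (\<phi> x)\<^sup>2) \<in> Lip0 D"
proof -
  obtain L where L: "L-lipschitz_on D \<phi>" using assms by (auto simp: Lip0_def)
  obtain B where B: "0 \<le> B" "\<And>x. x \<in> D \<Longrightarrow> \<bar>\<phi> x\<bar> \<le> B" using Lip0_bounded[OF assms] by metis
  have "(2 * B * L)-lipschitz_on D (\<lambda>x. (\<phi> x)\<^sup>2)"
  proof (rule lipschitz_onI)
    fix x y assume xy: "x \<in> D" "y \<in> D"
    have "\<bar>(\<phi> x)\<^sup>2 - (\<phi> y)\<^sup>2\<bar> = \<bar>\<phi> x + \<phi> y\<bar> * \<bar>\<phi> x - \<phi> y\<bar>"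
      by (simp add: power2_eq_square abs_mult[symmetric] algebra_simps)
    also have "\<dots> \<le> (2 * B) * (L * dist x y)"
      using B(1) B(2)[OF xy(1)] B(2)[OF xy(2)] lipschitz_onD[OF L xy]
      by (intro mult_mono) (auto simp: dist_real_def)
    finally show "dist ((\<phi> x)\<^sup>2) ((\<phi> y)\<^sup>2) \<le> 2 * B * L * dist x y" by (simp add: dist_real_def)
  qed (use B lipschitz_on_nonneg[OF L] in auto)
  then show ?thesis by (intro Lip0_vanishing_outside[OF assms]) auto
qed

lemma Lip_loc_compose:
  assumes "\<phi> \<in> Lip_loc D" "M-lipschitz_on UNIV h"
  shows "(\<lambda>x. h (\<phi> x)) \<in> Lip_loc D"
  unfolding Lip_loc_def
proof safe
  fix K assume "compact K" "K \<subseteq> D"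
  then obtain L where "L-lipschitz_on K \<phi>" using assms(1) by (auto simp: Lip_loc_def)
  then have "(M * L)-lipschitz_on K (\<lambda>x. h (\<phi> x))"
    by (intro lipschitz_on_compose2 lipschitz_on_subset[OF assms(2)]) auto
  then show "\<exists>L. L-lipschitz_on K (\<lambda>x. h (\<phi> x))" by blast
qed

lemma esssup_norm_AE_bound:
  fixes f :: "'a \<Rightarrow> 'b::euclidean_space"
  assumes "esssup M (\<lambda>x. ereal (norm (f x))) < \<infinity>"
  shows "AE x in M. norm (f x) \<le> real_of_ereal (esssup M (\<lambda>x. ereal (norm (f x))))"
proof -
  let ?e = "esssup M (\<lambda>x. ereal (norm (f x)))"
  have "AE x in M. ereal (norm (f x)) \<le> ?e" by (rule esssup_AE)
  then show ?thesis
    by eventually_elim (use assms in \<open>cases ?e; auto\<close>)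
qed

text \<open>On a null space the essential supremum is \<open>-\<infinity>\<close>, which \<open>real_of_ereal\<close> maps to 0.\<close>

lemma esssup_norm_nonneg:
  fixes f :: "'a \<Rightarrow> 'b::euclidean_space"
  assumes meas: "f \<in> borel_measurable M"
  shows "0 \<le> real_of_ereal (esssup M (\<lambda>x. ereal (norm (f x))))"
proof (cases "emeasure M (space M) = 0")
  case True
  have "esssup M (\<lambda>x. ereal (norm (f x))) = -\<infinity>"
    using meas True by (intro esssup_zero_space) auto
  then show ?thesis by simp
next
  case False
  have "(0::ereal) = esssup M (\<lambda>x. 0)" using False by (simp add: esssup_const)
  also have "\<dots> \<le> esssup M (\<lambda>x. ereal (norm (f x)))"
    by (intro esssup_mono) auto
  finally show ?thesis by (simp add: real_of_ereal_pos)
qed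

lemma borel_measurable_fst_snd:
  fixes f :: "'a \<Rightarrow> 'b::second_countable_topology \<times> 'c::second_countable_topology"
  assumes "f \<in> borel_measurable M"
  shows "(\<lambda>x. fst (f x)) \<in> borel_measurable M" "(\<lambda>x. snd (f x)) \<in> borel_measurable M"
  using assms by (auto intro!: measurable_compose[OF assms] borel_measurable_continuous_onI
      continuous_on_fst continuous_on_snd continuous_on_id)

section \<open>The degenerate Sobolev spaces\<close>

locale degenerate_setting =
  fixes D :: "(real^'n) set" and v :: "real^'n \<Rightarrow> real" and Q :: "real^'n \<Rightarrow> real^'n^'n"
  assumes D_open: "open D" and weight: "weight D v" and matrix_function: "matrix_function D Q"
    and v_integrable: "integrable (lebesgue_on D) v"
begin

abbreviation "dx \<equiv> lebesgue_on D"
abbreviation "vdx \<equiv> wmeasure v D"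

lemma D_lebesgue [simp]: "D \<in> sets lebesgue" using D_open by auto

lemma v_meas [measurable]: "v \<in> borel_measurable dx"
  and v_nonneg: "x \<in> D \<Longrightarrow> 0 \<le> v x"
  and v_pos: "AE x in dx. 0 < v x"
  using weight by (auto simp: weight_def)

lemma v_nonneg_AE: "AE x in dx. 0 \<le> v x" using v_pos by eventually_elim simp

lemma Q_psd: "x \<in> D \<Longrightarrow> pos_semidef (Q x)"
  using matrix_function by (auto simp: matrix_function_def)

lemma Q_quadratic_measurable:
  assumes [measurable]: "f \<in> borel_measurable dx" "g \<in> borel_measurable dx"
  shows "(\<lambda>x. (Q x *v f x) \<bullet> g x) \<in> borel_measurable dx"
proof -
  have [measurable]: "(\<lambda>x. Q x $ i $ j) \<in> borel_measurable dx" for i j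
    using matrix_function by (auto simp: matrix_function_def)
  have "(\<lambda>x. h x $ i) \<in> borel_measurable dx" if "h \<in> borel_measurable dx" for h :: "real^'n \<Rightarrow> real^'n" and i
    using borel_measurable_inner[OF that, of "\<lambda>_. axis i 1"] by (simp add: inner_axis)
  note [measurable] = this[OF assms(1)] this[OF assms(2)]
  have "(\<lambda>x. \<Sum>i\<in>UNIV. (\<Sum>j\<in>UNIV. Q x $ i $ j * f x $ j) * g x $ i) \<in> borel_measurable dx"
    by measurable
  then show ?thesis by (simp add: inner_vec_def matrix_vector_mult_def)
qed

lemma Q_quadratic_field: "quadratic_field dx (\<lambda>x a b. (Q x *v a) \<bullet> b)"
proof
  show "bilinear (\<lambda>a b. (Q x *v a) \<bullet> b)" for x
    by (auto simp: bilinear_def linear_iff matrix_vector_right_distrib inner_add_left inner_add_right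
        matrix_vector_mult_scaleR)
  fix x a b assume "x \<in> space dx"
  then have "pos_semidef (Q x)" using Q_psd by simp
  then show "(Q x *v a) \<bullet> b = (Q x *v b) \<bullet> a" "0 \<le> (Q x *v a) \<bullet> a"
    by (metis inner_commute pos_semidef_self_adjoint, metis inner_commute pos_semidef_def)
next
  have "AE x in dx. invertible (Q x)" using matrix_function by (simp add: matrix_function_def)
  with AE_space show "AE x in dx. \<forall>a. a \<noteq> 0 \<longrightarrow> 0 < (Q x *v a) \<bullet> a"
    by eventually_elim (auto intro: pos_semidef_invertible_pos Q_psd)
qed (rule Q_quadratic_measurable)

text \<open>The three instances are scalar \<open>L2 v\<close> (prefix \<open>vq\<close>), \<open>QL2\<close> (prefix \<open>Qq\<close>) and the space of pairs
  \<open>L2 v \<oplus> QL2\<close> (prefix \<open>pr\<close>), whose elements are functions with values in a product.\<close>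

sublocale vq: quadratic_field dx "\<lambda>x (a::real) b. v x * (a * b)"
proof
  show "AE x in dx. \<forall>a::real. a \<noteq> 0 \<longrightarrow> 0 < v x * (a * a)"
    using v_pos by eventually_elim (auto simp: zero_less_mult_iff)
  show "0 \<le> v x * (a * a)" if "x \<in> space dx" for x a
    using v_nonneg that by simp
qed (auto simp: bilinear_def linear_iff algebra_simps)

sublocale Qq: quadratic_field dx "\<lambda>x a b. (Q x *v a) \<bullet> b" by (rule Q_quadratic_field)

sublocale pr: quadratic_field dx "\<lambda>x a b. v x * (fst a * fst b) + (Q x *v snd a) \<bullet> snd b"
proof
  fix f g :: "real^'n \<Rightarrow> real \<times> (real^'n)"
  assume "f \<in> borel_measurable dx" "g \<in> borel_measurable dx"
  note [measurable] = this[THEN borel_measurable_fst_snd(1)] this[THEN borel_measurable_fst_snd(2)]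
  have [measurable]: "(\<lambda>x. (Q x *v snd (f x)) \<bullet> snd (g x)) \<in> borel_measurable dx"
    by (intro Q_quadratic_measurable) measurable
  show "(\<lambda>x. v x * (fst (f x) * fst (g x)) + (Q x *v snd (f x)) \<bullet> snd (g x)) \<in> borel_measurable dx"
    by measurable
next
  fix x a b assume x: "x \<in> space dx"
  show "bilinear (\<lambda>a b. v x * (fst a * fst b) + (Q x *v snd a) \<bullet> snd b)"
    using Qq.q_bil[OF x]
    by (auto simp: bilinear_def linear_iff algebra_simps)
  show "v x * (fst a * fst b) + (Q x *v snd a) \<bullet> snd b = v x * (fst b * fst a) + (Q x *v snd b) \<bullet> snd a"
    using Qq.q_sym[OF x] by simp
  show "0 \<le> v x * (fst a * fst a) + (Q x *v snd a) \<bullet> snd a"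
    using Qq.q_nonneg[OF x] vq.q_nonneg[OF x] by (simp add: add_nonneg_nonneg)
next
  show "AE x in dx. \<forall>a. a \<noteq> 0 \<longrightarrow> 0 < v x * (fst a * fst a) + (Q x *v snd a) \<bullet> snd a"
    using vq.q_pos Qq.q_pos AE_space
  proof eventually_elim
    case (elim x)
    show ?case
    proof safe
      fix a b assume "(a, b) \<noteq> (0 :: real \<times> (real^'n))"
      then consider "a \<noteq> 0" | "b \<noteq> 0" by (auto simp: zero_prod_def)
      then show "0 < v x * (fst (a, b) * fst (a, b)) + (Q x *v snd (a, b)) \<bullet> snd (a, b)"
        using elim Qq.q_nonneg[OF elim(3), of b] vq.q_nonneg[OF elim(3), of a]
        by cases (auto intro: add_pos_nonneg add_nonneg_pos)
    qed
  qed
qed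

lemma vdx_meas [simp]: "borel_measurable vdx = borel_measurable dx"
  by (intro measurable_cong_sets) (simp_all add: wmeasure_def)

lemma AE_vdx: "(AE x in vdx. P x) \<longleftrightarrow> (AE x in dx. P x)"
proof -
  have "(AE x in vdx. P x) \<longleftrightarrow> (AE x in dx. 0 < ennreal (v x) \<longrightarrow> P x)"
    unfolding wmeasure_def by (rule AE_density) simp
  also have "\<dots> \<longleftrightarrow> (AE x in dx. P x)"
    using v_pos by (intro eventually_cong[OF AE_mp[OF v_pos AE_I2]]) auto
  finally show ?thesis .
qed

lemma vdx_integrable:
  "f \<in> borel_measurable dx \<Longrightarrow> integrable vdx f \<longleftrightarrow> integrable dx (\<lambda>x. v x * f x)" for f :: "_ \<Rightarrow> real"
  unfolding wmeasure_def by (subst integrable_density) (auto intro: v_nonneg_AE)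

lemma vdx_integral:
  "f \<in> borel_measurable dx \<Longrightarrow> (LINT x|vdx. f x) = (LINT x|dx. v x * f x)" for f :: "_ \<Rightarrow> real"
  unfolding wmeasure_def by (subst integral_density) (auto intro: v_nonneg_AE)

lemma L2_iff:
  "f \<in> L2 v D \<longleftrightarrow> f \<in> borel_measurable dx \<and> (\<lambda>x. norm (f x)) \<in> vq.L2q"
  by (auto simp: L2_def vq.L2q_def vdx_integrable power2_eq_square)

lemma L2_real_iff: "u \<in> L2 v D \<longleftrightarrow> u \<in> vq.L2q" for u :: "_ \<Rightarrow> real"
  by (auto simp: L2_def vq.L2q_def vdx_integrable power2_eq_square)

lemma L2_norm_eq: "f \<in> borel_measurable dx \<Longrightarrow> L2_norm v D f = vq.nrm (\<lambda>x. norm (f x))"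
  by (simp add: L2_norm_def vq.nrm_def vq.ipq_def vdx_integral power2_eq_square)

lemma L2_norm_real_eq: "u \<in> borel_measurable dx \<Longrightarrow> L2_norm v D u = vq.nrm u" for u :: "_ \<Rightarrow> real"
  by (simp add: L2_norm_def vq.nrm_def vq.ipq_def vdx_integral power2_eq_square)

lemma QL2_iff: "w \<in> QL2 Q D \<longleftrightarrow> w \<in> Qq.L2q"
proof -
  have "integrable dx (\<lambda>x. (norm (matrix_sqrt (Q x) *v w x))\<^sup>2) = integrable dx (\<lambda>x. (Q x *v w x) \<bullet> w x)"
    by (rule Bochner_Integration.integrable_cong) (auto simp: norm_matrix_sqrt_square Q_psd)
  then show ?thesis by (simp add: QL2_def Qq.L2q_def)
qed

lemma QL2_norm_eq: "QL2_norm Q D w = Qq.nrm w"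
proof -
  have "(LINT x|dx. (norm (matrix_sqrt (Q x) *v w x))\<^sup>2) = (LINT x|dx. (Q x *v w x) \<bullet> w x)"
    by (rule Bochner_Integration.integral_cong) (auto simp: norm_matrix_sqrt_square Q_psd)
  then show ?thesis by (simp add: QL2_norm_def Qq.nrm_def Qq.ipq_def)
qed

lemma L2_norm_nonneg: "0 \<le> L2_norm v D f" and QL2_norm_nonneg: "0 \<le> QL2_norm Q D w"
  by (simp_all add: L2_norm_def QL2_norm_def)

lemma dominated_by_L2_product:
  fixes f a b :: "real^'n \<Rightarrow> real"
  assumes f: "f \<in> borel_measurable dx" and a: "a \<in> vq.L2q" and b: "b \<in> vq.L2q"
    and a0: "\<And>x. 0 \<le> a x" and b0: "\<And>x. 0 \<le> b x" and c: "0 \<le> c"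
    and le: "AE x in dx. \<bar>f x\<bar> \<le> c * (a x * b x)"
  shows "integrable vdx f" and "\<bar>LINT x|vdx. f x\<bar> \<le> c * (vq.nrm a * vq.nrm b)"
proof -
  have int: "integrable dx (\<lambda>x. c * (v x * (a x * b x)))"
    using vq.q_integrable[OF a b] by simp
  have le': "AE x in dx. norm (v x * f x) \<le> c * (v x * (a x * b x))"
    using le v_nonneg_AE
  proof eventually_elim
    case (elim x)
    then show ?case using mult_left_mono[OF elim] by (simp add: abs_mult mult_ac)
  qed
  have int_f: "integrable dx (\<lambda>x. v x * f x)"
    by (rule Bochner_Integration.integrable_bound[OF int])
      (use f le' in \<open>auto elim!: eventually_mono\<close>)
  then show "integrable vdx f" using f by (simp add: vdx_integrable)
  have "\<bar>LINT x|vdx. f x\<bar> \<le> (LINT x|dx. norm (v x * f x))"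
    unfolding vdx_integral[OF f] using integral_norm_bound[of dx "\<lambda>x. v x * f x"] by simp
  also have "\<dots> \<le> (LINT x|dx. c * (v x * (a x * b x)))"
    using int_f int le' by (intro integral_mono_AE) auto
  also have "\<dots> = c * vq.ipq a b" by (simp add: vq.ipq_def)
  also have "\<dots> \<le> c * (vq.nrm a * vq.nrm b)"
    using vq.ip_Cauchy_Schwarz[OF a b] c by (intro mult_left_mono) auto
  finally show "\<bar>LINT x|vdx. f x\<bar> \<le> c * (vq.nrm a * vq.nrm b)" .
qed

lemma L2_pairing:
  fixes A B :: "real^'n \<Rightarrow> 'b::euclidean_space"
  assumes A: "A \<in> L2 v D" and B: "B \<in> L2 v D"
  shows "integrable vdx (\<lambda>x. A x \<bullet> B x)"
    and "\<bar>LINT x|vdx. A x \<bullet> B x\<bar> \<le> L2_norm v D A * L2_norm v D B"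
proof -
  have m: "A \<in> borel_measurable dx" "B \<in> borel_measurable dx"
    and n: "(\<lambda>x. norm (A x)) \<in> vq.L2q" "(\<lambda>x. norm (B x)) \<in> vq.L2q"
    using A B by (auto simp: L2_iff)
  have le: "AE x in dx. \<bar>A x \<bullet> B x\<bar> \<le> 1 * (norm (A x) * norm (B x))"
    by (simp add: Cauchy_Schwarz_ineq2)
  have meas: "(\<lambda>x. A x \<bullet> B x) \<in> borel_measurable dx" using m by simp
  show "integrable vdx (\<lambda>x. A x \<bullet> B x)"
    by (rule dominated_by_L2_product[OF meas n _ _ _ le]) auto
  show "\<bar>LINT x|vdx. A x \<bullet> B x\<bar> \<le> L2_norm v D A * L2_norm v D B"
    using dominated_by_L2_product(2)[OF meas n _ _ _ le] m by (simp add: L2_norm_eq)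
qed

lemma Linf_triple:
  fixes A B :: "real^'n \<Rightarrow> 'b::euclidean_space" and \<phi> :: "real^'n \<Rightarrow> real"
  assumes A: "A \<in> Linf v D" and B: "B \<in> L2 v D" and \<phi>: "\<phi> \<in> L2 v D"
  shows "integrable vdx (\<lambda>x. (A x \<bullet> B x) * \<phi> x)"
    and "\<bar>LINT x|vdx. (A x \<bullet> B x) * \<phi> x\<bar> \<le> Linf_norm v D A * (L2_norm v D B * L2_norm v D \<phi>)"
proof -
  have m: "A \<in> borel_measurable dx" "B \<in> borel_measurable dx" "\<phi> \<in> borel_measurable dx"
    and n: "(\<lambda>x. norm (B x)) \<in> vq.L2q" "(\<lambda>x. norm (\<phi> x)) \<in> vq.L2q"
    using A B \<phi> by (auto simp: L2_iff Linf_def)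
  have "AE x in vdx. norm (A x) \<le> Linf_norm v D A"
    unfolding Linf_norm_def using A by (intro esssup_norm_AE_bound) (simp add: Linf_def)
  then have le: "AE x in dx. \<bar>(A x \<bullet> B x) * \<phi> x\<bar> \<le> Linf_norm v D A * (norm (B x) * norm (\<phi> x))"
    unfolding AE_vdx
  proof eventually_elim
    case (elim x)
    have "\<bar>A x \<bullet> B x\<bar> \<le> Linf_norm v D A * norm (B x)"
      using Cauchy_Schwarz_ineq2[of "A x" "B x"] mult_right_mono[OF elim, of "norm (B x)"] by simp
    from mult_right_mono[OF this, of "\<bar>\<phi> x\<bar>"] show ?case by (simp add: abs_mult mult_ac)
  qed
  have c: "0 \<le> Linf_norm v D A"
    unfolding Linf_norm_def using m by (intro esssup_norm_nonneg) simp
  have meas: "(\<lambda>x. (A x \<bullet> B x) * \<phi> x) \<in> borel_measurable dx" using m by simp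
  show "integrable vdx (\<lambda>x. (A x \<bullet> B x) * \<phi> x)"
    by (rule dominated_by_L2_product[OF meas n _ _ c le]) auto
  show "\<bar>LINT x|vdx. (A x \<bullet> B x) * \<phi> x\<bar> \<le> Linf_norm v D A * (L2_norm v D B * L2_norm v D \<phi>)"
    using dominated_by_L2_product(2)[OF meas n _ _ c le] m by (simp add: L2_norm_eq)
qed

lemma QLip_locD:
  assumes "\<phi> \<in> QLip_loc v Q D"
  shows "\<phi> \<in> Lip_loc D" "\<phi> \<in> vq.L2q" "grad \<phi> \<in> Qq.L2q"
    "\<phi> \<in> borel_measurable dx" "grad \<phi> \<in> borel_measurable dx"
    "AE x in dx. partially_differentiable \<phi> x"
  using assms Lip_loc_partially_differentiable_ae[OF D_open, of \<phi>]
  by (auto simp: QLip_loc_def L2_real_iff QL2_iff vq.L2q_def Qq.L2q_def)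

lemma QLip0_subset: "QLip0 v Q D \<subseteq> QLip_loc v Q D"
  using Lip0_subset_Lip_loc by (auto simp: QLip0_def QLip_loc_def)

lemma graph_in_QH12:
  assumes "\<phi> \<in> QLip_loc v Q D" shows "(\<phi>, grad \<phi>) \<in> QH12 v Q D"
  using assms
  by (auto simp: QH12_def QH_closure_def QLip_loc_def QH_norm_def L2_norm_def QL2_norm_def
      intro!: bexI[of _ \<phi>])

text \<open>The gradients of sums and compositions are known only almost everywhere; their measurability
  comes from the completeness of Lebesgue measure.\<close>

lemma QL2_AE_cong:
  assumes "w \<in> QL2 Q D" "AE x in dx. w x = w' x"
  shows "w' \<in> QL2 Q D" "QL2_norm Q D w' = QL2_norm Q D w"
proof -
  have w: "w \<in> Qq.L2q" using assms by (simp add: QL2_iff)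
  then have m: "w' \<in> borel_measurable dx"
    using borel_measurable_lebesgue_on_AE[OF D_lebesgue _ assms(2)] by (simp add: Qq.L2q_def)
  show "w' \<in> QL2 Q D" "QL2_norm Q D w' = QL2_norm Q D w"
    using Qq.L2q_AE_cong[OF w m assms(2)] by (simp_all add: QL2_iff QL2_norm_eq)
qed

lemma QLip_loc_bounded_compose:
  fixes h h' :: "real \<Rightarrow> real"
  assumes \<phi>: "\<phi> \<in> QLip_loc v Q D"
    and h: "\<And>t. (h has_real_derivative h' t) (at t)" and h'_le: "\<And>t. \<bar>h' t\<bar> \<le> M"
    and h'_cont: "continuous_on UNIV h'" and h_le: "\<And>t. \<bar>h t\<bar> \<le> B"
  shows "(\<lambda>x. h (\<phi> x)) \<in> QLip_loc v Q D"
    and "AE x in dx. grad (\<lambda>x. h (\<phi> x)) x = h' (\<phi> x) *\<^sub>R grad \<phi> x"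
    and "L2_norm v D (\<lambda>x. h (\<phi> x)) \<le> B * sqrt (LINT x|dx. v x)"
proof -
  note \<phi>D = QLip_locD[OF \<phi>]
  note [measurable] = \<phi>D(4)
  have hM: "h \<in> borel_measurable borel" "h' \<in> borel_measurable borel"
    using h h'_cont
    by (auto intro!: borel_measurable_continuous_onI continuous_at_imp_continuous_on DERIV_isCont)
  have hmeas [measurable]: "(\<lambda>x. h (\<phi> x)) \<in> borel_measurable dx" "(\<lambda>x. h' (\<phi> x)) \<in> borel_measurable dx"
    using hM by (auto intro: measurable_compose[OF \<phi>D(4)])
  show ae: "AE x in dx. grad (\<lambda>x. h (\<phi> x)) x = h' (\<phi> x) *\<^sub>R grad \<phi> x"
    using \<phi>D(6) by eventually_elim (rule grad_compose[OF _ h])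
  have "(\<lambda>x. h' (\<phi> x) *\<^sub>R grad \<phi> x) \<in> QL2 Q D"
    unfolding QL2_iff using \<phi>D(3) hmeas(2) h'_le by (rule Qq.L2q_bounded_multiplier)
  then have gr: "grad (\<lambda>x. h (\<phi> x)) \<in> QL2 Q D"
    by (rule QL2_AE_cong) (use ae in \<open>auto elim: eventually_mono\<close>)
  have "M-lipschitz_on UNIV h"
  proof (rule lipschitz_onI)
    fix s t :: real
    show "dist (h s) (h t) \<le> M * dist s t"
      using field_differentiable_bound[of UNIV h h' M s t] h h'_le
      by (simp add: dist_norm norm_minus_commute)
  qed (use h'_le[of 0] in \<open>auto intro: order_trans[OF abs_ge_zero]\<close>)
  then have lip: "(\<lambda>x. h (\<phi> x)) \<in> Lip_loc D" by (rule Lip_loc_compose[OF \<phi>D(1)])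
  have sq: "(h (\<phi> x))\<^sup>2 \<le> B\<^sup>2" for x using h_le by (metis abs_ge_zero power2_abs power_mono)
  have int: "integrable dx (\<lambda>x. v x * (h (\<phi> x) * h (\<phi> x)))"
  proof (rule Bochner_Integration.integrable_bound)
    show "integrable dx (\<lambda>x. B\<^sup>2 * v x)" using v_integrable by simp
    show "AE x in dx. norm (v x * (h (\<phi> x) * h (\<phi> x))) \<le> norm (B\<^sup>2 * v x)"
      using v_nonneg_AE
      by eventually_elim (use sq in \<open>simp add: abs_mult mult.commute mult_left_mono power2_eq_square\<close>)
  qed measurable
  then have "(\<lambda>x. h (\<phi> x)) \<in> L2 v D" unfolding L2_real_iff by (simp add: vq.L2q_def)
  with lip gr show "(\<lambda>x. h (\<phi> x)) \<in> QLip_loc v Q D" by (simp add: QLip_loc_def)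
  have "(L2_norm v D (\<lambda>x. h (\<phi> x)))\<^sup>2 = (LINT x|dx. v x * (h (\<phi> x) * h (\<phi> x)))"
    using \<open>(\<lambda>x. h (\<phi> x)) \<in> L2 v D\<close>
    by (simp add: L2_norm_real_eq L2_real_iff vq.nrm_square vq.ipq_def)
  also have "\<dots> \<le> (LINT x|dx. B\<^sup>2 * v x)"
    using int v_integrable v_nonneg_AE
    by (intro integral_mono_AE) (auto elim!: eventually_mono
        simp: mult.commute[of "B\<^sup>2"] power2_eq_square[symmetric] intro!: mult_left_mono sq)
  also have "\<dots> = (B * sqrt (LINT x|dx. v x))\<^sup>2"
    using v_nonneg_AE by (simp add: power_mult_distrib integral_nonneg_AE)
  finally show "L2_norm v D (\<lambda>x. h (\<phi> x)) \<le> B * sqrt (LINT x|dx. v x)"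
    using h_le[of 0] v_nonneg_AE
    by (elim power2_le_imp_le) (auto intro!: mult_nonneg_nonneg integral_nonneg_AE)
qed

text \<open>The bound \<open>\<parallel>V\<psi>\<parallel> \<le> C (\<parallel>\<psi>\<parallel> + \<parallel>\<surd>Q \<nabla>\<psi>\<parallel>)\<close> for all locally Lipschitz \<open>\<psi>\<close> implies the same bound without the
  term \<open>\<parallel>\<psi>\<parallel>\<close>. Apply it to \<open>\<psi> = sin (l \<phi>) / l\<close> and \<open>\<eta> = cos (l \<phi>) / l\<close>. Both have norm at most \<open>K / l\<close> with
  \<open>K\<^sup>2 = \<integral> v\<close>, and by \<open>sin\<^sup>2 + cos\<^sup>2 = 1\<close> the squared norms of the two gradients, and of the two images under \<open>V\<close>, add up to
  those of \<open>\<phi>\<close>. The cross terms vanish as \<open>l\<close> tends to infinity.\<close>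

lemma subunit_gradient_bound:
  assumes s: "subunit_const v Q D s C" and \<phi>: "\<phi> \<in> QLip_loc v Q D"
  shows "L2_norm v D (\<lambda>x. s x \<bullet> grad \<phi> x) \<le> \<bar>C\<bar> * QL2_norm Q D (grad \<phi>)"
proof -
  note \<phi>D = QLip_locD[OF \<phi>]
  define A where "A = L2_norm v D (\<lambda>x. s x \<bullet> grad \<phi> x)"
  define N where "N = QL2_norm Q D (grad \<phi>)"
  define K where "K = sqrt (LINT x|dx. v x)"
  have K: "0 \<le> K" unfolding K_def using v_nonneg_AE by (simp add: integral_nonneg_AE)
  have N: "0 \<le> N" by (simp add: N_def QL2_norm_nonneg)
  have sub: "(\<lambda>x. s x \<bullet> grad \<psi> x) \<in> L2 v D"
    "L2_norm v D (\<lambda>x. s x \<bullet> grad \<psi> x) \<le> \<bar>C\<bar> * (L2_norm v D \<psi> + QL2_norm Q D (grad \<psi>))"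
    if \<psi>: "\<psi> \<in> QLip_loc v Q D" for \<psi>
  proof -
    have *: "(\<lambda>x. s x \<bullet> grad \<psi> x) \<in> L2 v D"
      "L2_norm v D (\<lambda>x. s x \<bullet> grad \<psi> x) \<le> C * QH_norm v Q D (\<psi>, grad \<psi>)"
      using s graph_in_QH12[OF \<psi>] by (auto simp: subunit_const_def)
    show "(\<lambda>x. s x \<bullet> grad \<psi> x) \<in> L2 v D" by fact
    have "C * QH_norm v Q D (\<psi>, grad \<psi>) \<le> \<bar>C\<bar> * QH_norm v Q D (\<psi>, grad \<psi>)"
      by (intro mult_right_mono) (auto simp: QH_norm_def L2_norm_nonneg QL2_norm_nonneg)
    with * show "L2_norm v D (\<lambda>x. s x \<bullet> grad \<psi> x) \<le> \<bar>C\<bar> * (L2_norm v D \<psi> + QL2_norm Q D (grad \<psi>))"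
      by (simp add: QH_norm_def)
  qed
  have bound: "A\<^sup>2 \<le> C\<^sup>2 * (2 * (K / l)\<^sup>2 + 4 * (K / l) * N + N\<^sup>2)" if l: "0 < l" for l :: real
  proof -
    define \<psi> where "\<psi> x = sin (l * \<phi> x) / l" for x
    define \<eta> where "\<eta> x = cos (l * \<phi> x) / l" for x
    note comp = QLip_loc_bounded_compose[where M = 1 and B = "1 / l", OF \<phi>]
    have "((\<lambda>t. sin (l * t) / l) has_real_derivative cos (l * t)) (at t)" for t
      using l by (auto intro!: derivative_eq_intros)
    note sin_comp = comp[of "\<lambda>t. sin (l * t) / l" "\<lambda>t. cos (l * t)", OF this]
    have lip\<psi>: "\<psi> \<in> QLip_loc v Q D" "AE x in dx. grad \<psi> x = cos (l * \<phi> x) *\<^sub>R grad \<phi> x"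
        "L2_norm v D \<psi> \<le> 1 / l * K"
      unfolding \<psi>_def K_def
      by (rule sin_comp; use l in \<open>auto intro!: continuous_intros simp: divide_right_mono\<close>)+
    have "((\<lambda>t. cos (l * t) / l) has_real_derivative - sin (l * t)) (at t)" for t
      using l by (auto intro!: derivative_eq_intros)
    note cos_comp = comp[of "\<lambda>t. cos (l * t) / l" "\<lambda>t. - sin (l * t)", OF this]
    have lip\<eta>: "\<eta> \<in> QLip_loc v Q D" "AE x in dx. grad \<eta> x = (- sin (l * \<phi> x)) *\<^sub>R grad \<phi> x"
        "L2_norm v D \<eta> \<le> 1 / l * K"
      unfolding \<eta>_def K_def
      by (rule cos_comp; use l in \<open>auto intro!: continuous_intros simp: divide_right_mono\<close>)+
    define a where "a = QL2_norm Q D (grad \<psi>)"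
    define b where "b = QL2_norm Q D (grad \<eta>)"
    have ab: "0 \<le> a" "0 \<le> b" by (auto simp: a_def b_def QL2_norm_nonneg)
    have trig: "(cos t)\<^sup>2 * r + (sin t)\<^sup>2 * r = r" for t r :: real
      by (simp add: distrib_right[symmetric])
    have "a\<^sup>2 + b\<^sup>2 = (LINT x|dx. (Q x *v grad \<psi> x) \<bullet> grad \<psi> x + (Q x *v grad \<eta> x) \<bullet> grad \<eta> x)"
      using QLip_locD(3)[OF lip\<psi>(1)] QLip_locD(3)[OF lip\<eta>(1)]
      by (simp add: a_def b_def QL2_norm_eq Qq.nrm_square Qq.ipq_def Qq.q_integrable)
    also have "\<dots> = (LINT x|dx. (Q x *v grad \<phi> x) \<bullet> grad \<phi> x)"
    proof (rule integral_cong_AE)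
      show "AE x in dx. (Q x *v grad \<psi> x) \<bullet> grad \<psi> x + (Q x *v grad \<eta> x) \<bullet> grad \<eta> x
          = (Q x *v grad \<phi> x) \<bullet> grad \<phi> x"
        using lip\<psi>(2) lip\<eta>(2)
      proof eventually_elim
        case (elim x)
        show ?case
          unfolding elim using trig[of "l * \<phi> x" "(Q x *v grad \<phi> x) \<bullet> grad \<phi> x"]
          by (simp add: matrix_vector_mult_scaleR power2_eq_square mult.assoc del: scaleR_minus_left)
      qed
    qed (use QLip_locD(5)[OF lip\<psi>(1)] QLip_locD(5)[OF lip\<eta>(1)] \<phi>D(5) in
        \<open>auto intro!: borel_measurable_add Q_quadratic_measurable\<close>)
    also have "\<dots> = N\<^sup>2" using \<phi>D(3) by (simp add: N_def QL2_norm_eq Qq.nrm_square Qq.ipq_def)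
    finally have ab_N: "a\<^sup>2 + b\<^sup>2 = N\<^sup>2" .
    define A1 where "A1 = L2_norm v D (\<lambda>x. s x \<bullet> grad \<psi> x)"
    define A2 where "A2 = L2_norm v D (\<lambda>x. s x \<bullet> grad \<eta> x)"
    have mem: "(\<lambda>x. s x \<bullet> grad \<psi> x) \<in> vq.L2q" "(\<lambda>x. s x \<bullet> grad \<eta> x) \<in> vq.L2q" "(\<lambda>x. s x \<bullet> grad \<phi> x) \<in> vq.L2q"
      using sub(1) lip\<psi>(1) lip\<eta>(1) \<phi> by (auto simp: L2_real_iff)
    note meas = mem[THEN vq.L2q_def[THEN eq_refl, THEN subsetD], simplified, THEN conjunct1]
    have "A1\<^sup>2 + A2\<^sup>2 = (LINT x|dx. v x * ((s x \<bullet> grad \<psi> x) * (s x \<bullet> grad \<psi> x))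
        + v x * ((s x \<bullet> grad \<eta> x) * (s x \<bullet> grad \<eta> x)))"
      using mem meas
      by (simp add: A1_def A2_def L2_norm_real_eq vq.nrm_square vq.ipq_def
          Bochner_Integration.integral_add[OF vq.q_integrable[OF mem(1,1)] vq.q_integrable[OF mem(2,2)]])
    also have "\<dots> = (LINT x|dx. v x * ((s x \<bullet> grad \<phi> x) * (s x \<bullet> grad \<phi> x)))"
    proof (rule integral_cong_AE)
      show "AE x in dx. v x * ((s x \<bullet> grad \<psi> x) * (s x \<bullet> grad \<psi> x))
          + v x * ((s x \<bullet> grad \<eta> x) * (s x \<bullet> grad \<eta> x)) = v x * ((s x \<bullet> grad \<phi> x) * (s x \<bullet> grad \<phi> x))"
        using lip\<psi>(2) lip\<eta>(2)
      proof eventually_elim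
        case (elim x)
        show ?case
          unfolding elim using trig[of "l * \<phi> x" "v x * ((s x \<bullet> grad \<phi> x) * (s x \<bullet> grad \<phi> x))"]
          by (simp add: power2_eq_square mult_ac)
      qed
    qed (use meas in \<open>auto intro!: borel_measurable_add borel_measurable_times\<close>)
    also have "\<dots> = A\<^sup>2" using mem(3) meas(3)
      by (simp add: A_def L2_norm_real_eq vq.nrm_square vq.ipq_def)
    finally have A12: "A\<^sup>2 = A1\<^sup>2 + A2\<^sup>2" by simp
    have "A1 \<le> \<bar>C\<bar> * (K / l + a)"
      using order_trans[OF sub(2)[OF lip\<psi>(1)] mult_left_mono[OF add_right_mono[OF lip\<psi>(3)]]]
      by (simp add: A1_def a_def)
    then have 1: "A1\<^sup>2 \<le> C\<^sup>2 * (K / l + a)\<^sup>2"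
      using power_mono[of A1 "\<bar>C\<bar> * (K / l + a)" 2] by (simp add: A1_def L2_norm_nonneg power_mult_distrib)
    have "A2 \<le> \<bar>C\<bar> * (K / l + b)"
      using order_trans[OF sub(2)[OF lip\<eta>(1)] mult_left_mono[OF add_right_mono[OF lip\<eta>(3)]]]
      by (simp add: A2_def b_def)
    then have 2: "A2\<^sup>2 \<le> C\<^sup>2 * (K / l + b)\<^sup>2"
      using power_mono[of A2 "\<bar>C\<bar> * (K / l + b)" 2] by (simp add: A2_def L2_norm_nonneg power_mult_distrib)
    have aN: "a \<le> N" "b \<le> N"
      using ab_N N by (auto intro!: power2_le_imp_le[of _ N] simp flip: ab_N)
    have "A\<^sup>2 \<le> C\<^sup>2 * ((K / l + a)\<^sup>2 + (K / l + b)\<^sup>2)"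
      unfolding A12 distrib_left by (rule add_mono[OF 1 2])
    also have "(K / l + a)\<^sup>2 + (K / l + b)\<^sup>2 = 2 * (K / l)\<^sup>2 + 2 * (K / l) * (a + b) + N\<^sup>2"
      unfolding ab_N[symmetric] by (simp add: power2_sum algebra_simps add_divide_distrib)
    also have "C\<^sup>2 * \<dots> \<le> C\<^sup>2 * (2 * (K / l)\<^sup>2 + 4 * (K / l) * N + N\<^sup>2)"
    proof (intro mult_left_mono add_mono order_refl)
      have "2 * (K / l) * (a + b) \<le> 2 * (K / l) * (2 * N)"
        using aN K l by (intro mult_left_mono) auto
      then show "2 * (K / l) * (a + b) \<le> 4 * (K / l) * N" by (simp add: mult_ac)
    qed auto
    finally show ?thesis .
  qed
  have "A\<^sup>2 \<le> C\<^sup>2 * N\<^sup>2"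
  proof (rule LIMSEQ_le_const)
    have "(\<lambda>n. C\<^sup>2 * (2 * (K / real (Suc n))\<^sup>2 + 4 * (K / real (Suc n)) * N + N\<^sup>2)) \<longlonglongrightarrow>
        C\<^sup>2 * (2 * 0\<^sup>2 + 4 * 0 * N + N\<^sup>2)"
      by (intro tendsto_intros LIMSEQ_Suc lim_const_over_n)
    then show "(\<lambda>n. C\<^sup>2 * (2 * (K / real (Suc n))\<^sup>2 + 4 * (K / real (Suc n)) * N + N\<^sup>2)) \<longlonglongrightarrow> C\<^sup>2 * N\<^sup>2"
      by simp
  qed (use bound in auto)
  then have "A\<^sup>2 \<le> (\<bar>C\<bar> * N)\<^sup>2" by (simp add: power_mult_distrib)
  then show ?thesis
    unfolding A_def[symmetric] N_def[symmetric] by (rule power2_le_imp_le) (use N in simp)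
qed

lemma vfields_L2:
  fixes R :: "'m::finite \<Rightarrow> real^'n \<Rightarrow> real^'n"
  assumes R: "\<And>i. (\<lambda>x. R i x \<bullet> w x) \<in> L2 v D"
    and le: "\<And>i. L2_norm v D (\<lambda>x. R i x \<bullet> w x) \<le> \<bar>c i\<bar> * N" and N: "0 \<le> N"
  shows "vfields R w \<in> L2 v D" and "L2_norm v D (vfields R w) \<le> tuple_const c * N"
proof -
  have mem: "(\<lambda>x. R i x \<bullet> w x) \<in> vq.L2q" for i using R by (simp add: L2_real_iff)
  then have meas [measurable]: "(\<lambda>x. R i x \<bullet> w x) \<in> borel_measurable dx" for i by (simp add: vq.L2q_def)
  have V: "vfields R w \<in> borel_measurable dx"
  proof (subst borel_measurable_euclidean_space, rule ballI)
    fix b :: "real^'m" assume "b \<in> Basis"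
    then obtain i where "b = axis i 1" by (auto simp: Basis_vec_def)
    then show "(\<lambda>x. vfields R w x \<bullet> b) \<in> borel_measurable dx"
      by (simp add: inner_axis vfields_def meas)
  qed
  have sq: "norm (vfields R w x) * norm (vfields R w x) = (\<Sum>i\<in>UNIV. (R i x \<bullet> w x) * (R i x \<bullet> w x))" for x
    by (simp add: power2_eq_square[symmetric] power2_norm_eq_inner inner_vec_def vfields_def)
  have int: "integrable dx (\<lambda>x. \<Sum>i\<in>UNIV. v x * ((R i x \<bullet> w x) * (R i x \<bullet> w x)))"
    by (intro Bochner_Integration.integrable_sum vq.q_integrable mem)
  then have n: "(\<lambda>x. norm (vfields R w x)) \<in> vq.L2q"
    using V by (simp add: vq.L2q_def sq sum_distrib_left)
  then show "vfields R w \<in> L2 v D" using V by (simp add: L2_iff)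
  have "(L2_norm v D (vfields R w))\<^sup>2 = (LINT x|dx. (\<Sum>i\<in>UNIV. v x * ((R i x \<bullet> w x) * (R i x \<bullet> w x))))"
    using V n by (simp add: L2_norm_eq vq.nrm_square vq.ipq_def sq sum_distrib_left)
  also have "\<dots> = (\<Sum>i\<in>UNIV. (L2_norm v D (\<lambda>x. R i x \<bullet> w x))\<^sup>2)"
    using mem meas
    by (subst Bochner_Integration.integral_sum) (auto simp: L2_norm_real_eq vq.nrm_square vq.ipq_def
        intro!: vq.q_integrable)
  also have "\<dots> \<le> (\<Sum>i\<in>UNIV. (c i)\<^sup>2 * N\<^sup>2)"
  proof (rule sum_mono)
    fix i
    show "(L2_norm v D (\<lambda>x. R i x \<bullet> w x))\<^sup>2 \<le> (c i)\<^sup>2 * N\<^sup>2"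
      using power_mono[OF le[of i] L2_norm_nonneg, of 2] by (simp add: power_mult_distrib)
  qed
  also have "\<dots> = (tuple_const c * N)\<^sup>2"
    by (simp add: tuple_const_def power_mult_distrib sum_nonneg sum_distrib_right)
  finally show "L2_norm v D (vfields R w) \<le> tuple_const c * N"
    using N by (elim power2_le_imp_le) (simp add: tuple_const_def sum_nonneg)
qed

lemma vfields_gradient_bound:
  assumes "\<And>i. subunit_const v Q D (R i) (c i)" "\<phi> \<in> QLip_loc v Q D"
  shows "L2_norm v D (vfields R (grad \<phi>)) \<le> tuple_const c * QL2_norm Q D (grad \<phi>)"
  using assms graph_in_QH12[OF assms(2)]
  by (intro vfields_L2 subunit_gradient_bound QL2_norm_nonneg) (auto simp: subunit_const_def)

lemma vfields_QH12_bound: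
  assumes R: "\<And>i. subunit_const v Q D (R i) (c i)" and uw: "(u, w) \<in> QH12 v Q D"
  shows "vfields R w \<in> L2 v D" "L2_norm v D (vfields R w) \<le> tuple_const c * QH_norm v Q D (u, w)"
proof -
  have N: "0 \<le> QH_norm v Q D (u, w)" by (simp add: QH_norm_def L2_norm_nonneg QL2_norm_nonneg)
  have 1: "(\<lambda>x. R i x \<bullet> w x) \<in> L2 v D"
    and 2: "L2_norm v D (\<lambda>x. R i x \<bullet> w x) \<le> c i * QH_norm v Q D (u, w)" for i
    using R[of i] uw by (auto simp: subunit_const_def)
  have 3: "L2_norm v D (\<lambda>x. R i x \<bullet> w x) \<le> \<bar>c i\<bar> * QH_norm v Q D (u, w)" for i
    using 2[of i] mult_right_mono[OF abs_ge_self[of "c i"] N] by linarith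
  show "vfields R w \<in> L2 v D" "L2_norm v D (vfields R w) \<le> tuple_const c * QH_norm v Q D (u, w)"
    using vfields_L2[of R w c, OF 1 3 N] by auto
qed

text \<open>The space \<open>QH12_0\<close>, with a pair of functions replaced by a function into the product, so that it is a set of elements of a
  single real vector space.\<close>

definition W :: "(real^'n \<Rightarrow> real \<times> (real^'n)) set" where
  "W = {p. (\<lambda>x. fst (p x), \<lambda>x. snd (p x)) \<in> QH12_0 v Q D}"

definition graph :: "(real^'n \<Rightarrow> real) \<Rightarrow> real^'n \<Rightarrow> real \<times> (real^'n)" where
  "graph \<phi> x = (\<phi> x, grad \<phi> x)"

lemma pr_iff: "p \<in> pr.L2q \<longleftrightarrow> (\<lambda>x. fst (p x)) \<in> vq.L2q \<and> (\<lambda>x. snd (p x)) \<in> Qq.L2q"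
proof safe
  assume p: "p \<in> pr.L2q"
  then have pM: "p \<in> borel_measurable dx" by (simp add: pr.L2q_def)
  note m = borel_measurable_fst_snd[OF pM]
  have int: "integrable dx (\<lambda>x. v x * (fst (p x) * fst (p x)) + (Q x *v snd (p x)) \<bullet> snd (p x))"
    using p by (simp add: pr.L2q_def)
  have nonneg: "AE x in dx. 0 \<le> v x * (fst (p x) * fst (p x)) \<and> 0 \<le> (Q x *v snd (p x)) \<bullet> snd (p x)"
    using Qq.q_nonneg vq.q_nonneg by (intro AE_I2) blast
  have "integrable dx (\<lambda>x. v x * (fst (p x) * fst (p x)))"
  proof (rule Bochner_Integration.integrable_bound[OF int])
    show "AE x in dx. norm (v x * (fst (p x) * fst (p x)))
        \<le> norm (v x * (fst (p x) * fst (p x)) + (Q x *v snd (p x)) \<bullet> snd (p x))"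
      using nonneg by eventually_elim auto
  qed (use m in simp)
  then show "(\<lambda>x. fst (p x)) \<in> vq.L2q" using m by (simp add: vq.L2q_def)
  have "integrable dx (\<lambda>x. (Q x *v snd (p x)) \<bullet> snd (p x))"
  proof (rule Bochner_Integration.integrable_bound[OF int])
    show "AE x in dx. norm ((Q x *v snd (p x)) \<bullet> snd (p x))
        \<le> norm (v x * (fst (p x) * fst (p x)) + (Q x *v snd (p x)) \<bullet> snd (p x))"
      using nonneg by eventually_elim auto
  qed (rule Q_quadratic_measurable[OF m(2) m(2)])
  then show "(\<lambda>x. snd (p x)) \<in> Qq.L2q" using m by (simp add: Qq.L2q_def)
next
  assume "(\<lambda>x. fst (p x)) \<in> vq.L2q" "(\<lambda>x. snd (p x)) \<in> Qq.L2q"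
  moreover have "p \<in> borel_measurable dx"
    if "(\<lambda>x. fst (p x)) \<in> borel_measurable dx" "(\<lambda>x. snd (p x)) \<in> borel_measurable dx"
    using borel_measurable_Pair[OF that] by simp
  ultimately show "p \<in> pr.L2q" by (auto simp: pr.L2q_def vq.L2q_def Qq.L2q_def)
qed

lemma pr_norms:
  assumes p: "p \<in> pr.L2q"
  shows "(pr.nrm p)\<^sup>2 = (L2_norm v D (\<lambda>x. fst (p x)))\<^sup>2 + (QL2_norm Q D (\<lambda>x. snd (p x)))\<^sup>2" (is ?sq)
    and "L2_norm v D (\<lambda>x. fst (p x)) \<le> pr.nrm p"
    and "QL2_norm Q D (\<lambda>x. snd (p x)) \<le> pr.nrm p"
    and "pr.nrm p \<le> QH_norm v Q D (\<lambda>x. fst (p x), \<lambda>x. snd (p x))"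
    and "QH_norm v Q D (\<lambda>x. fst (p x), \<lambda>x. snd (p x)) \<le> 2 * pr.nrm p"
proof -
  have u: "(\<lambda>x. fst (p x)) \<in> vq.L2q" and w: "(\<lambda>x. snd (p x)) \<in> Qq.L2q" using p by (auto simp: pr_iff)
  have "pr.ipq p p = vq.ipq (\<lambda>x. fst (p x)) (\<lambda>x. fst (p x)) + Qq.ipq (\<lambda>x. snd (p x)) (\<lambda>x. snd (p x))"
    unfolding pr.ipq_def vq.ipq_def Qq.ipq_def
    by (intro Bochner_Integration.integral_add vq.q_integrable Qq.q_integrable u w)
  then show sq: ?sq
    using p u w by (simp add: pr.nrm_square vq.nrm_square Qq.nrm_square QL2_norm_eq L2_norm_real_eq vq.L2q_def)
  have n: "0 \<le> pr.nrm p" using p by simp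
  show 1: "L2_norm v D (\<lambda>x. fst (p x)) \<le> pr.nrm p"
    using sq n by (intro power2_le_imp_le[OF _ n]) simp
  show 2: "QL2_norm Q D (\<lambda>x. snd (p x)) \<le> pr.nrm p"
    using sq n by (intro power2_le_imp_le[OF _ n]) simp
  show "pr.nrm p \<le> QH_norm v Q D (\<lambda>x. fst (p x), \<lambda>x. snd (p x))"
  proof (rule power2_le_imp_le)
    show "(pr.nrm p)\<^sup>2 \<le> (QH_norm v Q D (\<lambda>x. fst (p x), \<lambda>x. snd (p x)))\<^sup>2"
      by (simp add: sq QH_norm_def power2_sum L2_norm_nonneg QL2_norm_nonneg)
  qed (simp add: QH_norm_def L2_norm_nonneg QL2_norm_nonneg)
  show "QH_norm v Q D (\<lambda>x. fst (p x), \<lambda>x. snd (p x)) \<le> 2 * pr.nrm p"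
    using 1 2 by (simp add: QH_norm_def)
qed

lemma QLip0D: "\<phi> \<in> QLip0 v Q D \<Longrightarrow> \<phi> \<in> QLip_loc v Q D" "\<phi> \<in> QLip0 v Q D \<Longrightarrow> \<phi> \<in> Lip0 D"
  using QLip0_subset by (auto simp: QLip0_def)

lemma graph_L2q: "\<phi> \<in> QLip_loc v Q D \<Longrightarrow> graph \<phi> \<in> pr.L2q"
  by (simp add: pr_iff graph_def QLip_locD)

lemma W_iff: "p \<in> W \<longleftrightarrow> p \<in> pr.L2q \<and> (\<forall>e>0. \<exists>\<phi>\<in>QLip0 v Q D. pr.nrm (p - graph \<phi>) < e)"
proof -
  have "(\<forall>e>0. \<exists>\<phi>\<in>QLip0 v Q D. pr.nrm (p - graph \<phi>) < e) \<longleftrightarrow>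
    (\<forall>e>0. \<exists>\<phi>\<in>QLip0 v Q D. QH_norm v Q D (\<lambda>x. fst (p x) - \<phi> x, \<lambda>x. snd (p x) - grad \<phi> x) < e)"
    if p: "p \<in> pr.L2q"
  proof -
    have le: "pr.nrm (p - graph \<phi>) \<le> QH_norm v Q D (\<lambda>x. fst (p x) - \<phi> x, \<lambda>x. snd (p x) - grad \<phi> x)"
      "QH_norm v Q D (\<lambda>x. fst (p x) - \<phi> x, \<lambda>x. snd (p x) - grad \<phi> x) \<le> 2 * pr.nrm (p - graph \<phi>)"
      if "\<phi> \<in> QLip0 v Q D" for \<phi>
      using pr_norms(4,5)[OF pr.mem(2)[OF p graph_L2q[OF QLip0D(1)[OF that]]]]
      by (simp_all add: graph_def)
    show ?thesis
    proof (intro iffI allI impI)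
      fix e :: real assume "0 < e" and "\<forall>e>0. \<exists>\<phi>\<in>QLip0 v Q D. pr.nrm (p - graph \<phi>) < e"
      then obtain \<phi> where "\<phi> \<in> QLip0 v Q D" "pr.nrm (p - graph \<phi>) < e / 2"
        by (meson half_gt_zero)
      then show "\<exists>\<phi>\<in>QLip0 v Q D. QH_norm v Q D (\<lambda>x. fst (p x) - \<phi> x, \<lambda>x. snd (p x) - grad \<phi> x) < e"
        using le(2)[of \<phi>] by (intro bexI[of _ \<phi>]) auto
    next
      fix e :: real
      assume "0 < e" and "\<forall>e>0. \<exists>\<phi>\<in>QLip0 v Q D.
          QH_norm v Q D (\<lambda>x. fst (p x) - \<phi> x, \<lambda>x. snd (p x) - grad \<phi> x) < e"
      then show "\<exists>\<phi>\<in>QLip0 v Q D. pr.nrm (p - graph \<phi>) < e"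
        using le(1) by (meson le_less_trans)
    qed
  qed
  then show ?thesis
    by (auto simp: W_def QH12_0_def QH_closure_def pr_iff L2_real_iff QL2_iff)
qed

lemma graph_W: "\<phi> \<in> QLip0 v Q D \<Longrightarrow> graph \<phi> \<in> W"
  unfolding W_iff using graph_L2q[OF QLip0D(1)] pr.nrm_zero
  by (auto intro!: bexI[of _ \<phi>] simp: zero_fun_def)

lemma QLip0_add:
  assumes \<phi>: "\<phi> \<in> QLip0 v Q D" and \<psi>: "\<psi> \<in> QLip0 v Q D"
  shows "(\<lambda>x. \<phi> x + \<psi> x) \<in> QLip0 v Q D"
    and "AE x in dx. grad (\<lambda>x. \<phi> x + \<psi> x) x = grad \<phi> x + grad \<psi> x"
proof -
  note \<phi>D = QLip_locD[OF QLip0D(1)[OF \<phi>]] and \<psi>D = QLip_locD[OF QLip0D(1)[OF \<psi>]]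
  show ae: "AE x in dx. grad (\<lambda>x. \<phi> x + \<psi> x) x = grad \<phi> x + grad \<psi> x"
    using \<phi>D(6) \<psi>D(6) by eventually_elim (rule grad_add)
  have "grad \<phi> + grad \<psi> \<in> QL2 Q D" using Qq.mem(1)[OF \<phi>D(3) \<psi>D(3)] by (simp add: QL2_iff)
  then have "grad (\<lambda>x. \<phi> x + \<psi> x) \<in> QL2 Q D"
    by (rule QL2_AE_cong) (use ae in \<open>auto elim: eventually_mono\<close>)
  moreover have "(\<lambda>x. \<phi> x + \<psi> x) \<in> L2 v D"
    using vq.mem(1)[OF \<phi>D(2) \<psi>D(2)] by (simp add: L2_real_iff plus_fun_def)
  ultimately show "(\<lambda>x. \<phi> x + \<psi> x) \<in> QLip0 v Q D"
    using Lip0_add QLip0D(2) \<phi> \<psi> by (auto simp: QLip0_def)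
qed

lemma QLip0_scale:
  assumes \<phi>: "\<phi> \<in> QLip0 v Q D"
  shows "(\<lambda>x. c * \<phi> x) \<in> QLip0 v Q D"
    and "AE x in dx. grad (\<lambda>x. c * \<phi> x) x = c *\<^sub>R grad \<phi> x"
proof -
  note \<phi>D = QLip_locD[OF QLip0D(1)[OF \<phi>]]
  show ae: "AE x in dx. grad (\<lambda>x. c * \<phi> x) x = c *\<^sub>R grad \<phi> x"
    using \<phi>D(6) by eventually_elim (rule grad_scale)
  have "c *\<^sub>R grad \<phi> \<in> QL2 Q D" using Qq.mem(3)[OF \<phi>D(3)] by (simp add: QL2_iff)
  then have "grad (\<lambda>x. c * \<phi> x) \<in> QL2 Q D"
    by (rule QL2_AE_cong) (use ae in \<open>auto elim: eventually_mono\<close>)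
  moreover have "(\<lambda>x. c * \<phi> x) \<in> L2 v D"
    using vq.mem(3)[OF \<phi>D(2)] by (simp add: L2_real_iff scaleR_fun_def)
  ultimately show "(\<lambda>x. c * \<phi> x) \<in> QLip0 v Q D"
    using Lip0_scale QLip0D(2) \<phi> by (auto simp: QLip0_def)
qed

lemma QLip0_square:
  assumes \<phi>: "\<phi> \<in> QLip0 v Q D"
  shows "(\<lambda>x. (\<phi> x)\<^sup>2) \<in> QLip0 v Q D"
    and "AE x in dx. grad (\<lambda>x. (\<phi> x)\<^sup>2) x = (2 * \<phi> x) *\<^sub>R grad \<phi> x"
proof -
  note \<phi>D = QLip_locD[OF QLip0D(1)[OF \<phi>]]
  obtain B where B: "0 \<le> B" "\<And>x. x \<in> D \<Longrightarrow> \<bar>\<phi> x\<bar> \<le> B"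
    using Lip0_bounded[OF QLip0D(2)[OF \<phi>]] by metis
  show ae: "AE x in dx. grad (\<lambda>x. (\<phi> x)\<^sup>2) x = (2 * \<phi> x) *\<^sub>R grad \<phi> x"
    using \<phi>D(6) by eventually_elim (erule grad_compose, auto intro!: derivative_eq_intros)
  have "(\<lambda>x. (2 * \<phi> x) *\<^sub>R grad \<phi> x) \<in> QL2 Q D"
    unfolding QL2_iff
    by (rule Qq.L2q_bounded_multiplier[OF \<phi>D(3), where B = "2 * B"]) (use \<phi>D(4) B in \<open>auto simp: abs_mult\<close>)
  then have "grad (\<lambda>x. (\<phi> x)\<^sup>2) \<in> QL2 Q D"
    by (rule QL2_AE_cong) (use ae in \<open>auto elim: eventually_mono\<close>)
  moreover have "(\<lambda>x. \<phi> x *\<^sub>R \<phi> x) \<in> vq.L2q"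
    by (rule vq.L2q_bounded_multiplier[OF \<phi>D(2,4), where B = B]) (use B in auto)
  ultimately show "(\<lambda>x. (\<phi> x)\<^sup>2) \<in> QLip0 v Q D"
    using Lip0_square QLip0D(2) \<phi> by (auto simp: QLip0_def L2_real_iff power2_eq_square)
qed

lemma W_subset: "W \<subseteq> pr.L2q" by (auto simp: W_iff)

text \<open>The graph of \<open>grad\<close> over \<open>QLip0\<close> need not be closed under addition, because \<open>grad\<close> is additive only almost
  everywhere. The norm does not see the difference, so the closure is a subspace.\<close>

lemma W_subspace: "subspace W"
  unfolding subspace_def
proof (intro conjI ballI allI)
  show add: "p + p' \<in> W" if p: "p \<in> W" and p': "p' \<in> W" for p p'
    unfolding W_iff
  proof (intro conjI allI impI)
    have L: "p \<in> pr.L2q" "p' \<in> pr.L2q" using p p' W_subset by auto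
    then show "p + p' \<in> pr.L2q" by (rule pr.mem(1))
    fix e :: real assume "0 < e"
    then obtain \<phi> \<psi> where \<phi>: "\<phi> \<in> QLip0 v Q D" "pr.nrm (p - graph \<phi>) < e / 2"
      and \<psi>: "\<psi> \<in> QLip0 v Q D" "pr.nrm (p' - graph \<psi>) < e / 2"
      using p p' unfolding W_iff by (meson half_gt_zero)
    have g: "graph \<phi> \<in> pr.L2q" "graph \<psi> \<in> pr.L2q" using \<phi> \<psi> graph_L2q QLip0D by auto
    let ?s = "\<lambda>x. \<phi> x + \<psi> x"
    have s: "graph ?s \<in> pr.L2q" using QLip0_add(1)[OF \<phi>(1) \<psi>(1)] graph_L2q QLip0D by auto
    have "pr.nrm (p + p' - graph ?s) = pr.nrm ((p - graph \<phi>) + (p' - graph \<psi>))"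
    proof (rule pr.L2q_AE_cong(2))
      show "(p - graph \<phi>) + (p' - graph \<psi>) \<in> pr.L2q" using L g pr.mem by blast
      have "p + p' - graph ?s \<in> pr.L2q" using L s pr.mem by blast
      then show "p + p' - graph ?s \<in> borel_measurable dx" unfolding pr.L2q_def by blast
      show "AE x in dx. (p - graph \<phi> + (p' - graph \<psi>)) x = (p + p' - graph ?s) x"
        using QLip0_add(2)[OF \<phi>(1) \<psi>(1)]
        by eventually_elim (simp add: graph_def prod_eq_iff)
    qed
    also have "\<dots> \<le> pr.nrm (p - graph \<phi>) + pr.nrm (p' - graph \<psi>)"
      using L g pr.mem by (intro pr.nrm_triangle) blast+
    also have "\<dots> < e" using \<phi>(2) \<psi>(2) by linarith
    finally show "\<exists>\<phi>\<in>QLip0 v Q D. pr.nrm (p + p' - graph \<phi>) < e"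
      using QLip0_add(1)[OF \<phi>(1) \<psi>(1)] by blast
  qed
  show scale: "c *\<^sub>R p \<in> W" if p: "p \<in> W" for c p
    unfolding W_iff
  proof (intro conjI allI impI)
    have L: "p \<in> pr.L2q" using p W_subset by auto
    then show "c *\<^sub>R p \<in> pr.L2q" by (rule pr.mem(3))
    fix e :: real assume e: "0 < e"
    then have "0 < e / (\<bar>c\<bar> + 1)" by simp
    then obtain \<phi> where \<phi>: "\<phi> \<in> QLip0 v Q D" "pr.nrm (p - graph \<phi>) < e / (\<bar>c\<bar> + 1)"
      using p unfolding W_iff by meson
    have g: "graph \<phi> \<in> pr.L2q" using \<phi> graph_L2q QLip0D by auto
    let ?s = "\<lambda>x. c * \<phi> x"
    have s: "graph ?s \<in> pr.L2q" using QLip0_scale(1)[OF \<phi>(1)] graph_L2q QLip0D by auto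
    have "pr.nrm (c *\<^sub>R p - graph ?s) = pr.nrm (c *\<^sub>R (p - graph \<phi>))"
    proof (rule pr.L2q_AE_cong(2))
      show "c *\<^sub>R (p - graph \<phi>) \<in> pr.L2q" using L g pr.mem by blast
      have "c *\<^sub>R p - graph ?s \<in> pr.L2q" using L s pr.mem by blast
      then show "c *\<^sub>R p - graph ?s \<in> borel_measurable dx" unfolding pr.L2q_def by blast
      show "AE x in dx. (c *\<^sub>R (p - graph \<phi>)) x = (c *\<^sub>R p - graph ?s) x"
        using QLip0_scale(2)[OF \<phi>(1)]
        by eventually_elim (simp add: graph_def prod_eq_iff algebra_simps)
    qed
    also have "\<dots> = \<bar>c\<bar> * pr.nrm (p - graph \<phi>)"
      using L g pr.mem by (intro pr.nrm_scale) blast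
    also have "\<dots> \<le> \<bar>c\<bar> * (e / (\<bar>c\<bar> + 1))" using \<phi>(2) by (intro mult_left_mono) auto
    also have "\<dots> < e" using e by (simp add: field_simps)
    finally show "\<exists>\<phi>\<in>QLip0 v Q D. pr.nrm (c *\<^sub>R p - graph \<phi>) < e"
      using QLip0_scale(1)[OF \<phi>(1)] by blast
  qed
  have "(\<lambda>x. 0) \<in> QLip0 v Q D"
  proof -
    have "grad (\<lambda>x::real^'n. 0) = (\<lambda>x. 0)" by (intro ext grad_eqI) simp
    moreover have "(\<lambda>x. 0) \<in> Lip0 D" by (auto simp: Lip0_def intro!: lipschitz_on_constant)
    ultimately show ?thesis
      using vq.mem(4) Qq.mem(4) by (simp add: QLip0_def L2_real_iff QL2_iff zero_fun_def)
  qed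
  from scale[OF graph_W[OF this], of 0] show "0 \<in> W" by simp
qed

text \<open>A limit exists in the complete space of pairs, and \<open>W\<close> is closed there by definition.\<close>

lemma W_hilbert: "semi_hilbert_space W pr.ipq"
proof -
  have inner: "semi_inner_space W pr.ipq"
    by unfold_locales
      (use W_subspace W_subset pr.ip_sym pr.ip_add pr.ip_scale pr.ip_nonneg in \<open>auto simp: subset_iff\<close>)
  show ?thesis
  proof (intro semi_hilbert_space.intro inner semi_hilbert_space_axioms.intro)
    fix X :: "nat \<Rightarrow> _" and r C :: real
    assume X: "\<And>n. X n \<in> W" and r: "0 < r" "r < 1"
      and fast: "\<And>n. pr.nrm (X (Suc n) - X n) \<le> C * r ^ n"
    have XL: "X n \<in> pr.L2q" for n using X W_subset by auto
    obtain g where g: "g \<in> pr.L2q" "(\<lambda>n. pr.nrm (X n - g)) \<longlonglongrightarrow> 0"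
      using pr.L2q_complete[OF XL r fast] by blast
    have "g \<in> W"
      unfolding W_iff
    proof (intro conjI allI impI)
      fix e :: real assume "0 < e"
      then have e2: "0 < e / 2" by simp
      obtain n where n: "pr.nrm (X n - g) < e / 2"
        using order_tendstoD(2)[OF g(2) e2] by (meson eventually_sequentially order_refl)
      obtain \<phi> where \<phi>: "\<phi> \<in> QLip0 v Q D" "pr.nrm (X n - graph \<phi>) < e / 2"
        using X[of n] e2 unfolding W_iff by meson
      have "pr.nrm (g - graph \<phi>) \<le> pr.nrm (g - X n) + pr.nrm (X n - graph \<phi>)"
        using g(1) XL \<phi>(1) graph_L2q QLip0D by (intro pr.nrm_triangle_diff) auto
      also have "pr.nrm (g - X n) = pr.nrm (X n - g)" by (rule pr.nrm_minus_commute[OF g(1) XL])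
      finally have "pr.nrm (g - graph \<phi>) < e" using n \<phi>(2) by linarith
      then show "\<exists>\<phi>\<in>QLip0 v Q D. pr.nrm (g - graph \<phi>) < e" using \<phi>(1) by blast
    qed (rule g(1))
    then show "\<exists>x\<in>W. (\<lambda>n. pr.nrm (X n - x)) \<longlonglongrightarrow> 0" using g(2) by blast
  qed
qed

sublocale W: semi_hilbert_space W pr.ipq by (rule W_hilbert)

lemma W_QH12: "p \<in> W \<Longrightarrow> (\<lambda>x. fst (p x), \<lambda>x. snd (p x)) \<in> QH12 v Q D"
  using QLip0_subset unfolding W_def QH12_0_def QH12_def QH_closure_def by blast

end

section \<open>The Dirichlet problem\<close>

lemma vfields_add: "vfields R (\<lambda>x. w x + w' x) x = vfields R w x + vfields R w' x"
  by (simp add: vfields_def vec_eq_iff inner_add_right)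

lemma vfields_scale: "vfields R (\<lambda>x. c *\<^sub>R w x) x = c *\<^sub>R vfields R w x"
  by (simp add: vfields_def vec_eq_iff)

text \<open>The Dirichlet problem with constants \<open>CT\<close> chosen for the fields \<open>T\<close> and a nonnegative constant \<open>s\<close> in the
  Sobolev inequality.\<close>

locale dirichlet_problem = degenerate_setting D v Q
  for D :: "(real^'n) set" and v :: "real^'n \<Rightarrow> real" and Q :: "real^'n \<Rightarrow> real^'n^'n" +
  fixes f F :: "real^'n \<Rightarrow> real" and G H g :: "real^'n \<Rightarrow> real^'m"
    and R S T :: "'m \<Rightarrow> real^'n \<Rightarrow> real^'n" and CR CS CT :: "'m \<Rightarrow> real" and s :: real
  assumes f: "f \<in> L2 v D" and g: "g \<in> L2 v D"
    and F: "F \<in> Linf v D" and H: "H \<in> Linf v D" and G: "G \<in> Linf v D"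
    and R: "\<And>i. subunit_const v Q D (R i) (CR i)"
    and S: "\<And>i. subunit_const v Q D (S i) (CS i)"
    and T: "\<And>i. subunit_const v Q D (T i) (CT i)"
    and sign: "\<And>\<phi>. \<lbrakk>\<phi> \<in> QLip0 v Q D; \<forall>x\<in>D. 0 \<le> \<phi> x\<rbrakk> \<Longrightarrow>
           0 \<le> (LINT x|wmeasure v D. G x \<bullet> vfields S (grad \<phi>) x + F x * \<phi> x)"
    and sobolev: "\<And>\<phi>. \<phi> \<in> QLip0 v Q D \<Longrightarrow> L2_norm v D \<phi> \<le> s * QL2_norm Q D (grad \<phi>)"
    and s: "0 \<le> s"
    and small: "max (tuple_const CR) (tuple_const CS) * s * (Linf_norm v D G + Linf_norm v D H) < 1"
begin

definition form :: "(real^'n \<Rightarrow> real \<times> (real^'n)) \<Rightarrow> (real^'n \<Rightarrow> real \<times> (real^'n)) \<Rightarrow> real" where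
  "form p r = (LINT x|dx. (Q x *v snd (p x)) \<bullet> snd (r x))
    + (LINT x|vdx. (H x \<bullet> vfields R (\<lambda>x. snd (p x)) x) * fst (r x))
    + (LINT x|vdx. fst (p x) * (G x \<bullet> vfields S (\<lambda>x. snd (r x)) x))
    + (LINT x|vdx. F x * fst (p x) * fst (r x))"

definition load :: "(real^'n \<Rightarrow> real \<times> (real^'n)) \<Rightarrow> real" where
  "load r = (LINT x|vdx. f x * fst (r x)) + (LINT x|vdx. g x \<bullet> vfields T (\<lambda>x. snd (r x)) x)"

lemma weak_solution_iff:
  "degenerate_weak_solution D v Q H R G S F f g T (u, w) \<longleftrightarrow>
    (\<lambda>x. (u x, w x)) \<in> W \<and>
    (\<forall>\<phi>\<in>QLip0 v Q D. form (\<lambda>x. (u x, w x)) (graph \<phi>) = load (graph \<phi>))"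
  by (simp add: degenerate_weak_solution_def W_def form_def load_def graph_def)

lemma W_components:
  assumes "p \<in> W"
  shows "(\<lambda>x. fst (p x)) \<in> L2 v D" "(\<lambda>x. snd (p x)) \<in> Qq.L2q"
    "L2_norm v D (\<lambda>x. fst (p x)) \<le> pr.nrm p" "QL2_norm Q D (\<lambda>x. snd (p x)) \<le> pr.nrm p"
proof -
  have p: "p \<in> pr.L2q" using assms W_subset by auto
  show "(\<lambda>x. fst (p x)) \<in> L2 v D" "(\<lambda>x. snd (p x)) \<in> Qq.L2q"
    using p by (auto simp: pr_iff L2_real_iff)
  show "L2_norm v D (\<lambda>x. fst (p x)) \<le> pr.nrm p" "QL2_norm Q D (\<lambda>x. snd (p x)) \<le> pr.nrm p"
    using pr_norms(2,3)[OF p] by auto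
qed

lemma tuple_const_nonneg: "0 \<le> tuple_const c"
  by (simp add: tuple_const_def sum_nonneg)

lemma Linf_norm_nonneg: "A \<in> Linf v D \<Longrightarrow> 0 \<le> Linf_norm v D A"
  unfolding Linf_norm_def by (intro esssup_norm_nonneg) (simp add: Linf_def)

lemma W_vfields:
  assumes X: "\<And>i. subunit_const v Q D (X i) (c i)" and p: "p \<in> W"
  shows "vfields X (\<lambda>x. snd (p x)) \<in> L2 v D"
    "L2_norm v D (vfields X (\<lambda>x. snd (p x))) \<le> 2 * tuple_const c * pr.nrm p"
proof -
  note b = vfields_QH12_bound[of X c, OF X W_QH12[OF p]]
  show "vfields X (\<lambda>x. snd (p x)) \<in> L2 v D" by (rule b(1))
  have "p \<in> pr.L2q" using p W_subset by auto
  from mult_left_mono[OF pr_norms(5)[OF this] tuple_const_nonneg[of c]] b(2)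
  show "L2_norm v D (vfields X (\<lambda>x. snd (p x))) \<le> 2 * tuple_const c * pr.nrm p" by simp
qed

lemma form_integrable:
  assumes p: "p \<in> W" and r: "r \<in> W"
  shows "integrable dx (\<lambda>x. (Q x *v snd (p x)) \<bullet> snd (r x))"
    and "integrable vdx (\<lambda>x. (H x \<bullet> vfields R (\<lambda>x. snd (p x)) x) * fst (r x))"
    and "integrable vdx (\<lambda>x. fst (p x) * (G x \<bullet> vfields S (\<lambda>x. snd (r x)) x))"
    and "integrable vdx (\<lambda>x. F x * fst (p x) * fst (r x))"
  using Qq.q_integrable[OF W_components(2)[OF p] W_components(2)[OF r]]
    Linf_triple(1)[OF H W_vfields(1)[of R CR, OF R p] W_components(1)[OF r]]
    Linf_triple(1)[OF G W_vfields(1)[of S CS, OF S r] W_components(1)[OF p]]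
    Linf_triple(1)[OF F W_components(1)[OF p] W_components(1)[OF r]]
  by (simp_all add: mult.commute)

lemma form_add:
  assumes p: "p \<in> W" and p': "p' \<in> W" and r: "r \<in> W"
  shows "form (p + p') r = form p r + form p' r"
    and "form r (p + p') = form r p + form r p'"
  unfolding form_def
  by (simp_all add: form_integrable[OF p r] form_integrable[OF p' r] form_integrable[OF r p]
      form_integrable[OF r p'] matrix_vector_right_distrib vfields_add inner_add_left inner_add_right
      distrib_left distrib_right)

lemma form_scale: "form (c *\<^sub>R p) r = c * form p r" "form p (c *\<^sub>R r) = c * form p r"
  unfolding form_def
  by (simp_all add: matrix_vector_mult_scaleR vfields_scale distrib_left mult_ac)

lemma form_bounded:
  assumes p: "p \<in> W" and r: "r \<in> W"
  shows "\<bar>form p r\<bar> \<le> (1 + 2 * Linf_norm v D H * tuple_const CR + 2 * Linf_norm v D G * tuple_const CS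
      + Linf_norm v D F) * pr.nrm p * pr.nrm r"
proof -
  have n: "0 \<le> pr.nrm p" "0 \<le> pr.nrm r" using p r W_subset by auto
  note cp = W_components[OF p] and cr = W_components[OF r]
  have 1: "\<bar>LINT x|dx. (Q x *v snd (p x)) \<bullet> snd (r x)\<bar> \<le> pr.nrm p * pr.nrm r"
  proof -
    have "\<bar>LINT x|dx. (Q x *v snd (p x)) \<bullet> snd (r x)\<bar> \<le> Qq.nrm (\<lambda>x. snd (p x)) * Qq.nrm (\<lambda>x. snd (r x))"
      using Qq.ip_Cauchy_Schwarz[OF cp(2) cr(2)] by (simp add: Qq.ipq_def)
    also have "\<dots> \<le> pr.nrm p * pr.nrm r"
      using cp(4) cr(4) cr(2) n by (intro mult_mono) (auto simp: QL2_norm_eq)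
    finally show ?thesis .
  qed
  have "\<bar>LINT x|vdx. (H x \<bullet> vfields R (\<lambda>x. snd (p x)) x) * fst (r x)\<bar>
      \<le> Linf_norm v D H * (2 * tuple_const CR * pr.nrm p * pr.nrm r)"
    using Linf_triple(2)[OF H W_vfields(1)[of R CR, OF R p] cr(1)]
    by (rule order_trans) (intro mult_left_mono mult_mono W_vfields(2)[of R CR, OF R p] cr
        L2_norm_nonneg Linf_norm_nonneg H n mult_nonneg_nonneg tuple_const_nonneg; simp)
  moreover have "\<bar>LINT x|vdx. fst (p x) * (G x \<bullet> vfields S (\<lambda>x. snd (r x)) x)\<bar>
      \<le> Linf_norm v D G * (2 * tuple_const CS * pr.nrm r * pr.nrm p)"
    using Linf_triple(2)[OF G W_vfields(1)[of S CS, OF S r] cp(1)] unfolding mult.commute[of "fst (p _)"]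
    by (rule order_trans) (intro mult_left_mono mult_mono W_vfields(2)[of S CS, OF S r] cp
        L2_norm_nonneg Linf_norm_nonneg G n mult_nonneg_nonneg tuple_const_nonneg; simp)
  moreover have "\<bar>LINT x|vdx. F x * fst (p x) * fst (r x)\<bar> \<le> Linf_norm v D F * (pr.nrm p * pr.nrm r)"
    using Linf_triple(2)[OF F cp(1) cr(1)] unfolding inner_real_def
    by (rule order_trans) (intro mult_left_mono mult_mono cp cr L2_norm_nonneg Linf_norm_nonneg F n)
  ultimately show ?thesis using 1 unfolding form_def by (simp add: algebra_simps)
qed

lemma load_add:
  assumes p: "p \<in> W" and p': "p' \<in> W"
  shows "load (p + p') = load p + load p'"
proof -
  note f_pair = L2_pairing(1)[OF f W_components(1), unfolded inner_real_def]
  note g_pair = L2_pairing(1)[OF g W_vfields(1)[of T CT, OF T]]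
  show ?thesis
    unfolding load_def
    by (simp add: f_pair[OF p] f_pair[OF p'] g_pair[OF p] g_pair[OF p'] vfields_add
        inner_add_right distrib_left)
qed

lemma load_scale: "load (c *\<^sub>R p) = c * load p"
  unfolding load_def by (simp add: vfields_scale distrib_left mult_ac)

lemma load_bounded:
  assumes p: "p \<in> W"
  shows "\<bar>load p\<bar> \<le> (L2_norm v D f + 2 * L2_norm v D g * tuple_const CT) * pr.nrm p"
proof -
  have "\<bar>LINT x|vdx. f x * fst (p x)\<bar> \<le> L2_norm v D f * pr.nrm p"
    using L2_pairing(2)[OF f W_components(1)[OF p], unfolded inner_real_def]
    by (rule order_trans) (intro mult_left_mono W_components p L2_norm_nonneg)
  moreover have "\<bar>LINT x|vdx. g x \<bullet> vfields T (\<lambda>x. snd (p x)) x\<bar>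
      \<le> L2_norm v D g * (2 * tuple_const CT * pr.nrm p)"
    using L2_pairing(2)[OF g W_vfields(1)[of T CT, OF T p]]
    by (rule order_trans) (intro mult_left_mono W_vfields(2)[of T CT, OF T p] L2_norm_nonneg)
  ultimately show ?thesis
    unfolding load_def by (simp add: algebra_simps)
qed

definition \<theta> :: real where
  "\<theta> = max (tuple_const CR) (tuple_const CS) * s * (Linf_norm v D G + Linf_norm v D H)"

text \<open>Let \<open>N\<close> be the norm of the gradient and \<open>t1\<close>, \<open>t2\<close>, \<open>t3\<close> the terms of \<open>H\<close>, \<open>G\<close> and \<open>F\<close>. The sign condition for \<open>\<phi>\<^sup>2\<close> reads
  \<open>2 t2 + t3 \<ge> 0\<close>, so the form is at least \<open>N\<^sup>2 - \<bar>t1\<bar> - \<bar>t2\<bar>\<close>. Since the subunit fields are bounded by \<open>N\<close> alone and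
  \<open>\<parallel>\<phi>\<parallel> \<le> s N\<close>, this is at least \<open>(1 - \<theta>) N\<^sup>2\<close>, and \<open>N\<^sup>2\<close> is at least the square of the norm of \<open>W\<close> divided by \<open>1 + s\<^sup>2\<close>.\<close>

lemma form_coercive:
  assumes \<phi>: "\<phi> \<in> QLip0 v Q D"
  shows "(1 - \<theta>) / (1 + s\<^sup>2) * (pr.nrm (graph \<phi>))\<^sup>2 \<le> form (graph \<phi>) (graph \<phi>)"
proof -
  note \<phi>l = QLip0D(1)[OF \<phi>]
  note W\<phi> = graph_W[OF \<phi>]
  define N where "N = QL2_norm Q D (grad \<phi>)"
  define m where "m = max (tuple_const CR) (tuple_const CS)"
  have N: "0 \<le> N" by (simp add: N_def QL2_norm_nonneg)
  have m: "0 \<le> m" "tuple_const CR \<le> m" "tuple_const CS \<le> m"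
    using tuple_const_nonneg[of CR] by (auto simp: m_def)
  have \<phi>N: "L2_norm v D \<phi> \<le> s * N" using sobolev[OF \<phi>] by (simp add: N_def)
  define t1 where "t1 = (LINT x|vdx. (H x \<bullet> vfields R (grad \<phi>) x) * \<phi> x)"
  define t2 where "t2 = (LINT x|vdx. \<phi> x * (G x \<bullet> vfields S (grad \<phi>) x))"
  define t3 where "t3 = (LINT x|vdx. F x * \<phi> x * \<phi> x)"
  have form_eq: "form (graph \<phi>) (graph \<phi>) = N\<^sup>2 + t1 + t2 + t3"
  proof -
    have "(LINT x|dx. (Q x *v grad \<phi> x) \<bullet> grad \<phi> x) = N\<^sup>2"
      using QLip_locD(3)[OF \<phi>l] by (simp add: N_def QL2_norm_eq Qq.nrm_square Qq.ipq_def)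
    then show ?thesis by (simp add: form_def graph_def t1_def t2_def t3_def)
  qed
  have \<phi>L: "\<phi> \<in> L2 v D" using QLip_locD(2)[OF \<phi>l] by (simp add: L2_real_iff)
  have first_order: "\<bar>LINT x|vdx. (A x \<bullet> vfields X (grad \<phi>) x) * \<phi> x\<bar> \<le> Linf_norm v D A * (m * N * (s * N))"
    if A: "A \<in> Linf v D" and X: "\<And>i. subunit_const v Q D (X i) (c i)" and c: "tuple_const c \<le> m"
    for A :: "real^'n \<Rightarrow> real^'m" and X c
  proof -
    have V: "vfields X (grad \<phi>) \<in> L2 v D"
      using W_vfields(1)[of X c, OF X W\<phi>] by (simp add: graph_def)
    have "L2_norm v D (vfields X (grad \<phi>)) \<le> m * N"
      using order_trans[OF vfields_gradient_bound[of X c, OF X \<phi>l] mult_right_mono[OF c QL2_norm_nonneg]]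
      by (simp add: N_def)
    then show ?thesis
      using Linf_triple(2)[OF A V \<phi>L] \<phi>N m N s Linf_norm_nonneg[OF A]
      by (elim order_trans) (intro mult_left_mono mult_mono L2_norm_nonneg; simp)
  qed
  have t1: "\<bar>t1\<bar> \<le> Linf_norm v D H * (m * N * (s * N))"
    unfolding t1_def by (rule first_order[OF H R m(2)])
  have t2: "\<bar>t2\<bar> \<le> Linf_norm v D G * (m * N * (s * N))"
    unfolding t2_def mult.commute[of "\<phi> _"] by (rule first_order[OF G S m(3)])
  have t23: "0 \<le> 2 * t2 + t3"
  proof -
    have "0 \<le> (LINT x|vdx. G x \<bullet> vfields S (grad (\<lambda>x. (\<phi> x)\<^sup>2)) x + F x * (\<phi> x)\<^sup>2)"
      by (rule sign[OF QLip0_square(1)[OF \<phi>]]) simp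
    also have "\<dots> = (LINT x|vdx. 2 * (\<phi> x * (G x \<bullet> vfields S (grad \<phi>) x)) + F x * \<phi> x * \<phi> x)"
    proof (rule integral_cong_AE)
      have V: "vfields S (grad \<psi>) \<in> borel_measurable dx" if "\<psi> \<in> QLip0 v Q D" for \<psi>
        using W_vfields(1)[of S CS, OF S graph_W[OF that]] by (simp add: graph_def L2_iff)
      note [measurable] = V[OF \<phi>] V[OF QLip0_square(1)[OF \<phi>]] QLip_locD(4)[OF \<phi>l]
      have [measurable]: "G \<in> borel_measurable dx" "F \<in> borel_measurable dx"
        using G F by (auto simp: Linf_def)
      show "(\<lambda>x. G x \<bullet> vfields S (grad (\<lambda>x. (\<phi> x)\<^sup>2)) x + F x * (\<phi> x)\<^sup>2) \<in> borel_measurable vdx"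
        "(\<lambda>x. 2 * (\<phi> x * (G x \<bullet> vfields S (grad \<phi>) x)) + F x * \<phi> x * \<phi> x) \<in> borel_measurable vdx"
        unfolding vdx_meas by measurable
      show "AE x in vdx. G x \<bullet> vfields S (grad (\<lambda>x. (\<phi> x)\<^sup>2)) x + F x * (\<phi> x)\<^sup>2
          = 2 * (\<phi> x * (G x \<bullet> vfields S (grad \<phi>) x)) + F x * \<phi> x * \<phi> x"
        unfolding AE_vdx using QLip0_square(2)[OF \<phi>]
      proof eventually_elim
        case (elim x)
        have "vfields S (grad (\<lambda>x. (\<phi> x)\<^sup>2)) x = (2 * \<phi> x) *\<^sub>R vfields S (grad \<phi>) x"
          by (simp add: vfields_def elim vec_eq_iff)
        then show ?case by (simp add: power2_eq_square)
      qed
    qed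
    also have "\<dots> = 2 * t2 + t3"
      unfolding t2_def t3_def
      using form_integrable(3)[OF W\<phi> W\<phi>] form_integrable(4)[OF W\<phi> W\<phi>]
      by (simp add: graph_def)
    finally show ?thesis .
  qed
  have "N\<^sup>2 - \<theta> * N\<^sup>2 \<le> N\<^sup>2 + t1 + t2 + t3"
  proof -
    have "\<theta> * N\<^sup>2 = Linf_norm v D H * (m * N * (s * N)) + Linf_norm v D G * (m * N * (s * N))"
      by (simp add: \<theta>_def m_def power2_eq_square algebra_simps)
    then show ?thesis using t1 t2 t23 by linarith
  qed
  moreover have "(1 - \<theta>) / (1 + s\<^sup>2) * (pr.nrm (graph \<phi>))\<^sup>2 \<le> N\<^sup>2 - \<theta> * N\<^sup>2"
  proof -
    have "(L2_norm v D \<phi>)\<^sup>2 \<le> s\<^sup>2 * N\<^sup>2"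
      using power_mono[OF \<phi>N L2_norm_nonneg, of 2] by (simp add: power_mult_distrib)
    then have "(pr.nrm (graph \<phi>))\<^sup>2 \<le> (1 + s\<^sup>2) * N\<^sup>2"
      using pr_norms(1)[OF graph_L2q[OF \<phi>l]] by (simp add: graph_def N_def algebra_simps)
    then have "(1 - \<theta>) / (1 + s\<^sup>2) * (pr.nrm (graph \<phi>))\<^sup>2 \<le> (1 - \<theta>) / (1 + s\<^sup>2) * ((1 + s\<^sup>2) * N\<^sup>2)"
      using small by (intro mult_left_mono) (auto simp: \<theta>_def add_nonneg_nonneg)
    also have "\<dots> = N\<^sup>2 - \<theta> * N\<^sup>2"
    proof -
      have "a / b * (b * c) = a * c" if "b \<noteq> 0" for a b c :: real using that by simp
      moreover have "1 + s\<^sup>2 \<noteq> 0" by (metis add_pos_nonneg zero_le_power2 zero_less_one less_irrefl)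
      ultimately have "(1 - \<theta>) / (1 + s\<^sup>2) * ((1 + s\<^sup>2) * N\<^sup>2) = (1 - \<theta>) * N\<^sup>2" by blast
      then show ?thesis by (simp only: left_diff_distrib mult_1)
    qed
    finally show ?thesis .
  qed
  ultimately show ?thesis by (simp add: form_eq)
qed

theorem unique_weak_solution:
  shows "\<exists>u w. degenerate_weak_solution D v Q H R G S F f g T (u, w)"
    and "\<lbrakk>degenerate_weak_solution D v Q H R G S F f g T (u, w);
      degenerate_weak_solution D v Q H R G S F f g T (u', w')\<rbrakk>
      \<Longrightarrow> AE x in lebesgue_on D. u x = u' x \<and> w x = w' x"
proof -
  have c: "0 < (1 - \<theta>) / (1 + s\<^sup>2)"
    using small by (intro divide_pos_pos) (auto simp: \<theta>_def intro: add_pos_nonneg)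
  have dense: "\<exists>r\<in>graph ` QLip0 v Q D. pr.nrm (p - r) < e" if "p \<in> W" "0 < e" for p e
    using that by (simp add: W_iff)
  have sub: "graph ` QLip0 v Q D \<subseteq> W" using graph_W by auto
  have coercive: "(1 - \<theta>) / (1 + s\<^sup>2) * (pr.nrm r)\<^sup>2 \<le> form r r" if "r \<in> graph ` QLip0 v Q D" for r
    using that form_coercive by auto
  note LM = W.Lax_Milgram_dense[of form _ load _ "graph ` QLip0 v Q D",
      OF form_add(1) form_scale(1) form_add(2) form_scale(2) form_bounded
        load_add load_scale load_bounded sub dense c coercive]
  obtain p where "p \<in> W" "\<forall>y\<in>graph ` QLip0 v Q D. form p y = load y" using LM(1) by auto
  then have "degenerate_weak_solution D v Q H R G S F f g T (\<lambda>x. fst (p x), \<lambda>x. snd (p x))"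
    by (simp add: weak_solution_iff)
  then show "\<exists>u w. degenerate_weak_solution D v Q H R G S F f g T (u, w)" by blast
  assume sol: "degenerate_weak_solution D v Q H R G S F f g T (u, w)"
      "degenerate_weak_solution D v Q H R G S F f g T (u', w')"
  let ?p = "\<lambda>x. (u x, w x)" and ?p' = "\<lambda>x. (u' x, w' x)"
  have p: "?p \<in> W" "?p' \<in> W" using sol by (auto simp: weak_solution_iff)
  have "pr.nrm (?p - ?p') = 0"
    by (rule LM(2)) (use sol p in \<open>auto simp: weak_solution_iff\<close>)
  moreover have "?p - ?p' \<in> pr.L2q" using W.mem(2)[OF p] W_subset by blast
  ultimately have "AE x in dx. (?p - ?p') x = 0" by (simp only: pr.nrm_eq_0_iff_AE[symmetric])
  then show "AE x in lebesgue_on D. u x = u' x \<and> w x = w' x"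
    by eventually_elim (simp add: zero_prod_def)
qed

end


theorem theorem3p5:
  fixes \<Omega> \<Theta> :: "(real^'n) set"
    and v :: "real^'n \<Rightarrow> real" and Q :: "real^'n \<Rightarrow> real^'n^'n" and k :: real
    and f F :: "real^'n \<Rightarrow> real" and G H g :: "real^'n \<Rightarrow> real^'m"
    and R S T :: "'m \<Rightarrow> real^'n \<Rightarrow> real^'n"
    and CR CS :: "'m \<Rightarrow> real" and S21 :: real
    and \<rho> :: "real^'n \<Rightarrow> real^'n \<Rightarrow> real"
  assumes "bounded \<Omega>" "connected \<Omega>" "open \<Omega>"
    and "bounded \<Theta>" "open \<Theta>" "closure \<Omega> \<subseteq> \<Theta>"
    and "weight \<Theta> v" "matrix_function \<Theta> Q"
    and "integrable (lebesgue_on \<Omega>) v"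
    and "k > 0" "AE x in lebesgue_on \<Omega>. op_norm (Q x) \<le> k * v x"
    and "f \<in> L2 v \<Omega>" "F \<in> L2 v \<Omega>"
    and "G \<in> L2 v \<Omega>" "H \<in> L2 v \<Omega>" "g \<in> L2 v \<Omega>"
    and "\<And>i. subunit_const v Q \<Omega> (R i) (CR i)"
    and "\<And>i. subunit_const v Q \<Omega> (S i) (CS i)"
    and "\<And>i. degenerate_subunit v Q \<Omega> (T i)"
    and "\<And>\<phi>. \<phi> \<in> QLip0 v Q \<Omega> \<Longrightarrow> (\<forall>x\<in>\<Omega>. 0 \<le> \<phi> x) \<Longrightarrow>
           0 \<le> (LINT x|wmeasure v \<Omega>. G x \<bullet> vfields S (grad \<phi>) x + F x * \<phi> x)"
    and "\<And>\<phi>. \<phi> \<in> QLip0 v Q \<Omega> \<Longrightarrow> L2_norm v \<Omega> \<phi> \<le> S21 * QL2_norm Q \<Omega> (grad \<phi>)"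
    and "admissible_quasimetric \<Theta> \<rho>" "local_poincare \<Theta> \<rho> v Q"
    and "F \<in> Linf v \<Omega>" "H \<in> Linf v \<Omega>" "G \<in> Linf v \<Omega>"
    and "max (tuple_const CR) (tuple_const CS) * S21 * (Linf_norm v \<Omega> G + Linf_norm v \<Omega> H) < 1"
  shows "(\<exists>u w. degenerate_weak_solution \<Omega> v Q H R G S F f g T (u, w)) \<and>
    (\<forall>u w u' w'. degenerate_weak_solution \<Omega> v Q H R G S F f g T (u, w) \<and>
       degenerate_weak_solution \<Omega> v Q H R G S F f g T (u', w') \<longrightarrow>
       (AE x in lebesgue_on \<Omega>. u x = u' x \<and> w x = w' x))"
proof -
  have sub: "\<Omega> \<subseteq> \<Theta>" using \<open>closure \<Omega> \<subseteq> \<Theta>\<close> closure_subset by (rule order_trans[rotated])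
  have Omega: "\<Omega> \<in> sets lebesgue" using \<open>open \<Omega>\<close> by auto
  have Theta: "\<Theta> \<in> sets lebesgue" using \<open>open \<Theta>\<close> by auto
  have AE_sub: "AE x in lebesgue_on \<Omega>. P x" if "AE x in lebesgue_on \<Theta>. P x" for P
    using that sub Omega Theta by (auto simp: AE_restrict_space_iff elim!: eventually_mono)
  have meas_sub: "h \<in> borel_measurable (lebesgue_on \<Omega>)" if "h \<in> borel_measurable (lebesgue_on \<Theta>)"
    for h :: "real^'n \<Rightarrow> real"
    using that sub by (rule measurable_restrict_mono)
  have weight: "weight \<Omega> v"
    unfolding weight_def
  proof (intro conjI ballI)
    show "v \<in> borel_measurable (lebesgue_on \<Omega>)"
      by (rule meas_sub) (use \<open>weight \<Theta> v\<close> in \<open>simp add: weight_def\<close>)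
    show "0 \<le> v x" if "x \<in> \<Omega>" for x
      using \<open>weight \<Theta> v\<close> subsetD[OF sub that] by (simp add: weight_def)
    show "AE x in lebesgue_on \<Omega>. 0 < v x"
      by (rule AE_sub) (use \<open>weight \<Theta> v\<close> in \<open>simp add: weight_def\<close>)
  qed
  have matrix: "matrix_function \<Omega> Q"
    unfolding matrix_function_def
  proof (intro conjI ballI allI)
    show "pos_semidef (Q x)" if "x \<in> \<Omega>" for x
      using \<open>matrix_function \<Theta> Q\<close> subsetD[OF sub that] by (simp add: matrix_function_def)
    show "(\<lambda>x. Q x $ i $ j) \<in> borel_measurable (lebesgue_on \<Omega>)" for i j
      by (rule meas_sub) (use \<open>matrix_function \<Theta> Q\<close> in \<open>simp add: matrix_function_def\<close>)
    show "AE x in lebesgue_on \<Omega>. invertible (Q x)"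
      by (rule AE_sub) (use \<open>matrix_function \<Theta> Q\<close> in \<open>simp add: matrix_function_def\<close>)
  qed
  obtain CT where CT: "\<And>i. subunit_const v Q \<Omega> (T i) (CT i)"
    using \<open>\<And>i. degenerate_subunit v Q \<Omega> (T i)\<close> unfolding degenerate_subunit_def by metis
  \<comment> \<open>If \<open>S21\<close> is negative, the Sobolev inequality also holds with 0, and the smallness condition becomes \<open>0 < 1\<close>.\<close>
  define s where "s = max S21 0"
  have sob: "L2_norm v \<Omega> \<phi> \<le> s * QL2_norm Q \<Omega> (grad \<phi>)" if "\<phi> \<in> QLip0 v Q \<Omega>" for \<phi>
  proof -
    have "S21 * QL2_norm Q \<Omega> (grad \<phi>) \<le> s * QL2_norm Q \<Omega> (grad \<phi>)"
      by (intro mult_right_mono) (auto simp: s_def QL2_norm_def)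
    then show ?thesis using assms(21)[OF that] by linarith
  qed
  have small: "max (tuple_const CR) (tuple_const CS) * s * (Linf_norm v \<Omega> G + Linf_norm v \<Omega> H) < 1"
    using assms(27) by (cases "0 \<le> S21") (auto simp: s_def max_def)
  interpret dirichlet_problem \<Omega> v Q f F G H g R S T CR CS CT s
  proof unfold_locales
    show "0 \<le> s" by (simp add: s_def)
  qed (fact \<open>open \<Omega>\<close> weight matrix assms(9) assms(12) assms(16-18) assms(20) assms(24-26) CT sob small)+
  show ?thesis using unique_weak_solution by blast
qed

end
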